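(* Let $\mathcal{A}$ be a finite set and let $Q=(Q_{\alpha\beta})_{\alpha,\beta\in\mathcal{A}}$ be an integral symmetric matrix indexed by $\mathcal{A}$. Let $t=(t_\alpha)_{\alpha\in\mathcal{A}}$ be variables and set $$f_{\mathcal{A},Q}(t)=\frac{1}{1-\sum_{\alpha\in\mathcal{A}}(-1)^{Q_{\alpha\alpha}}t_\alpha},\qquad f_{\mathcal{A},Q}(t,q)=\sum_{k\in\mathbb{Z}_{\ge0}^{\mathcal{A}}}(-1)^{\mathrm{diag}(Q)k}\,q^{\frac12k^tQk+\frac12\mathrm{diag}(Q)k}\,\frac{(q;q)_{\sum_\alpha k_\alpha}}{\prod_\alpha(q;q)_{k_\alpha}}\prod_\alpha t_\alpha^{k_\alpha}.$$ Then $f_{\mathcal{A},Q}(t,q)$ is an element of the Habiro ring $\mathcal{H}_{R/\mathbb{Z}[t]}$ of the étale $\mathbb{Z}[t]$-algebra $R=\mathbb{Z}[t][f_{\mathcal{A},Q}(t)]$.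
   Context: Notation: $(q;q)_k=\prod_{i=1}^k(1-q^i)$, $\mathrm{diag}(Q)k=\sum_\alpha Q_{\alpha\alpha}k_\alpha$. Fix primitive $m$-th roots of unity $\zeta_m$ ($m\ge1$) with $\zeta_{mm'}=\zeta_m\zeta_{m'}$ for coprime $m,m'$ and $(\zeta_{p^r})^p=\zeta_{p^{r-1}}$ for primes $p$, $r\ge1$. Habiro ring: for an étale $\mathbb{Z}[t]$-algebra $R$, put $R_m=R[t^{1/m},\zeta_m]=R\otimes_{\mathbb{Z}[t]}\mathbb{Z}[t^{1/m},\zeta_m]$ (adjoining $m$-th roots of all variables $t_\alpha$). For a prime $p$, the Frobenius lift $t_\alpha\mapsto t_\alpha^p$ extends to the $p$-adic completion $R^\wedge_p$, and to $\varphi_p$ on $(R_{pm})^\wedge_p$ with $t_\alpha^{1/(pm)}\mapsto t_\alpha^{1/m}$, fixing $\zeta_{pm}$. The Habiro ring $\mathcal{H}_{R/\mathbb{Z}[t]}$ is the set of collections $(f_m(q-\zeta_m))_{m\ge1}\in\prod_{m\ge1}R_m[\![q-\zeta_m]\!]$ satisfying, for all $m\ge1$ and all primes $p$, $$f_m(q-\zeta_{pm}+(\zeta_{pm}-\zeta_m))=\varphi_pf_{pm}(q-\zeta_{pm})\in(R_{pm})^\wedge_p[\![q-\zeta_{pm}]\!].$$ A series $f(t,q)\in\mathbb{Z}[q^{\pm1}][\![t]\!]$ is regarded as an element of $\mathcal{H}_{R/\mathbb{Z}[t]}$ (for $R\subset\mathbb{Z}[\![t]\!]$) when the collection whose $m$-th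 member $f_m$ is the expansion of $f(t^{1/m},q)$ in powers of $q-\zeta_m$, a priori in $\mathbb{Z}[\zeta_m][\![t^{1/m}]\!][\![q-\zeta_m]\!]$, lies in it. *)

theory Defs
  imports
    "HOL-Computational_Algebra.Computational_Algebra"
    "HOL-Library.Poly_Mapping"
    "HOL-Algebra.QuotRing"
    "HOL-Algebra.Generated_Rings"
    "Jordan_Normal_Form.Determinant"
    Complex_Main
begin

section \<open>Multivariate formal power series\<close>

typedef ('v, 'c) mfps = "UNIV :: (('v \<Rightarrow>\<^sub>0 nat) \<Rightarrow> 'c) set"
  morphisms mfps_coeff Abs_mfps ..

setup_lifting type_definition_mfps

lemma mfps_eqI: "(\<And>k. mfps_coeff F k = mfps_coeff G k) \<Longrightarrow> F = G"
  by transfer auto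

lemma finite_antidiagonal: "finite {(a, b). a + b = (k :: 'v \<Rightarrow>\<^sub>0 nat)}"
proof -
  let ?S = "{a. \<exists>b. a + b = k}"
  let ?r = "\<lambda>a. restrict (Poly_Mapping.lookup a) (Poly_Mapping.keys k)"
  have le: "Poly_Mapping.lookup a v \<le> Poly_Mapping.lookup k v" if "a \<in> ?S" for a v
    using that by (auto simp: lookup_add)
  have "?r ` ?S \<subseteq> (\<Pi>\<^sub>E v\<in>Poly_Mapping.keys k. {..Poly_Mapping.lookup k v})"
    using le by auto
  moreover have "finite (\<Pi>\<^sub>E v\<in>Poly_Mapping.keys k. {..Poly_Mapping.lookup k v})"
    by (intro finite_PiE) auto
  ultimately have "finite (?r ` ?S)"
    by (rule finite_subset)
  moreover have "inj_on ?r ?S"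
  proof (rule inj_onI)
    fix a b assume a: "a \<in> ?S" and b: "b \<in> ?S" and eq: "?r a = ?r b"
    show "a = b"
    proof (rule poly_mapping_eqI)
      fix v
      show "Poly_Mapping.lookup a v = Poly_Mapping.lookup b v"
      proof (cases "v \<in> Poly_Mapping.keys k")
        case True
        then show ?thesis using fun_cong[OF eq, of v] by simp
      next
        case False
        then have "Poly_Mapping.lookup k v = 0" by (simp add: in_keys_iff)
        then show ?thesis using le[OF a, of v] le[OF b, of v] by simp
      qed
    qed
  qed
  ultimately have fin: "finite ?S"
    using finite_imageD by blast
  have "{(a, b). a + b = k} \<subseteq> (\<lambda>a. (a, k - a)) ` ?S"
  proof clarify
    fix a b :: "'v \<Rightarrow>\<^sub>0 nat" assume "k = a + b"
    then show "(a, b) \<in> (\<lambda>c. (c, a + b - c)) ` {c. \<exists>d. c + d = a + b}"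
      by (intro image_eqI[of _ _ a]) auto
  qed
  then show ?thesis
    using fin finite_surj by blast
qed

instantiation mfps :: (type, comm_ring_1) comm_ring_1
begin

lift_definition zero_mfps :: "('a, 'b) mfps" is "\<lambda>_. 0" .

lift_definition one_mfps :: "('a, 'b) mfps" is "\<lambda>k. if k = 0 then 1 else 0" .

lift_definition plus_mfps :: "('a, 'b) mfps \<Rightarrow> ('a, 'b) mfps \<Rightarrow> ('a, 'b) mfps"
  is "\<lambda>F G k. F k + G k" .

lift_definition minus_mfps :: "('a, 'b) mfps \<Rightarrow> ('a, 'b) mfps \<Rightarrow> ('a, 'b) mfps"
  is "\<lambda>F G k. F k - G k" .

lift_definition uminus_mfps :: "('a, 'b) mfps \<Rightarrow> ('a, 'b) mfps"
  is "\<lambda>F k. - F k" .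

lift_definition times_mfps :: "('a, 'b) mfps \<Rightarrow> ('a, 'b) mfps \<Rightarrow> ('a, 'b) mfps"
  is "\<lambda>F G k. \<Sum>(a, b) | a + b = k. F a * G b" .

instance
proof
  fix F G H :: "('a, 'b) mfps"
  show "F * G * H = F * (G * H)"
  proof (transfer, rule ext)
    fix F G H :: "('a \<Rightarrow>\<^sub>0 nat) \<Rightarrow> 'b" and k
    have "(\<Sum>(a, b) | a + b = k. (\<Sum>(c, d) | c + d = a. F c * G d) * H b)
        = (\<Sum>x\<in>{(a, b). a + b = k}. \<Sum>y\<in>{(c, d). c + d = fst x}.
             F (fst y) * G (snd y) * H (snd x))"
      by (simp add: sum_distrib_right case_prod_beta)
    also have "\<dots> = (\<Sum>z\<in>Sigma {(a, b). a + b = k} (\<lambda>x. {(c, d). c + d = fst x}).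
             F (fst (snd z)) * G (snd (snd z)) * H (snd (fst z)))"
      by (subst sum.Sigma) (auto simp: finite_antidiagonal case_prod_beta)
    also have "\<dots> = (\<Sum>z\<in>Sigma {(a, b). a + b = k} (\<lambda>x. {(c, d). c + d = snd x}).
             F (fst (fst z)) * (G (fst (snd z)) * H (snd (snd z))))"
      by (rule sum.reindex_bij_witness
            [where i = "\<lambda>((a, b), (c, d)). ((a + c, d), (a, c))"
               and j = "\<lambda>((a, b), (c, d)). ((c, d + b), (d, b))"])
         (auto simp: algebra_simps)
    also have "\<dots> = (\<Sum>x\<in>{(a, b). a + b = k}. \<Sum>y\<in>{(c, d). c + d = snd x}.
             F (fst x) * (G (fst y) * H (snd y)))"
      by (subst sum.Sigma) (auto simp: finite_antidiagonal case_prod_beta)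
    also have "\<dots> = (\<Sum>(a, b) | a + b = k. F a * (\<Sum>(c, d) | c + d = b. G c * H d))"
      by (simp add: sum_distrib_left case_prod_beta)
    finally show "(\<Sum>(a, b) | a + b = k. (\<Sum>(c, d) | c + d = a. F c * G d) * H b)
        = (\<Sum>(a, b) | a + b = k. F a * (\<Sum>(c, d) | c + d = b. G c * H d))" .
  qed
  show "F * G = G * F"
  proof (transfer, rule ext)
    fix F G :: "('a \<Rightarrow>\<^sub>0 nat) \<Rightarrow> 'b" and k
    show "(\<Sum>(a, b) | a + b = k. F a * G b) = (\<Sum>(a, b) | a + b = k. G a * F b)"
      by (rule sum.reindex_bij_witness[where i = prod.swap and j = prod.swap])
         (auto simp: algebra_simps)
  qed
  show "1 * F = F"
  proof (transfer, rule ext)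
    fix F :: "('a \<Rightarrow>\<^sub>0 nat) \<Rightarrow> 'b" and k
    have "(\<Sum>(a, b) | a + b = k. (if a = 0 then 1 else 0) * F b)
        = (\<Sum>(a, b)\<in>{(0 :: 'a \<Rightarrow>\<^sub>0 nat, k)}. (if a = 0 then 1 else 0) * F b)"
      by (rule sum.mono_neutral_right) (auto simp: finite_antidiagonal split: if_splits)
    then show "(\<Sum>(a, b) | a + b = k. (if a = 0 then 1 else 0) * F b) = F k"
      by simp
  qed
  show "(F + G) * H = F * H + G * H"
    by (rule mfps_eqI)
       (simp add: times_mfps.rep_eq plus_mfps.rep_eq distrib_right sum.distrib case_prod_beta)
  show "(0 :: ('a, 'b) mfps) \<noteq> 1"
  proof
    assume "(0 :: ('a, 'b) mfps) = 1"
    then have "mfps_coeff (0 :: ('a, 'b) mfps) 0 = mfps_coeff (1 :: ('a, 'b) mfps) 0"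
      by simp
    then show False
      by (simp add: zero_mfps.rep_eq one_mfps.rep_eq)
  qed
qed (rule mfps_eqI; simp add: zero_mfps.rep_eq plus_mfps.rep_eq minus_mfps.rep_eq
      uminus_mfps.rep_eq add.assoc add.commute)+

end

lift_definition mfps_const :: "'c \<Rightarrow> ('v, 'c :: comm_ring_1) mfps"
  is "\<lambda>c k. if k = 0 then c else 0" .

lift_definition mfps_var :: "'v \<Rightarrow> ('v, 'c :: comm_ring_1) mfps"
  is "\<lambda>\<alpha> k. if k = Poly_Mapping.single \<alpha> 1 then 1 else 0" .

lift_definition mfps_map :: "('b \<Rightarrow> 'c) \<Rightarrow> ('v, 'b) mfps \<Rightarrow> ('v, 'c) mfps"
  is "\<lambda>h F k. h (F k)" .

text \<open>The substitution \<open>t\<^sub>\<alpha> \<mapsto> t\<^sub>\<alpha> ^ n\<close> in all variables, for \<open>n \<ge> 1\<close>.\<close>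

lift_definition mfps_subst_power :: "nat \<Rightarrow> ('v, 'c :: comm_ring_1) mfps \<Rightarrow> ('v, 'c) mfps"
  is "\<lambda>n F k. if \<forall>\<alpha>. n dvd Poly_Mapping.lookup k \<alpha> then F (Poly_Mapping.map (\<lambda>i. i div n) k) else 0" .

text \<open>Series with constant term 1 are invertible, so the definite description used below for
  \<open>f\<^sub>A\<^sub>,\<^sub>Q(t)\<close> is meaningful.\<close>

definition mon_degree :: "('v \<Rightarrow>\<^sub>0 nat) \<Rightarrow> nat" where
  "mon_degree k = (\<Sum>v\<in>Poly_Mapping.keys k. Poly_Mapping.lookup k v)"

lemma mon_degree_add: "mon_degree (a + b) = mon_degree a + mon_degree b"
proof -
  have *: "mon_degree k = (\<Sum>v\<in>Poly_Mapping.keys a \<union> Poly_Mapping.keys b. Poly_Mapping.lookup k v)" if "Poly_Mapping.keys k \<subseteq> Poly_Mapping.keys a \<union> Poly_Mapping.keys b" for k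
    unfolding mon_degree_def using that by (intro sum.mono_neutral_left) (auto simp: in_keys_iff)
  show ?thesis
    using *[of a] *[of b] *[of "a + b"] keys_add[of a b]
    by (simp add: lookup_add sum.distrib)
qed

lemma mon_degree_pos: "k \<noteq> 0 \<Longrightarrow> mon_degree k > 0"
proof -
  assume "k \<noteq> 0"
  then obtain v where "v \<in> Poly_Mapping.keys k"
    by (metis keys_eq_empty ex_in_conv)
  then show ?thesis
    unfolding mon_degree_def by (intro sum_pos2[of _ v]) (auto simp: in_keys_iff)
qed

lemma mfps_power_coeff_eq_0:
  assumes "mfps_coeff u 0 = 0" "mon_degree k < n"
  shows "mfps_coeff (u ^ n :: ('v, 'c :: comm_ring_1) mfps) k = 0"
  using assms(2)
proof (induction n arbitrary: k)
  case (Suc n)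
  have "mfps_coeff u a * mfps_coeff (u ^ n) b = 0" if "a + b = k" for a b
  proof (cases "a = 0")
    case False
    then have "mon_degree b < n"
      using Suc.prems that mon_degree_pos[of a] by (auto simp: mon_degree_add)
    then show ?thesis using Suc.IH by simp
  qed (use assms(1) in simp)
  then show ?case
    by (auto simp: times_mfps.rep_eq intro!: sum.neutral)
qed simp

lemma mfps_coeff_sum: "mfps_coeff (sum F S) k = (\<Sum>x\<in>S. mfps_coeff (F x) k)"
  by (induction S rule: infinite_finite_induct) (auto simp: zero_mfps.rep_eq plus_mfps.rep_eq)

lemma mfps_ex1_inverse:
  fixes F :: "('v, 'c :: comm_ring_1) mfps"
  assumes "mfps_coeff F 0 = 1"
  shows "\<exists>!G. G * F = 1"
proof (rule ex_ex1I)
  define u where "u = 1 - F"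
  have u0: "mfps_coeff u 0 = 0"
    using assms by (simp add: u_def minus_mfps.rep_eq one_mfps.rep_eq)
  define G where "G = Abs_mfps (\<lambda>k. \<Sum>n\<le>mon_degree k. mfps_coeff (u ^ n) k)"
  have G: "mfps_coeff G k = mfps_coeff (\<Sum>n<Suc N. u ^ n) k" if "mon_degree k \<le> N" for k N
    unfolding G_def mfps_coeff_sum
    by (simp only: Abs_mfps_inverse[OF UNIV_I])
       (rule sum.mono_neutral_left, use that mfps_power_coeff_eq_0[OF u0] in auto)
  have "G * F = 1"
  proof (rule mfps_eqI)
    fix k :: "'v \<Rightarrow>\<^sub>0 nat"
    let ?P = "\<Sum>n<Suc (mon_degree k). u ^ n"
    have "mfps_coeff (G * F) k = mfps_coeff (?P * F) k"
      unfolding times_mfps.rep_eq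
    proof (intro sum.cong refl, clarify)
      fix a b assume "k = a + b"
      then show "mfps_coeff G a * mfps_coeff F b
          = mfps_coeff (\<Sum>n<Suc (mon_degree (a + b)). u ^ n) a * mfps_coeff F b"
        using G[of a "mon_degree (a + b)"] by (simp add: mon_degree_add)
    qed
    also have "?P * F = 1 - u ^ Suc (mon_degree k)"
      using one_diff_power_eq[of u "Suc (mon_degree k)"] by (simp add: u_def mult.commute)
    also have "mfps_coeff \<dots> k = mfps_coeff 1 k"
      using mfps_power_coeff_eq_0[OF u0, of k "Suc (mon_degree k)"]
      by (simp add: minus_mfps.rep_eq del: power_Suc)
    finally show "mfps_coeff (G * F) k = mfps_coeff 1 k" .
  qed
  then show "\<exists>G. G * F = 1" ..
next
  fix G H assume G: "G * F = 1" and H: "H * F = 1"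
  have "G = G * (H * F)" by (simp add: H)
  also have "\<dots> = H * (G * F)" by (rule mult.left_commute)
  finally show "G = H" by (simp add: G)
qed


section \<open>Subrings of power series rings and etale algebras\<close>

definition univ_ring :: "'r :: comm_ring_1 ring" where
  "univ_ring = \<lparr>carrier = UNIV, mult = (*), one = 1, zero = 0, add = (+)\<rparr>"

definition Zt :: "'v set \<Rightarrow> ('v, int) mfps set" where
  "Zt A = generate_ring univ_ring (mfps_var ` A)"

text \<open>\<open>mpoly_over B n\<close> is the polynomial ring \<open>B[x\<^sub>0, \<dots>, x\<^sub>n\<^sub>-\<^sub>1]\<close> over the subring \<open>B\<close>.\<close>

definition mpoly_over :: "'r :: comm_ring_1 set \<Rightarrow> nat \<Rightarrow> ((nat \<Rightarrow>\<^sub>0 nat) \<Rightarrow>\<^sub>0 'r) set" where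
  "mpoly_over B n =
    {P. (\<forall>e. Poly_Mapping.lookup P e \<in> B) \<and> (\<forall>e\<in>Poly_Mapping.keys P. Poly_Mapping.keys e \<subseteq> {..<n})}"

definition mpoly_eval :: "(nat \<Rightarrow> 'r) \<Rightarrow> ((nat \<Rightarrow>\<^sub>0 nat) \<Rightarrow>\<^sub>0 'r) \<Rightarrow> 'r :: comm_ring_1" where
  "mpoly_eval x P = (\<Sum>e\<in>Poly_Mapping.keys P. Poly_Mapping.lookup P e * (\<Prod>i\<in>Poly_Mapping.keys e. x i ^ Poly_Mapping.lookup e i))"

definition mpoly_pderiv ::
    "nat \<Rightarrow> ((nat \<Rightarrow>\<^sub>0 nat) \<Rightarrow>\<^sub>0 'r) \<Rightarrow> ((nat \<Rightarrow>\<^sub>0 nat) \<Rightarrow>\<^sub>0 'r :: comm_ring_1)" where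
  "mpoly_pderiv i P = (\<Sum>e\<in>Poly_Mapping.keys P.
     Poly_Mapping.single (e - Poly_Mapping.single i 1) (of_nat (Poly_Mapping.lookup e i) * Poly_Mapping.lookup P e))"

text \<open>\<open>R\<close> is etale over \<open>B\<close>: there is a presentation
  \<open>R \<cong> B[x\<^sub>0, \<dots>, x\<^sub>n\<^sub>-\<^sub>1] / (g\<^sub>0, \<dots>, g\<^sub>n\<^sub>-\<^sub>1)\<close> whose Jacobian determinant is a unit of \<open>R\<close>.\<close>

definition etale_over :: "'r :: comm_ring_1 set \<Rightarrow> 'r set \<Rightarrow> bool" where
  "etale_over B R \<longleftrightarrow> (\<exists>n x g.
     (\<forall>i<n. g i \<in> mpoly_over B n) \<and>
     R = mpoly_eval x ` mpoly_over B n \<and>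
     (\<forall>P\<in>mpoly_over B n. mpoly_eval x P = 0 \<longleftrightarrow>
        (\<exists>h. (\<forall>i<n. h i \<in> mpoly_over B n) \<and> P = (\<Sum>i<n. h i * g i))) \<and>
     (\<exists>u\<in>R. u * det (mat n n (\<lambda>(i, j). mpoly_eval x (mpoly_pderiv j (g i)))) = 1))"


section \<open>The p-adic completion of a ring\<close>

abbreviation pn_ideal :: "('r, 'k) ring_scheme \<Rightarrow> nat \<Rightarrow> nat \<Rightarrow> 'r set" where
  "pn_ideal S p n \<equiv> PIdl\<^bsub>S\<^esub> ([(p ^ n)] \<cdot>\<^bsub>S\<^esub> \<one>\<^bsub>S\<^esub>)"

text \<open>The inverse limit of the quotients \<open>S / p\<^sup>n S\<close>. For cosets, \<open>x (Suc n) \<subseteq> x n\<close> says that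
  \<open>x (Suc n)\<close> is mapped to \<open>x n\<close> by the projection.\<close>

definition padic_completion :: "('r, 'k) ring_scheme \<Rightarrow> nat \<Rightarrow> (nat \<Rightarrow> 'r set) ring" where
  "padic_completion S p =
    \<lparr>carrier = {x. (\<forall>n. x n \<in> carrier (S Quot pn_ideal S p n)) \<and> (\<forall>n. x (Suc n) \<subseteq> x n)},
     mult = (\<lambda>x y n. x n \<otimes>\<^bsub>S Quot pn_ideal S p n\<^esub> y n),
     one = (\<lambda>n. \<one>\<^bsub>S Quot pn_ideal S p n\<^esub>),
     zero = (\<lambda>n. \<zero>\<^bsub>S Quot pn_ideal S p n\<^esub>),
     add = (\<lambda>x y n. x n \<oplus>\<^bsub>S Quot pn_ideal S p n\<^esub> y n)\<rparr>"

definition to_completion :: "('r, 'k) ring_scheme \<Rightarrow> nat \<Rightarrow> 'r \<Rightarrow> nat \<Rightarrow> 'r set" where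
  "to_completion S p a = (\<lambda>n. pn_ideal S p n +>\<^bsub>S\<^esub> a)"

text \<open>\<open>padic_sums S p a x\<close>: the series \<open>\<Sum>i. a i\<close> of elements of \<open>S\<close> converges to \<open>x\<close> in the
  \<open>p\<close>-adic topology of the completion.\<close>

definition padic_sums ::
    "('r :: comm_ring_1, 'k) ring_scheme \<Rightarrow> nat \<Rightarrow> (nat \<Rightarrow> 'r) \<Rightarrow> (nat \<Rightarrow> 'r set) \<Rightarrow> bool" where
  "padic_sums S p a x \<longleftrightarrow>
    (\<forall>N. \<forall>\<^sub>F M in sequentially. to_completion S p (\<Sum>i<M. a i) N = x N)"


section \<open>The Habiro ring\<close>

definition compatible_roots_of_unity :: "(nat \<Rightarrow> complex) \<Rightarrow> bool" where
  "compatible_roots_of_unity \<zeta> \<longleftrightarrow>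
    (\<forall>m\<ge>1. \<zeta> m ^ m = 1 \<and> (\<forall>k. 0 < k \<and> k < m \<longrightarrow> \<zeta> m ^ k \<noteq> 1)) \<and>
    (\<forall>m\<ge>1. \<forall>m'\<ge>1. coprime m m' \<longrightarrow> \<zeta> (m * m') = \<zeta> m * \<zeta> m') \<and>
    (\<forall>p r. prime p \<and> r \<ge> 1 \<longrightarrow> \<zeta> (p ^ r) ^ p = \<zeta> (p ^ (r - 1)))"

text \<open>At level \<open>m\<close> the variables of the power series are \<open>t\<^sub>\<alpha>\<^bsup>1/m\<^esup>\<close>. Hence
  \<open>\<int>[[t]]\<close> embeds into level \<open>m\<close> by \<open>level_embed m\<close>, and level \<open>m\<close> embeds into level \<open>p * m\<close>
  by \<open>mfps_subst_power p\<close>.\<close>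

definition level_embed :: "nat \<Rightarrow> ('v, int) mfps \<Rightarrow> ('v, complex) mfps" where
  "level_embed m g = mfps_subst_power m (mfps_map of_int g)"

text \<open>\<open>R\<^sub>m = R[t\<^bsup>1/m\<^esup>, \<zeta>\<^sub>m]\<close> for \<open>\<int>[t] \<subseteq> R \<subseteq> \<int>[[t]]\<close>. It is the tensor product
  \<open>R \<otimes> \<int>[t\<^bsup>1/m\<^esup>, \<zeta>\<^sub>m]\<close> over \<open>\<int>[t]\<close>: the products of the \<open>t\<^bsup>i/m\<^esup>\<close> (all \<open>0 \<le> i\<^sub>\<alpha> < m\<close>)
  with an integral basis of \<open>\<int>[\<zeta>\<^sub>m]\<close> are linearly independent over \<open>\<int>[[t]]\<close>.\<close>

definition level_ring ::
    "(nat \<Rightarrow> complex) \<Rightarrow> 'v set \<Rightarrow> ('v, int) mfps set \<Rightarrow> nat \<Rightarrow> ('v, complex) mfps ring" where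
  "level_ring \<zeta> A R m = univ_ring\<lparr>carrier :=
     generate_ring univ_ring (level_embed m ` R \<union> mfps_var ` A \<union> {mfps_const (\<zeta> m)})\<rparr>"

text \<open>\<open>\<phi>\<close> is the map \<open>\<phi>\<^sub>p\<close> on the completion of \<open>R\<^sub>p\<^sub>m\<close>, whose variables are \<open>t\<^sub>\<alpha>\<^bsup>1/(pm)\<^esup>\<close>,
  so that \<open>t\<^sub>\<alpha>\<^bsup>1/m\<^esup>\<close> is the \<open>p\<close>-th power of a variable. The last condition says that \<open>\<phi>\<close> lifts
  the Frobenius of \<open>R / p R\<close>. As \<open>R\<close> is etale over \<open>\<int>[t]\<close>, these conditions determine \<open>\<phi>\<close> on the
  carrier of the completion.\<close>

definition is_frobenius_lift ::
    "(nat \<Rightarrow> complex) \<Rightarrow> 'v set \<Rightarrow> ('v, int) mfps set \<Rightarrow> nat \<Rightarrow> nat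
      \<Rightarrow> ((nat \<Rightarrow> ('v, complex) mfps set) \<Rightarrow> (nat \<Rightarrow> ('v, complex) mfps set)) \<Rightarrow> bool" where
  "is_frobenius_lift \<zeta> A R p m \<phi> \<longleftrightarrow>
    (let S = level_ring \<zeta> A R (p * m); C = padic_completion S p; \<iota> = to_completion S p in
      \<phi> \<in> Ring.ring_hom C C \<and>
      (\<forall>\<alpha>\<in>A. \<phi> (\<iota> (mfps_var \<alpha>)) = \<iota> (mfps_var \<alpha> ^ p)) \<and>
      \<phi> (\<iota> (mfps_const (\<zeta> (p * m)))) = \<iota> (mfps_const (\<zeta> (p * m))) \<and>
      (\<forall>g\<in>R. \<phi> (\<iota> (level_embed (p * m) g)) 1 = \<iota> (level_embed (p * m) g ^ p) 1))"

text \<open>The gluing condition between \<open>F = f\<^sub>m\<close> and \<open>G = f\<^sub>p\<^sub>m\<close>, one coefficient at a time: the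
  \<open>j\<close>-th coefficient of \<open>F(x + c)\<close> with \<open>c = \<zeta>\<^sub>p\<^sub>m - \<zeta>\<^sub>m\<close> is the \<open>p\<close>-adically convergent sum of
  the terms \<open>(i + j choose j) c\<^sup>i F\<^sub>i\<^sub>+\<^sub>j\<close>.\<close>

definition habiro_glued ::
    "(nat \<Rightarrow> complex) \<Rightarrow> 'v set \<Rightarrow> ('v, int) mfps set \<Rightarrow> nat \<Rightarrow> nat
      \<Rightarrow> ('v, complex) mfps fps \<Rightarrow> ('v, complex) mfps fps \<Rightarrow> bool" where
  "habiro_glued \<zeta> A R p m F G \<longleftrightarrow>
    (let S = level_ring \<zeta> A R (p * m) in
     \<exists>\<phi>. is_frobenius_lift \<zeta> A R p m \<phi> \<and>
       (\<forall>j. padic_sums S p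
          (\<lambda>i. of_nat ((i + j) choose j) * mfps_const ((\<zeta> (p * m) - \<zeta> m) ^ i)
                 * mfps_subst_power p (fps_nth F (i + j)))
          (\<phi> (to_completion S p (fps_nth G j)))))"

text \<open>Power series in \<open>q - \<zeta>\<^sub>m\<close> are represented by \<^typ>\<open>'a fps\<close>. Collections are indexed by
  \<open>m \<ge> 1\<close>; their value at \<open>0\<close> is irrelevant.\<close>

definition habiro_ring ::
    "(nat \<Rightarrow> complex) \<Rightarrow> 'v set \<Rightarrow> ('v, int) mfps set \<Rightarrow> (nat \<Rightarrow> ('v, complex) mfps fps) set" where
  "habiro_ring \<zeta> A R = {f.
     (\<forall>m\<ge>1. \<forall>n. fps_nth (f m) n \<in> carrier (level_ring \<zeta> A R m)) \<and>
     (\<forall>m\<ge>1. \<forall>p. prime p \<longrightarrow> habiro_glued \<zeta> A R p m (f m) (f (p * m)))}"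


section \<open>Series over the Laurent polynomials as collections\<close>

text \<open>The ring \<open>\<int>[q, q\<^sup>-\<^sup>1]\<close>, as the group ring of the additive group \<open>\<int>\<close>.\<close>

type_synonym laurent = "int \<Rightarrow>\<^sub>0 int"

definition laurent_of_poly :: "int poly \<Rightarrow> laurent" where
  "laurent_of_poly P =
    (\<Sum>i\<le>Polynomial.degree P. Poly_Mapping.single (int i) (Polynomial.coeff P i))"

text \<open>The expansion in powers of \<open>q - z\<close>, where \<open>q = z + (q - z)\<close>, for \<open>z \<noteq> 0\<close>.\<close>

definition laurent_expand :: "complex \<Rightarrow> laurent \<Rightarrow> complex fps" where
  "laurent_expand z P =
    (\<Sum>i\<in>Poly_Mapping.keys P. fps_const (of_int (Poly_Mapping.lookup P i)) * (fps_const z + fps_X) powi i)"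

text \<open>Since the variables at level \<open>m\<close> are \<open>t\<^sub>\<alpha>\<^bsup>1/m\<^esup>\<close>, the coefficient of \<open>f(t\<^bsup>1/m\<^esup>, q)\<close> at
  a monomial of level \<open>m\<close> is the coefficient of \<open>f(t, q)\<close> with the same exponents.\<close>

definition habiro_expansion ::
    "(nat \<Rightarrow> complex) \<Rightarrow> ('v, laurent) mfps \<Rightarrow> nat \<Rightarrow> ('v, complex) mfps fps" where
  "habiro_expansion \<zeta> F m =
    Abs_fps (\<lambda>n. Abs_mfps (\<lambda>k. fps_nth (laurent_expand (\<zeta> m) (mfps_coeff F k)) n))"


section \<open>The series attached to a symmetric matrix\<close>

definition minus_one_pow :: "int \<Rightarrow> 'c :: comm_ring_1" where
  "minus_one_pow n = (if even n then 1 else -1)"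

definition diag_form :: "'v set \<Rightarrow> ('v \<Rightarrow> 'v \<Rightarrow> int) \<Rightarrow> ('v \<Rightarrow>\<^sub>0 nat) \<Rightarrow> int" where
  "diag_form A Q k = (\<Sum>\<alpha>\<in>A. Q \<alpha> \<alpha> * int (Poly_Mapping.lookup k \<alpha>))"

definition quad_form :: "'v set \<Rightarrow> ('v \<Rightarrow> 'v \<Rightarrow> int) \<Rightarrow> ('v \<Rightarrow>\<^sub>0 nat) \<Rightarrow> int" where
  "quad_form A Q k = (\<Sum>\<alpha>\<in>A. \<Sum>\<beta>\<in>A. int (Poly_Mapping.lookup k \<alpha>) * Q \<alpha> \<beta> * int (Poly_Mapping.lookup k \<beta>))"

definition qpoch :: "nat \<Rightarrow> int poly" where
  "qpoch n = (\<Prod>i=1..n. 1 - Polynomial.monom 1 i)"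

text \<open>The division is exact, as \<open>q\<close>-multinomial coefficients are polynomials in \<open>q\<close>.\<close>

definition qmultinomial :: "'v set \<Rightarrow> ('v \<Rightarrow>\<^sub>0 nat) \<Rightarrow> int poly" where
  "qmultinomial A k = qpoch (\<Sum>\<alpha>\<in>A. Poly_Mapping.lookup k \<alpha>) div (\<Prod>\<alpha>\<in>A. qpoch (Poly_Mapping.lookup k \<alpha>))"

definition f_classical :: "'v set \<Rightarrow> ('v \<Rightarrow> 'v \<Rightarrow> int) \<Rightarrow> ('v, int) mfps" where
  "f_classical A Q =
    (THE g. g * (1 - (\<Sum>\<alpha>\<in>A. mfps_const (minus_one_pow (Q \<alpha> \<alpha>)) * mfps_var \<alpha>)) = 1)"

lemma f_classical_inverse:
  "f_classical A Q * (1 - (\<Sum>\<alpha>\<in>A. mfps_const (minus_one_pow (Q \<alpha> \<alpha>)) * mfps_var \<alpha>)) = 1"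
proof -
  have *: "mfps_coeff (mfps_const c * mfps_var \<alpha> :: ('v, int) mfps) 0 = 0" for c and \<alpha> :: 'v
    unfolding times_mfps.rep_eq
  proof (intro sum.neutral ballI, clarify)
    fix a b :: "'v \<Rightarrow>\<^sub>0 nat" assume "a + b = 0"
    then have "Poly_Mapping.lookup b \<alpha> = 0"
      by (metis add_is_0 lookup_add lookup_zero)
    then have "b \<noteq> Poly_Mapping.single \<alpha> 1"
      by auto
    then show "mfps_coeff (mfps_const c) a * mfps_coeff (mfps_var \<alpha>) b = (0 :: int)"
      by (simp add: mfps_var.rep_eq)
  qed
  show ?thesis
    unfolding f_classical_def
    by (rule theI'[OF mfps_ex1_inverse])
       (simp add: * minus_mfps.rep_eq one_mfps.rep_eq mfps_coeff_sum)
qed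

text \<open>The exponent of \<open>q\<close> is an integer: its numerator is even, as \<open>Q\<close> is symmetric.\<close>

definition f_quantum :: "'v set \<Rightarrow> ('v \<Rightarrow> 'v \<Rightarrow> int) \<Rightarrow> ('v, laurent) mfps" where
  "f_quantum A Q = Abs_mfps (\<lambda>k.
     if Poly_Mapping.keys k \<subseteq> A then
       minus_one_pow (diag_form A Q k)
       * Poly_Mapping.single ((quad_form A Q k + diag_form A Q k) div 2) 1
       * laurent_of_poly (qmultinomial A k)
     else 0)"

definition R_classical :: "'v set \<Rightarrow> ('v \<Rightarrow> 'v \<Rightarrow> int) \<Rightarrow> ('v, int) mfps set" where
  "R_classical A Q = generate_ring univ_ring (insert (f_classical A Q) (Zt A))"

end

theory Submission
  imports Defs
begin

text \<open>Write \<open>\<delta>\<close> for \<open>1 - \<Sum>\<^sub>\<alpha> \<plusminus>t\<^sub>\<alpha>\<close>, the denominator of \<open>f\<^sub>A\<^sub>,\<^sub>Q(t)\<close>, so that \<open>R = \<int>[t][1/\<delta>]\<close>; at level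
  \<open>m\<close>, where the variables are \<open>t\<^sub>\<alpha>\<^bsup>1/m\<^esup>\<close>, it involves only \<open>m\<close>-th powers of the variables.

  The localization \<open>R\<close> is \<open>\<int>[t][x] / (\<delta> x - 1)\<close> with Jacobian \<open>\<delta>\<close>, hence etale
  (\<open>etale_over_localization\<close>).

  The coefficients of the expansion at \<open>\<zeta>\<^sub>m\<close> lie in \<open>R\<^sub>m\<close> because of a \<open>q\<close>-difference equation. Choose a
  linear order on \<open>A\<close>. Pascal's rule for \<open>q\<close>-multinomial coefficients says that
  \<open>f = f\<^sub>A\<^sub>,\<^sub>Q(t, q)\<close> satisfies \<open>f = 1 + T f\<close>, where \<open>T\<close> is a sum of operators
  \<open>Y\<^sub>\<alpha>\<close>, one for each \<open>\<alpha> \<in> A\<close>, which rescale the variables by powers of \<open>q\<close> and multiply by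
  \<open>\<plusminus>q\<^bsup>Q(\<alpha>,\<alpha>)\<^esup> t\<^sub>\<alpha>\<close> (\<open>f_quantum_equation\<close>). For \<open>\<alpha> \<noteq> \<beta>\<close> one has
  \<open>Y\<^sub>\<alpha> Y\<^sub>\<beta> = q\<^bsup>\<plusminus>1\<^esup> Y\<^sub>\<beta> Y\<^sub>\<alpha>\<close>, so that \<open>q\<close>-multinomial coefficients appear in the powers
  of \<open>T\<close>; they vanish at \<open>q = \<zeta>\<^sub>m\<close> in \<open>T\<^sup>m\<close>, except for the pure powers \<open>Y\<^sub>\<alpha>\<^sup>m\<close>, and at
  \<open>q = \<zeta>\<^sub>m\<close> the operator \<open>T\<^sup>m\<close> is multiplication by \<open>1 - \<delta>\<close> (\<open>qdiff_power_at_root\<close>). Let \<open>f\<^sub>n\<close>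
  be the coefficient of \<open>(q - \<zeta>\<^sub>m)\<^sup>n\<close> in \<open>f\<close>. Comparing these coefficients in
  \<open>f = (1 + T + \<dots> + T\<^bsup>m-1\<^esup>) 1 + T\<^sup>m f\<close> expresses \<open>\<delta> f\<^sub>n\<close> through \<open>f\<^sub>0, \<dots>, f\<^sub>n\<^sub>-\<^sub>1\<close>, and \<open>\<delta>\<close> is a
  unit of \<open>R\<^sub>m\<close> (\<open>expansion_mem_B\<close>). Rescaling the variables by powers of \<open>q\<close> preserves
  \<open>R\<^sub>m[[q - \<zeta>\<^sub>m]]\<close>, because it fixes \<open>\<delta>\<close> modulo \<open>q - \<zeta>\<^sub>m\<close> (\<open>twist_mem_B\<close>).

  The gluing condition holds because \<open>f\<^sub>m\<close> and \<open>f\<^sub>p\<^sub>m\<close> expand the same Laurent polynomials in \<open>q\<close>,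
  one for each monomial. In power series with coefficients in \<open>\<int>[\<zeta>\<^sub>p\<^sub>m]\<close> the Frobenius lift is just
  the substitution \<open>\<psi>\<close> of \<open>p\<close>-th powers for the variables. It induces \<open>\<phi>\<^sub>p\<close> on the completion of
  \<open>R\<^sub>p\<^sub>m\<close> because \<open>R\<^sub>p\<^sub>m / p\<^sup>n\<close> embeds into these power series modulo \<open>p\<^sup>n\<close> (\<open>S_pure\<close>)
  with an image stable under \<open>\<psi>\<close> (\<open>h_approx\<close>). The re-expansion from \<open>\<zeta>\<^sub>m\<close> to \<open>\<zeta>\<^sub>p\<^sub>m\<close>
  is the binomial series in \<open>c = \<zeta>\<^sub>p\<^sub>m - \<zeta>\<^sub>m\<close>, which converges \<open>p\<close>-adically since \<open>p\<close> divides a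
  power of \<open>c\<close> (\<open>expansion_converges\<close>).\<close>

section \<open>Subrings and ring homomorphisms\<close>

locale subring_set =
  fixes S :: "'r :: comm_ring_1 set"
  assumes one_mem: "1 \<in> S"
    and diff_mem: "a \<in> S \<Longrightarrow> b \<in> S \<Longrightarrow> a - b \<in> S"
    and mult_mem: "a \<in> S \<Longrightarrow> b \<in> S \<Longrightarrow> a * b \<in> S"
begin

lemma zero_mem: "0 \<in> S"
  using diff_mem[OF one_mem one_mem] by simp

lemma uminus_mem: "a \<in> S \<Longrightarrow> - a \<in> S"
  using diff_mem[OF zero_mem, of a] by simp

lemma add_mem: "a \<in> S \<Longrightarrow> b \<in> S \<Longrightarrow> a + b \<in> S"
  using diff_mem[OF _ uminus_mem, of a b] by simp

lemma sum_mem: "(\<And>i. i \<in> I \<Longrightarrow> f i \<in> S) \<Longrightarrow> sum f I \<in> S"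
  by (induction I rule: infinite_finite_induct) (auto intro: zero_mem add_mem)

lemma prod_mem: "(\<And>i. i \<in> I \<Longrightarrow> f i \<in> S) \<Longrightarrow> prod f I \<in> S"
  by (induction I rule: infinite_finite_induct) (auto intro: one_mem mult_mem)

lemma power_mem: "a \<in> S \<Longrightarrow> a ^ n \<in> S"
  by (induction n) (auto intro: one_mem mult_mem)

lemma of_nat_mem: "of_nat n \<in> S"
  by (induction n) (auto intro: zero_mem one_mem add_mem)

lemma of_int_mem: "of_int n \<in> S"
  by (cases n) (auto intro: of_nat_mem uminus_mem simp del: of_nat_Suc)

lemma minus_one_pow_mem: "minus_one_pow n \<in> S"
  by (auto simp: minus_one_pow_def intro: one_mem uminus_mem)

lemmas mem_intros = one_mem zero_mem uminus_mem diff_mem add_mem mult_mem sum_mem prod_mem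
  power_mem of_nat_mem of_int_mem minus_one_pow_mem

end

lemma cring_univ_ring: "cring (univ_ring :: 'r :: comm_ring_1 ring)"
proof (rule cringI)
  show "abelian_group (univ_ring :: 'r ring)"
  proof (rule abelian_groupI)
    fix x :: 'r
    show "\<exists>y\<in>carrier univ_ring. y \<oplus>\<^bsub>univ_ring\<^esub> x = \<zero>\<^bsub>univ_ring\<^esub>"
      by (rule bexI[of _ "- x"]) (auto simp: univ_ring_def)
  qed (auto simp: univ_ring_def algebra_simps)
  show "comm_monoid (univ_ring :: 'r ring)"
    by unfold_locales (auto simp: univ_ring_def algebra_simps)
qed (auto simp: univ_ring_def algebra_simps)

lemma univ_ring_simps [simp]:
  "carrier univ_ring = UNIV" "mult univ_ring = (*)" "one univ_ring = 1" "zero univ_ring = 0"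
  "add univ_ring = (+)"
  by (simp_all add: univ_ring_def)

lemma univ_ring_a_inv [simp]: "\<ominus>\<^bsub>univ_ring\<^esub> (x :: 'r :: comm_ring_1) = - x"
proof -
  interpret cring "univ_ring :: 'r ring" by (rule cring_univ_ring)
  show ?thesis by (rule minus_equality) auto
qed

abbreviation ring_gen :: "'r :: comm_ring_1 set \<Rightarrow> 'r set" where
  "ring_gen H \<equiv> generate_ring univ_ring H"

lemma subring_set_ring_gen: "subring_set (ring_gen H)"
proof
  show "1 \<in> ring_gen H"
    using generate_ring.one[of univ_ring H] by simp
  show "a * b \<in> ring_gen H" if "a \<in> ring_gen H" "b \<in> ring_gen H" for a b
    using generate_ring.eng_mult[OF that] by simp
  show "a - b \<in> ring_gen H" if "a \<in> ring_gen H" "b \<in> ring_gen H" for a b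
    using generate_ring.eng_add[OF that(1) generate_ring.a_inv[OF that(2)]] by simp
qed

lemma ring_gen_incl: "h \<in> H \<Longrightarrow> h \<in> ring_gen H"
  by (rule generate_ring.incl)

lemma ring_gen_subset:
  assumes "subring_set T" "H \<subseteq> T"
  shows "ring_gen H \<subseteq> T"
proof
  interpret subring_set T by fact
  fix x assume "x \<in> ring_gen H"
  then show "x \<in> T"
    by (induction rule: generate_ring.induct) (use assms(2) in \<open>auto intro: mem_intros\<close>)
qed

lemma comm_ring_homI:
  fixes h :: "'a :: comm_ring_1 \<Rightarrow> 'b :: comm_ring_1"
  assumes "\<And>x y. h (x + y) = h x + h y" "\<And>x y. h (x * y) = h x * h y" "h 1 = 1"
  shows "comm_ring_hom h"
proof unfold_locales
  show "h 0 = 0" using assms(1)[of 0 0] by simp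
qed (use assms in auto)

lemma (in comm_ring_hom) subring_set_vimage:
  assumes "subring_set T"
  shows "subring_set {x. hom x \<in> T}"
proof -
  interpret subring_set T by fact
  show ?thesis
    by unfold_locales (auto simp: hom_distribs intro: mem_intros)
qed

lemma comm_ring_hom_of_int: "comm_ring_hom (of_int :: int \<Rightarrow> 'a :: comm_ring_1)"
  by (rule comm_ring_homI) auto

lemma (in comm_ring_hom) hom_minus_one_pow: "hom (minus_one_pow n) = minus_one_pow n"
  by (auto simp: minus_one_pow_def hom_distribs)

lemma minus_one_pow_add: "minus_one_pow (a + b) = (minus_one_pow a * minus_one_pow b :: 'c :: comm_ring_1)"
  by (auto simp: minus_one_pow_def)

section \<open>Operations on multivariate power series\<close>

lemma mfps_coeff_simps [simp]:
  "mfps_coeff 0 k = 0"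
  "mfps_coeff 1 k = (if k = 0 then 1 else 0)"
  "mfps_coeff (F + G) k = mfps_coeff F k + mfps_coeff G k"
  "mfps_coeff (F - G) k = mfps_coeff F k - mfps_coeff G k"
  "mfps_coeff (- F) k = - mfps_coeff F k"
  "mfps_coeff (mfps_map h H) k = h (mfps_coeff H k)"
  by (simp_all add: zero_mfps.rep_eq one_mfps.rep_eq plus_mfps.rep_eq minus_mfps.rep_eq
      uminus_mfps.rep_eq mfps_map.rep_eq)

lemma mfps_coeff_Abs [simp]: "mfps_coeff (Abs_mfps f) = f"
  by (simp add: Abs_mfps_inverse)

definition mfps_monom :: "('v \<Rightarrow>\<^sub>0 nat) \<Rightarrow> ('v, 'c :: comm_ring_1) mfps" where
  "mfps_monom a = Abs_mfps (\<lambda>k. if k = a then 1 else 0)"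

lemma mfps_monom_coeff: "mfps_coeff (mfps_monom a) k = (if k = a then 1 else 0)"
  by (simp add: mfps_monom_def)

lemma mfps_var_eq_monom: "mfps_var \<alpha> = mfps_monom (Poly_Mapping.single \<alpha> 1)"
  by (rule mfps_eqI) (simp add: mfps_var.rep_eq mfps_monom_coeff)

lemma mfps_monom_0: "mfps_monom 0 = 1"
  by (rule mfps_eqI) (simp add: mfps_monom_coeff)

lemma mfps_const_coeff:
  fixes F :: "('v, 'c :: comm_ring_1) mfps"
  shows "mfps_coeff (mfps_const c * F) k = c * mfps_coeff F k"
proof -
  have "(\<Sum>(a, b) | a + b = k. mfps_coeff (mfps_const c) a * mfps_coeff F b)
      = (\<Sum>(a, b)\<in>{(0 :: 'v \<Rightarrow>\<^sub>0 nat, k)}. mfps_coeff (mfps_const c) a * mfps_coeff F b)"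
    by (rule sum.mono_neutral_right)
       (auto simp: finite_antidiagonal mfps_const.rep_eq split: if_splits)
  then show ?thesis
    by (simp add: times_mfps.rep_eq mfps_const.rep_eq)
qed

lemma mfps_monom_coeff_add:
  fixes F :: "('v, 'c :: comm_ring_1) mfps"
  shows "mfps_coeff (mfps_monom a * F) (a + b) = mfps_coeff F b"
proof -
  have "(\<Sum>(x, y) | x + y = a + b. mfps_coeff (mfps_monom a) x * mfps_coeff F y)
      = (\<Sum>(x, y)\<in>{(a, b)}. mfps_coeff (mfps_monom a) x * mfps_coeff F y)"
    by (rule sum.mono_neutral_right)
       (auto simp: finite_antidiagonal mfps_monom_coeff split: if_splits)
  then show ?thesis
    by (simp add: times_mfps.rep_eq mfps_monom_coeff)
qed

lemma mfps_monom_coeff_eq_0: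
  assumes "\<And>b. k \<noteq> a + b"
  shows "mfps_coeff (mfps_monom a * F) k = 0"
  unfolding times_mfps.rep_eq
  by (rule sum.neutral) (use assms in \<open>auto simp: mfps_monom_coeff\<close>)

lemma mfps_monom_mult: "mfps_monom a * mfps_monom b = mfps_monom (a + b)"
proof (rule mfps_eqI)
  fix k
  show "mfps_coeff (mfps_monom a * mfps_monom b :: ('a, 'b) mfps) k
      = mfps_coeff (mfps_monom (a + b)) k"
  proof (cases "\<exists>c. k = a + c")
    case True
    then obtain c where "k = a + c" by blast
    then show ?thesis by (simp add: mfps_monom_coeff_add mfps_monom_coeff)
  next
    case False
    then show ?thesis
      by (subst mfps_monom_coeff_eq_0) (auto simp: mfps_monom_coeff)
  qed
qed

lemma single_le_decomp:
  assumes "0 < Poly_Mapping.lookup k \<alpha>"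
  shows "k = Poly_Mapping.single \<alpha> 1 + (k - Poly_Mapping.single \<alpha> (1 :: nat))"
  by (rule poly_mapping_eqI) (use assms in \<open>auto simp: lookup_add lookup_minus lookup_single when_def\<close>)

lemma mfps_var_coeff:
  "mfps_coeff (mfps_var \<alpha> * F) k
    = (if 0 < Poly_Mapping.lookup k \<alpha> then mfps_coeff F (k - Poly_Mapping.single \<alpha> 1) else 0)"
proof (cases "0 < Poly_Mapping.lookup k \<alpha>")
  case True
  then show ?thesis
    using mfps_monom_coeff_add[of "Poly_Mapping.single \<alpha> 1" F "k - Poly_Mapping.single \<alpha> 1"]
      single_le_decomp[OF True] by (simp add: mfps_var_eq_monom)
next
  case False
  then have "k \<noteq> Poly_Mapping.single \<alpha> 1 + b" for b
    by (auto simp: lookup_add)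
  then show ?thesis
    using False by (simp add: mfps_var_eq_monom mfps_monom_coeff_eq_0)
qed

lemma mfps_var_power: "mfps_var \<alpha> ^ n = mfps_monom (Poly_Mapping.single \<alpha> n)"
  by (induction n) (simp_all add: mfps_monom_0 mfps_var_eq_monom mfps_monom_mult flip: single_add)

lemma mfps_monom_eq_prod:
  assumes "finite A" "Poly_Mapping.keys k \<subseteq> A"
  shows "mfps_monom k = (\<Prod>\<alpha>\<in>A. mfps_var \<alpha> ^ Poly_Mapping.lookup k \<alpha>)"
proof -
  have *: "(\<Prod>\<alpha>\<in>B. mfps_monom (f \<alpha>) :: ('a, 'b) mfps) = mfps_monom (sum f B)"
    for B and f :: "'a \<Rightarrow> 'a \<Rightarrow>\<^sub>0 nat"
    by (induction B rule: infinite_finite_induct) (simp_all add: mfps_monom_0 mfps_monom_mult)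
  have "(\<Sum>\<alpha>\<in>A. Poly_Mapping.single \<alpha> (Poly_Mapping.lookup k \<alpha>)) = k"
  proof (rule poly_mapping_eqI)
    fix x
    show "Poly_Mapping.lookup (\<Sum>\<alpha>\<in>A. Poly_Mapping.single \<alpha> (Poly_Mapping.lookup k \<alpha>)) x
        = Poly_Mapping.lookup k x"
      using assms by (cases "x \<in> A") (auto simp: lookup_sum lookup_single when_def in_keys_iff)
  qed
  then show ?thesis
    by (simp add: mfps_var_power *)
qed

lemma comm_ring_hom_const: "comm_ring_hom (mfps_const :: 'c :: comm_ring_1 \<Rightarrow> ('v, 'c) mfps)"
proof (rule comm_ring_homI)
  fix x y :: 'c
  show "mfps_const (x * y) = (mfps_const x * mfps_const y :: ('v, 'c) mfps)"
    by (rule mfps_eqI) (simp add: mfps_const_coeff mfps_const.rep_eq)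
qed (rule mfps_eqI; simp add: mfps_const.rep_eq)+

interpretation mfps_const: comm_ring_hom "mfps_const :: 'c :: comm_ring_1 \<Rightarrow> ('v, 'c) mfps"
  by (rule comm_ring_hom_const)

lemma comm_ring_hom_map:
  assumes "comm_ring_hom h"
  shows "comm_ring_hom (mfps_map h :: ('v, 'c :: comm_ring_1) mfps \<Rightarrow> ('v, 'd :: comm_ring_1) mfps)"
proof -
  interpret comm_ring_hom h by fact
  show ?thesis
    by (rule comm_ring_homI; rule mfps_eqI)
       (auto simp: hom_distribs times_mfps.rep_eq case_prod_beta)
qed

lemma mfps_map_var:
  assumes "comm_ring_hom h"
  shows "mfps_map h (mfps_var \<alpha>) = mfps_var \<alpha>"
proof -
  interpret comm_ring_hom h by fact
  show ?thesis by (rule mfps_eqI) (simp add: mfps_var.rep_eq)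
qed

lemma mfps_map_const:
  assumes "comm_ring_hom h"
  shows "mfps_map h (mfps_const c) = mfps_const (h c)"
proof -
  interpret comm_ring_hom h by fact
  show ?thesis by (rule mfps_eqI) (simp add: mfps_const.rep_eq)
qed

definition exp_char :: "(('v \<Rightarrow>\<^sub>0 nat) \<Rightarrow> 'c :: comm_ring_1) \<Rightarrow> bool" where
  "exp_char \<chi> \<longleftrightarrow> \<chi> 0 = 1 \<and> (\<forall>a b. \<chi> (a + b) = \<chi> a * \<chi> b)"

text \<open>For a character \<open>\<chi>(k) = q ^ a(k)\<close> of the monoid of exponents, with \<open>a\<close> additive, this rescales
  the variables by powers of \<open>q\<close>.\<close>

definition mfps_twist ::
    "(('v \<Rightarrow>\<^sub>0 nat) \<Rightarrow> 'c :: comm_ring_1) \<Rightarrow> ('v, 'c) mfps \<Rightarrow> ('v, 'c) mfps" where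
  "mfps_twist \<chi> F = Abs_mfps (\<lambda>k. \<chi> k * mfps_coeff F k)"

lemma mfps_twist_coeff: "mfps_coeff (mfps_twist \<chi> F) k = \<chi> k * mfps_coeff F k"
  by (simp add: mfps_twist_def)

lemma comm_ring_hom_twist:
  assumes "exp_char \<chi>"
  shows "comm_ring_hom (mfps_twist \<chi>)"
proof (rule comm_ring_homI)
  show "mfps_twist \<chi> (x * y) = mfps_twist \<chi> x * mfps_twist \<chi> y" for x y
    by (rule mfps_eqI)
       (use assms in \<open>auto simp: times_mfps.rep_eq mfps_twist_coeff exp_char_def sum_distrib_left
          case_prod_beta mult_ac intro!: sum.cong\<close>)
qed (rule mfps_eqI; use assms in \<open>simp add: mfps_twist_coeff distrib_left exp_char_def\<close>)+

lemma mfps_twist_const: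
  "exp_char \<chi> \<Longrightarrow> mfps_twist \<chi> (mfps_const c) = mfps_const c"
  by (rule mfps_eqI) (simp add: mfps_twist_coeff mfps_const.rep_eq exp_char_def)

lemma mfps_twist_monom: "mfps_twist \<chi> (mfps_monom k) = mfps_const (\<chi> k) * mfps_monom k"
  by (rule mfps_eqI) (simp add: mfps_twist_coeff mfps_monom_coeff mfps_const_coeff)

lemma mfps_twist_twist: "mfps_twist \<chi> (mfps_twist \<xi> F) = mfps_twist (\<lambda>k. \<chi> k * \<xi> k) F"
  by (rule mfps_eqI) (simp add: mfps_twist_coeff)

definition pm_scale :: "nat \<Rightarrow> ('v \<Rightarrow>\<^sub>0 nat) \<Rightarrow> ('v \<Rightarrow>\<^sub>0 nat)" where
  "pm_scale n k = Poly_Mapping.map (\<lambda>i. n * i) k"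

lemma lookup_pm_scale [simp]: "Poly_Mapping.lookup (pm_scale n k) v = n * Poly_Mapping.lookup k v"
  by (simp add: pm_scale_def map.rep_eq when_def)

lemma pm_scale_simps:
  "pm_scale n (a + b) = pm_scale n a + pm_scale n b"
  "pm_scale n 0 = 0"
  "pm_scale n (pm_scale m k) = pm_scale (n * m) k"
  "pm_scale n (Poly_Mapping.single \<alpha> i) = Poly_Mapping.single \<alpha> (n * i)"
  by (rule poly_mapping_eqI; simp add: lookup_add lookup_single when_def distrib_left)+

lemma pm_scale_inj:
  assumes "n \<ge> 1" "pm_scale n a = pm_scale n b"
  shows "a = b"
proof (rule poly_mapping_eqI)
  fix v
  show "Poly_Mapping.lookup a v = Poly_Mapping.lookup b v"
    using arg_cong[OF assms(2), of "\<lambda>k. Poly_Mapping.lookup k v"] assms(1) by simp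
qed

lemma pm_scale_eq_iff: "n \<ge> 1 \<Longrightarrow> pm_scale n a = pm_scale n b \<longleftrightarrow> a = b"
  using pm_scale_inj by blast

lemma pm_scale_eq_0_iff: "n \<ge> 1 \<Longrightarrow> pm_scale n a = 0 \<longleftrightarrow> a = 0"
  using pm_scale_eq_iff[of n a 0] by (simp add: pm_scale_simps)

lemma zero_in_range_pm_scale: "0 \<in> range (pm_scale n)"
  using pm_scale_simps(2) by (metis rangeI)

lemma pm_scale_exists:
  assumes "\<forall>\<alpha>. n dvd Poly_Mapping.lookup k \<alpha>"
  shows "k = pm_scale n (Poly_Mapping.map (\<lambda>i. i div n) k)"
  by (rule poly_mapping_eqI) (use assms in \<open>auto simp: map.rep_eq when_def\<close>)

lemma mfps_subst_power_coeff_scale: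
  assumes "n \<ge> 1"
  shows "mfps_coeff (mfps_subst_power n F) (pm_scale n k) = mfps_coeff F k"
proof -
  have "Poly_Mapping.map (\<lambda>i. i div n) (pm_scale n k) = k"
    by (rule poly_mapping_eqI) (use assms in \<open>auto simp: map.rep_eq when_def\<close>)
  then show ?thesis
    by (simp add: mfps_subst_power.rep_eq)
qed

lemma mfps_subst_power_coeff_eq_0:
  assumes "k \<notin> range (pm_scale n)"
  shows "mfps_coeff (mfps_subst_power n F) k = 0"
  using assms pm_scale_exists[of n k] by (auto simp: mfps_subst_power.rep_eq)

lemma mfps_subst_power_eqI:
  assumes "n \<ge> 1" "\<And>k. mfps_coeff G (pm_scale n k) = mfps_coeff F k"
    "\<And>k. k \<notin> range (pm_scale n) \<Longrightarrow> mfps_coeff G k = 0"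
  shows "mfps_subst_power n F = G"
proof (rule mfps_eqI)
  fix k
  show "mfps_coeff (mfps_subst_power n F) k = mfps_coeff G k"
    by (cases "k \<in> range (pm_scale n)")
       (use assms in \<open>auto simp: mfps_subst_power_coeff_scale mfps_subst_power_coeff_eq_0\<close>)
qed

lemma comm_ring_hom_subst_power:
  assumes n: "n \<ge> 1"
  shows "comm_ring_hom (mfps_subst_power n :: ('v, 'c :: comm_ring_1) mfps \<Rightarrow> ('v, 'c) mfps)"
proof (rule comm_ring_homI)
  note s = mfps_subst_power_coeff_scale[OF n] mfps_subst_power_coeff_eq_0
  fix F G :: "('v, 'c) mfps"
  show "mfps_subst_power n (F + G) = mfps_subst_power n F + mfps_subst_power n G"
    by (rule mfps_subst_power_eqI[OF n]) (auto simp: s)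
  show "mfps_subst_power n 1 = (1 :: ('v, 'c) mfps)"
    by (rule mfps_subst_power_eqI[OF n])
       (use n zero_in_range_pm_scale[of n] in \<open>auto simp: pm_scale_eq_0_iff\<close>)
  show "mfps_subst_power n (F * G) = mfps_subst_power n F * mfps_subst_power n G"
  proof (rule mfps_subst_power_eqI[OF n])
    fix k :: "'v \<Rightarrow>\<^sub>0 nat"
    let ?t = "\<lambda>(a, b). mfps_coeff (mfps_subst_power n F) a * mfps_coeff (mfps_subst_power n G) b"
    let ?h = "map_prod (pm_scale n) (pm_scale n)"
    have "(\<Sum>x\<in>{(a, b). a + b = pm_scale n k}. ?t x) = (\<Sum>x\<in>?h ` {(a, b). a + b = k}. ?t x)"
    proof (rule sum.mono_neutral_right)
      show "finite {(a, b). a + b = pm_scale n k}"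
        by (rule finite_antidiagonal)
      show "\<forall>x\<in>{(a, b). a + b = pm_scale n k} - ?h ` {(a, b). a + b = k}. ?t x = 0"
      proof
        fix x assume x: "x \<in> {(a, b). a + b = pm_scale n k} - ?h ` {(a, b). a + b = k}"
        obtain a b where ab: "x = (a, b)" by force
        show "?t x = 0"
        proof (rule ccontr)
          assume nz: "?t x \<noteq> 0"
          then have "mfps_coeff (mfps_subst_power n F) a \<noteq> 0"
              "mfps_coeff (mfps_subst_power n G) b \<noteq> 0"
            unfolding ab by auto
          then have "a \<in> range (pm_scale n)" "b \<in> range (pm_scale n)"
            using s(2) by blast+
          then obtain a' b' where *: "a = pm_scale n a'" "b = pm_scale n b'" by blast
          then have "a' + b' = k"
            using x pm_scale_inj[OF n, of "a' + b'" k] by (simp add: ab pm_scale_simps(1))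
          then have "x \<in> ?h ` {(a, b). a + b = k}"
            by (intro image_eqI[of _ _ "(a', b')"]) (auto simp: ab *)
          then show False using x by blast
        qed
      qed
    qed (auto simp: pm_scale_simps)
    also have "\<dots> = (\<Sum>(a, b) | a + b = k. mfps_coeff F a * mfps_coeff G b)"
      by (subst sum.reindex)
         (auto simp: inj_on_def s pm_scale_eq_iff[OF n] case_prod_beta intro!: sum.cong)
    finally show "mfps_coeff (mfps_subst_power n F * mfps_subst_power n G) (pm_scale n k)
        = mfps_coeff (F * G) k"
      by (simp add: times_mfps.rep_eq case_prod_beta)
  next
    fix k :: "'v \<Rightarrow>\<^sub>0 nat" assume k: "k \<notin> range (pm_scale n)"
    have "mfps_coeff (mfps_subst_power n F) a * mfps_coeff (mfps_subst_power n G) b = 0"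
      if "a + b = k" for a b :: "'v \<Rightarrow>\<^sub>0 nat"
    proof (cases "a \<in> range (pm_scale n) \<and> b \<in> range (pm_scale n)")
      case True
      then show ?thesis
        using k that pm_scale_simps(1)[of n, symmetric] by blast
    next
      case False
      then show ?thesis using s(2) by (metis mult_zero_left mult_zero_right)
    qed
    then show "mfps_coeff (mfps_subst_power n F * mfps_subst_power n G) k = 0"
      by (auto simp: times_mfps.rep_eq intro!: sum.neutral)
  qed
qed

lemma mfps_subst_power_const:
  "n \<ge> 1 \<Longrightarrow> mfps_subst_power n (mfps_const c) = mfps_const c"
  by (rule mfps_subst_power_eqI)
     (use zero_in_range_pm_scale[of n] in \<open>auto simp: mfps_const.rep_eq pm_scale_eq_0_iff\<close>)

lemma mfps_subst_power_monom:
  "n \<ge> 1 \<Longrightarrow> mfps_subst_power n (mfps_monom k) = mfps_monom (pm_scale n k)"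
  by (rule mfps_subst_power_eqI) (auto simp: mfps_monom_coeff pm_scale_eq_iff)

lemma mfps_subst_power_var:
  "n \<ge> 1 \<Longrightarrow> mfps_subst_power n (mfps_var \<alpha>) = mfps_var \<alpha> ^ n"
  unfolding mfps_var_power by (simp add: mfps_var_eq_monom mfps_subst_power_monom pm_scale_simps)

lemma mfps_subst_power_subst_power:
  assumes "n \<ge> 1" "m \<ge> 1"
  shows "mfps_subst_power n (mfps_subst_power m F) = mfps_subst_power (n * m) F"
proof (rule mfps_subst_power_eqI)
  fix k :: "'a \<Rightarrow>\<^sub>0 nat"
  show "mfps_coeff (mfps_subst_power (n * m) F) (pm_scale n k) = mfps_coeff (mfps_subst_power m F) k"
  proof (cases "k \<in> range (pm_scale m)")
    case True
    then obtain l where "k = pm_scale m l" by blast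
    then show ?thesis
      using mfps_subst_power_coeff_scale[of "n * m" F l] assms
      by (simp add: pm_scale_simps mfps_subst_power_coeff_scale)
  next
    case False
    then have "pm_scale n k \<notin> range (pm_scale (n * m))"
      using pm_scale_inj[OF assms(1), of k] by (auto simp: pm_scale_simps(3)[symmetric])
    then show ?thesis
      using False by (simp add: mfps_subst_power_coeff_eq_0)
  qed
next
  fix k :: "'a \<Rightarrow>\<^sub>0 nat" assume "k \<notin> range (pm_scale n)"
  then have "k \<notin> range (pm_scale (n * m))"
    by (auto simp: pm_scale_simps(3)[symmetric])
  then show "mfps_coeff (mfps_subst_power (n * m) F) k = 0"
    by (rule mfps_subst_power_coeff_eq_0)
qed fact

section \<open>Localizations are etale\<close>

definition mon_val :: "(nat \<Rightarrow> 'r) \<Rightarrow> (nat \<Rightarrow>\<^sub>0 nat) \<Rightarrow> 'r :: comm_ring_1" where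
  "mon_val x e = (\<Prod>i\<in>Poly_Mapping.keys e. x i ^ Poly_Mapping.lookup e i)"

lemma mon_val_superset:
  assumes "finite I" "Poly_Mapping.keys e \<subseteq> I"
  shows "mon_val x e = (\<Prod>i\<in>I. x i ^ Poly_Mapping.lookup e i)"
  unfolding mon_val_def
  by (rule prod.mono_neutral_left) (use assms in \<open>auto simp: in_keys_iff\<close>)

lemma mon_val_simps:
  "mon_val x 0 = 1" "mon_val x (Poly_Mapping.single i n) = x i ^ n"
  "mon_val x (a + b) = mon_val x a * mon_val x b"
proof -
  let ?I = "Poly_Mapping.keys a \<union> Poly_Mapping.keys b"
  show "mon_val x (a + b) = mon_val x a * mon_val x b"
    using mon_val_superset[of ?I a x] mon_val_superset[of ?I b x]
      mon_val_superset[of ?I "a + b" x] keys_add[of a b]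
    by (simp add: lookup_add power_add prod.distrib)
  show "mon_val x (Poly_Mapping.single i n) = x i ^ n"
    by (subst mon_val_superset[of "{i}"]) auto
qed (simp add: mon_val_def)

lemma poly_mapping_eq_sum_single:
  "P = (\<Sum>e\<in>Poly_Mapping.keys P. Poly_Mapping.single e (Poly_Mapping.lookup P e))"
proof (rule poly_mapping_eqI)
  fix k
  have "(\<Sum>e\<in>Poly_Mapping.keys P. Poly_Mapping.lookup P e when e = k) = Poly_Mapping.lookup P k"
    by (simp add: when_def in_keys_iff)
  then show "Poly_Mapping.lookup P k
      = Poly_Mapping.lookup (\<Sum>e\<in>Poly_Mapping.keys P. Poly_Mapping.single e (Poly_Mapping.lookup P e)) k"
    by (simp add: lookup_sum lookup_single)
qed

lemma mpoly_eval_superset: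
  assumes "finite S" "Poly_Mapping.keys P \<subseteq> S"
  shows "mpoly_eval x P = (\<Sum>e\<in>S. Poly_Mapping.lookup P e * mon_val x e)"
  unfolding mpoly_eval_def mon_val_def
  by (rule sum.mono_neutral_left) (use assms in \<open>auto simp: in_keys_iff\<close>)

lemma mpoly_eval_single: "mpoly_eval x (Poly_Mapping.single e c) = c * mon_val x e"
  by (subst mpoly_eval_superset[of "{e}"]) auto

lemma mpoly_eval_add: "mpoly_eval x (P + Q) = mpoly_eval x P + mpoly_eval x Q"
proof -
  let ?S = "Poly_Mapping.keys P \<union> Poly_Mapping.keys Q"
  show ?thesis
    using mpoly_eval_superset[of ?S P x] mpoly_eval_superset[of ?S Q x]
      mpoly_eval_superset[of ?S "P + Q" x] keys_add[of P Q]
    by (simp add: lookup_add distrib_right sum.distrib)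
qed

lemma mpoly_eval_sum: "mpoly_eval x (sum F I) = (\<Sum>i\<in>I. mpoly_eval x (F i))"
proof -
  have "mpoly_eval x 0 = 0" by (simp add: mpoly_eval_def)
  then show ?thesis
    by (induction I rule: infinite_finite_induct) (auto simp: mpoly_eval_add)
qed

lemma poly_mapping_mult_eq_sum:
  fixes P Q :: "'a :: monoid_add \<Rightarrow>\<^sub>0 'r :: comm_ring_1"
  shows "P * Q = (\<Sum>a\<in>Poly_Mapping.keys P. \<Sum>b\<in>Poly_Mapping.keys Q.
    Poly_Mapping.single (a + b) (Poly_Mapping.lookup P a * Poly_Mapping.lookup Q b))"
proof -
  have "P * Q = (\<Sum>e\<in>Poly_Mapping.keys P. Poly_Mapping.single e (Poly_Mapping.lookup P e))
      * (\<Sum>e\<in>Poly_Mapping.keys Q. Poly_Mapping.single e (Poly_Mapping.lookup Q e))"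
    by (simp only: poly_mapping_eq_sum_single[symmetric])
  then show ?thesis
    by (simp only: sum_product mult_single)
qed

lemma comm_ring_hom_mpoly_eval: "comm_ring_hom (mpoly_eval x)"
proof (rule comm_ring_homI)
  fix P Q :: "(nat \<Rightarrow>\<^sub>0 nat) \<Rightarrow>\<^sub>0 'a"
  show "mpoly_eval x (P * Q) = mpoly_eval x P * mpoly_eval x Q"
    by (subst poly_mapping_mult_eq_sum)
       (simp add: mpoly_eval_sum mpoly_eval_single mon_val_simps
          mpoly_eval_superset[of "Poly_Mapping.keys P" P] mpoly_eval_superset[of "Poly_Mapping.keys Q" Q]
          sum_product mult_ac)
  show "mpoly_eval x (1 :: (nat \<Rightarrow>\<^sub>0 nat) \<Rightarrow>\<^sub>0 'a) = 1"
    using mpoly_eval_single[of x 0 1] by (simp add: mon_val_simps)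
qed (rule mpoly_eval_add)

lemma subring_set_mpoly_over:
  assumes "subring_set B"
  shows "subring_set (mpoly_over B n)"
proof -
  interpret B: subring_set B by fact
  show ?thesis
  proof
    show "1 \<in> mpoly_over B n"
      by (auto simp: mpoly_over_def lookup_one when_def intro: B.mem_intros)
    show "P - Q \<in> mpoly_over B n" if "P \<in> mpoly_over B n" "Q \<in> mpoly_over B n" for P Q
    proof -
      have "Poly_Mapping.keys (P - Q) \<subseteq> Poly_Mapping.keys P \<union> Poly_Mapping.keys Q"
        by (auto simp: in_keys_iff lookup_minus)
      then show ?thesis
        using that unfolding mpoly_over_def
        by (auto simp: lookup_minus subset_iff intro!: B.mem_intros)
    qed
    show "P * Q \<in> mpoly_over B n" if P: "P \<in> mpoly_over B n" and Q: "Q \<in> mpoly_over B n" for P Q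
    proof -
      have "Poly_Mapping.lookup (P * Q) e \<in> B" for e
        by (subst poly_mapping_mult_eq_sum)
           (use P Q in \<open>auto simp: lookup_sum lookup_single when_def mpoly_over_def
              intro!: B.mem_intros\<close>)
      moreover have "Poly_Mapping.keys e \<subseteq> {..<n}" if e: "e \<in> Poly_Mapping.keys (P * Q)" for e
      proof -
        obtain a b where "e = a + b" "a \<in> Poly_Mapping.keys P" "b \<in> Poly_Mapping.keys Q"
          using e keys_mult[of P Q] by blast
        then show ?thesis
          using P Q keys_add[of a b] unfolding mpoly_over_def by blast
      qed
      ultimately show ?thesis
        by (auto simp: mpoly_over_def)
    qed
  qed
qed

text \<open>The presentation is \<open>B[x] / (\<delta> x - 1)\<close>, with Jacobian \<open>\<delta>\<close>. A polynomial \<open>P\<close> that vanishes at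
  \<open>1/\<delta>\<close> is a multiple of \<open>\<delta> x - 1\<close>: modulo \<open>\<delta> x - 1\<close> some \<open>\<delta>\<^sup>N P\<close> is a constant of \<open>B\<close>, which
  is zero since it vanishes at \<open>1/\<delta>\<close>, and \<open>P\<close> is congruent to \<open>x\<^sup>N \<delta>\<^sup>N P\<close>.\<close>

lemma etale_over_localization:
  fixes B :: "'a :: comm_ring_1 set"
  assumes B: "subring_set B" and \<delta>: "\<delta> \<in> B" and f: "f * \<delta> = 1"
  shows "etale_over B (ring_gen (insert f B))"
proof -
  define M where "M = mpoly_over B 1"
  define C where "C = (\<lambda>b :: 'a. Poly_Mapping.single (0 :: nat \<Rightarrow>\<^sub>0 nat) b)"
  define X where "X = Poly_Mapping.single (Poly_Mapping.single (0 :: nat) (1 :: nat)) (1 :: 'a)"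
  define g where "g = C \<delta> * X - 1"
  define x where "x = (\<lambda>_ :: nat. f)"
  define J where "J = (\<lambda>h. h * g) ` M"
  interpret B: subring_set B
    by (rule B)
  interpret M: subring_set M unfolding M_def by (rule subring_set_mpoly_over[OF B])
  interpret R: subring_set "ring_gen (insert f B)" by (rule subring_set_ring_gen)
  interpret ev: comm_ring_hom "mpoly_eval x" by (rule comm_ring_hom_mpoly_eval)
  interpret C: comm_ring_hom C
    unfolding C_def by (rule comm_ring_homI) (simp_all add: single_add mult_single)
  have C_mem: "C b \<in> M" if "b \<in> B" for b
    using that by (auto simp: C_def M_def mpoly_over_def lookup_single when_def B.zero_mem)
  have X_mem: "X \<in> M"
    by (auto simp: X_def M_def mpoly_over_def lookup_single when_def B.zero_mem B.one_mem)
  have g_mem: "g \<in> M"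
    unfolding g_def by (intro M.mem_intros C_mem X_mem \<delta>)
  have ev_C: "mpoly_eval x (C b) = b" for b
    by (simp add: C_def mpoly_eval_single mon_val_simps)
  have ev_X: "mpoly_eval x X = f"
    by (simp add: X_def mpoly_eval_single mon_val_simps x_def)
  have ev_g: "mpoly_eval x g = 0"
    using f by (simp add: g_def ev.hom_minus ev.hom_mult ev_C ev_X mult.commute)
  have X_power: "X ^ i = Poly_Mapping.single (Poly_Mapping.single 0 i) 1" for i
    by (induction i) (simp_all add: X_def mult_single flip: single_add)
  have single_eq: "Poly_Mapping.single e b = C b * X ^ Poly_Mapping.lookup e 0"
    if "Poly_Mapping.keys e \<subseteq> {..<1}" for e b
  proof -
    have "e = Poly_Mapping.single 0 (Poly_Mapping.lookup e 0)"
      by (rule poly_mapping_eqI) (use that in \<open>auto simp: lookup_single when_def in_keys_iff\<close>)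
    then show ?thesis
      by (simp add: X_power C_def mult_single)
  qed
  have J_add: "a + b \<in> J" if "a \<in> J" "b \<in> J" for a b
    using that unfolding J_def by (auto simp flip: distrib_right intro: M.mem_intros)
  have J_mult: "a * b \<in> J" if "a \<in> M" "b \<in> J" for a b
    using that unfolding J_def by (auto simp flip: mult.assoc intro: M.mem_intros)
  have J_power: "(C \<delta> * X) ^ i - 1 \<in> J" for i
  proof -
    have "(C \<delta> * X) ^ i - 1 = (\<Sum>j<i. (C \<delta> * X) ^ j) * g"
      using power_diff_1_eq[of "C \<delta> * X" i] by (simp add: g_def mult.commute)
    moreover have "(\<Sum>j<i. (C \<delta> * X) ^ j) \<in> M"
      by (intro M.mem_intros C_mem X_mem \<delta>)
    ultimately show ?thesis
      unfolding J_def by blast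
  qed
  have red: "\<exists>N b. b \<in> B \<and> C \<delta> ^ N * (\<Sum>e\<in>S. Poly_Mapping.single e (Poly_Mapping.lookup P e)) - C b \<in> J"
    if P: "P \<in> M" and "finite S" "S \<subseteq> Poly_Mapping.keys P" for P S
    using that(2,3)
  proof (induction S)
    case empty
    have "0 \<in> J" unfolding J_def using M.zero_mem by (intro image_eqI[of _ _ 0]) auto
    then show ?case by (intro exI[of _ 0]) (auto simp: B.zero_mem)
  next
    case (insert e S)
    let ?P = "\<Sum>e\<in>S. Poly_Mapping.single e (Poly_Mapping.lookup P e)"
    let ?c = "Poly_Mapping.lookup P e" and ?i = "Poly_Mapping.lookup e 0"
    obtain N b where N: "b \<in> B" "C \<delta> ^ N * ?P - C b \<in> J"
      using insert by auto
    have c: "?c \<in> B" and e: "Poly_Mapping.keys e \<subseteq> {..<1}"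
      using P insert.prems by (auto simp: M_def mpoly_over_def)
    have "C \<delta> ^ ?i * (C \<delta> ^ N * ?P - C b) + (C \<delta> ^ N * C ?c) * ((C \<delta> * X) ^ ?i - 1) \<in> J"
      by (intro J_add J_mult M.mem_intros C_mem \<delta> c N(2) J_power)
    also have "C \<delta> ^ ?i * (C \<delta> ^ N * ?P - C b) + (C \<delta> ^ N * C ?c) * ((C \<delta> * X) ^ ?i - 1)
        = C \<delta> ^ (?i + N) * (C ?c * X ^ ?i + ?P) - C (\<delta> ^ ?i * b + \<delta> ^ N * ?c)"
      by (simp add: C.hom_add C.hom_mult C.hom_power algebra_simps power_add power_mult_distrib)
    also have "C ?c * X ^ ?i + ?P = (\<Sum>e\<in>insert e S. Poly_Mapping.single e (Poly_Mapping.lookup P e))"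
      using insert.hyps by (simp add: single_eq[OF e])
    finally show ?case
      by (intro exI[of _ "?i + N"] exI[of _ "\<delta> ^ ?i * b + \<delta> ^ N * ?c"] conjI B.mem_intros \<delta> N c)
  qed
  have ker: "P \<in> J" if P: "P \<in> M" and 0: "mpoly_eval x P = 0" for P
  proof -
    obtain N b where N: "b \<in> B" "C \<delta> ^ N * P - C b \<in> J"
      using red[OF P, of "Poly_Mapping.keys P"] by (auto simp flip: poly_mapping_eq_sum_single)
    then obtain h where h: "C \<delta> ^ N * P - C b = h * g"
      unfolding J_def by blast
    have "- b = mpoly_eval x (C \<delta> ^ N * P - C b)"
      by (simp add: ev.hom_minus ev.hom_mult ev_C 0)
    then have "b = 0"
      by (simp add: h ev.hom_mult ev_g)
    then have "X ^ N * (C \<delta> ^ N * P) \<in> J"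
      using N(2) by (intro J_mult[OF M.power_mem[OF X_mem]]) simp
    then have "X ^ N * (C \<delta> ^ N * P) + (- P) * ((C \<delta> * X) ^ N - 1) \<in> J"
      by (intro J_add J_mult[OF M.uminus_mem[OF P] J_power])
    then show ?thesis
      by (simp add: power_mult_distrib algebra_simps)
  qed
  have img: "ring_gen (insert f B) = mpoly_eval x ` M"
  proof
    have "subring_set (mpoly_eval x ` M)"
    proof
      show "1 \<in> mpoly_eval x ` M"
        using M.one_mem by (intro image_eqI[of _ _ 1]) auto
    qed (auto simp flip: ev.hom_minus ev.hom_mult intro: M.mem_intros)
    moreover have "b \<in> mpoly_eval x ` M" if "b \<in> B" for b
      using C_mem[OF that] by (metis ev_C imageI)
    moreover have "f \<in> mpoly_eval x ` M"
      using X_mem by (metis ev_X imageI)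
    ultimately show "ring_gen (insert f B) \<subseteq> mpoly_eval x ` M"
      by (intro ring_gen_subset) auto
    show "mpoly_eval x ` M \<subseteq> ring_gen (insert f B)"
    proof clarify
      fix P assume "P \<in> M"
      then have P: "Poly_Mapping.lookup P e \<in> ring_gen (insert f B)" for e
        by (intro ring_gen_incl) (auto simp: M_def mpoly_over_def)
      show "mpoly_eval x P \<in> ring_gen (insert f B)"
        unfolding mpoly_eval_def x_def
        by (intro R.sum_mem R.mult_mem R.prod_mem R.power_mem P ring_gen_incl insertI1)
    qed
  qed
  have "mpoly_pderiv 0 g = C \<delta>"
  proof -
    let ?e = "Poly_Mapping.single (0 :: nat) (1 :: nat)"
    have ne: "?e \<noteq> 0" by (metis lookup_single_eq lookup_zero zero_neq_one)
    have g: "g = Poly_Mapping.single ?e \<delta> - Poly_Mapping.single 0 1"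
      by (simp add: g_def C_def X_def mult_single)
    have "mpoly_pderiv 0 g = (\<Sum>e\<in>{?e, 0}. Poly_Mapping.single (e - ?e)
        (of_nat (Poly_Mapping.lookup e 0) * Poly_Mapping.lookup g e))"
      unfolding mpoly_pderiv_def
      by (rule sum.mono_neutral_left)
         (auto simp: g in_keys_iff lookup_minus lookup_single lookup_one when_def split: if_splits)
    also have "\<dots> = C \<delta>"
      using ne by (simp add: g C_def lookup_minus lookup_single lookup_one when_def)
    finally show ?thesis .
  qed
  then have det: "det (mat 1 1 (\<lambda>(i, j). mpoly_eval x (mpoly_pderiv j g))) = \<delta>"
    by (subst det_single) (auto simp: ev_C)
  have lt: "{..<1 :: nat} = {0}"
    by auto
  show ?thesis
    unfolding etale_over_def
  proof (intro exI[of _ "1 :: nat"] exI[of _ x] exI[of _ "\<lambda>_. g"] conjI ballI)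
    fix P assume P: "P \<in> mpoly_over B 1"
    show "mpoly_eval x P = 0 \<longleftrightarrow> (\<exists>h. (\<forall>i<1 :: nat. h i \<in> mpoly_over B 1) \<and> P = (\<Sum>i<1 :: nat. h i * g))"
    proof
      assume "mpoly_eval x P = 0"
      then obtain h where "h \<in> M" "P = h * g"
        using ker P unfolding M_def J_def by blast
      then show "\<exists>h. (\<forall>i<1 :: nat. h i \<in> mpoly_over B 1) \<and> P = (\<Sum>i<1 :: nat. h i * g)"
        by (intro exI[of _ "\<lambda>_. h"]) (auto simp: M_def lt)
    qed (auto simp: ev.hom_mult ev_g lt)
  next
    show "\<exists>u\<in>ring_gen (insert f B). u * det (mat 1 1 (\<lambda>(i, j). mpoly_eval x (mpoly_pderiv j g))) = 1"
      using f by (intro bexI[of _ f]) (simp_all only: det ring_gen_incl insertI1)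
  qed (use g_mem img in \<open>auto simp: M_def\<close>)
qed

definition denom :: "'v set \<Rightarrow> ('v \<Rightarrow> 'v \<Rightarrow> int) \<Rightarrow> ('v, 'c :: comm_ring_1) mfps" where
  "denom A Q = 1 - (\<Sum>\<alpha>\<in>A. minus_one_pow (Q \<alpha> \<alpha>) * mfps_var \<alpha>)"

lemma f_classical_denom: "f_classical A Q * denom A Q = 1"
  using f_classical_inverse[of A Q] by (simp add: denom_def mfps_const.hom_minus_one_pow)

lemma etale_R_classical: "etale_over (Zt A) (R_classical A Q)"
proof -
  interpret subring_set "Zt A"
    unfolding Zt_def by (rule subring_set_ring_gen)
  have "denom A Q \<in> Zt A"
    unfolding denom_def by (intro mem_intros) (auto simp: Zt_def intro: ring_gen_incl)
  then show ?thesis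
    unfolding R_classical_def
    by (rule etale_over_localization[OF subring_set_axioms _ f_classical_denom])
qed

section \<open>Endomorphisms of p-adic completions\<close>

definition subring_of :: "'r :: comm_ring_1 set \<Rightarrow> 'r ring" where
  "subring_of S = univ_ring\<lparr>carrier := S\<rparr>"

lemma subring_of_simps [simp]:
  "carrier (subring_of S) = S" "mult (subring_of S) = (*)" "zero (subring_of S) = 0"
  "add (subring_of S) = (+)"
  by (simp_all add: subring_of_def univ_ring_def)

lemma subring_of_one: "\<one>\<^bsub>subring_of S\<^esub> = 1"
  by (simp add: subring_of_def)

definition pcoset :: "'r :: comm_ring_1 set \<Rightarrow> nat \<Rightarrow> nat \<Rightarrow> 'r \<Rightarrow> 'r set" where
  "pcoset S p n a = {of_nat (p ^ n) * s + a | s. s \<in> S}"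

context subring_set
begin

lemma cring_subring_of: "cring (subring_of S)"
proof (rule cringI)
  show "abelian_group (subring_of S)"
  proof (rule abelian_groupI)
    fix x assume "x \<in> carrier (subring_of S)"
    then show "\<exists>y\<in>carrier (subring_of S). y \<oplus>\<^bsub>subring_of S\<^esub> x = \<zero>\<^bsub>subring_of S\<^esub>"
      by (intro bexI[of _ "- x"]) (auto intro: mem_intros)
  qed (auto simp: algebra_simps intro: mem_intros)
  show "comm_monoid (subring_of S)"
    by unfold_locales (auto simp: algebra_simps subring_of_one intro: mem_intros)
qed (auto simp: algebra_simps)

lemma add_pow_one: "[(k :: nat)] \<cdot>\<^bsub>subring_of S\<^esub> \<one>\<^bsub>subring_of S\<^esub> = of_nat k"
  by (induction k) (simp_all add: add_pow_def nat_pow_def add.commute subring_of_one)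

lemma pn_ideal_eq: "pn_ideal (subring_of S) p n = {of_nat (p ^ n) * s | s. s \<in> S}"
  unfolding cgenideal_def add_pow_one by (auto simp: mult.commute)

lemma pn_ideal_ideal: "ideal (pn_ideal (subring_of S) p n) (subring_of S)"
  by (rule cring.cgenideal_ideal[OF cring_subring_of]) (simp add: add_pow_one of_nat_mem del: of_nat_power)

lemma pn_ideal_coset: "pn_ideal (subring_of S) p n +>\<^bsub>subring_of S\<^esub> a = pcoset S p n a"
  unfolding a_r_coset_def' pn_ideal_eq pcoset_def by auto

lemma to_completion_eq: "to_completion (subring_of S) p a = (\<lambda>n. pcoset S p n a)"
  unfolding to_completion_def pn_ideal_coset ..

lemma quot_carrier: "carrier (subring_of S Quot pn_ideal (subring_of S) p n) = pcoset S p n ` S"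
  unfolding FactRing_def A_RCOSETS_def' pn_ideal_coset by auto

lemma quot_mult:
  assumes "a \<in> S" "b \<in> S"
  shows "pcoset S p n a \<otimes>\<^bsub>subring_of S Quot pn_ideal (subring_of S) p n\<^esub> pcoset S p n b
    = pcoset S p n (a * b)"
  using ideal.rcoset_mult_add[OF pn_ideal_ideal, of a b p n] assms
  by (simp add: FactRing_def pn_ideal_coset)

lemma quot_add:
  assumes "a \<in> S" "b \<in> S"
  shows "pcoset S p n a \<oplus>\<^bsub>subring_of S Quot pn_ideal (subring_of S) p n\<^esub> pcoset S p n b
    = pcoset S p n (a + b)"
  using abelian_subgroup.a_rcos_sum[OF abelian_subgroupI3[OF ideal.axioms(1)[OF pn_ideal_ideal]
      cring.axioms(1)[OF cring_subring_of, THEN ring.is_abelian_group]], of a b p n] assms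
  by (simp add: FactRing_def pn_ideal_coset)

lemma quot_one: "\<one>\<^bsub>subring_of S Quot pn_ideal (subring_of S) p n\<^esub> = pcoset S p n 1"
  using pn_ideal_coset[of p n 1] by (simp add: FactRing_def subring_of_one)

lemma pcoset_self: "a \<in> pcoset S p n a"
  unfolding pcoset_def by (auto intro!: exI[of _ 0] zero_mem)

end

text \<open>A ring endomorphism \<open>\<psi>\<close> of a ring \<open>T\<close> acts on the completion of a subring \<open>S\<close> as soon as
  \<open>S / p\<^sup>n\<close> embeds into \<open>T / p\<^sup>n\<close> with an image stable under \<open>\<psi>\<close>.\<close>

locale padic_stable = S: subring_set S + T: subring_set T + comm_ring_hom \<psi>
  for S T :: "'r :: comm_ring_1 set" and \<psi> :: "'r \<Rightarrow> 'r" +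
  fixes p :: nat
  assumes subset: "S \<subseteq> T"
    and stable: "t \<in> T \<Longrightarrow> \<psi> t \<in> T"
    and pure: "a \<in> S \<Longrightarrow> a = of_nat (p ^ n) * t \<Longrightarrow> t \<in> T \<Longrightarrow> \<exists>s\<in>S. a = of_nat (p ^ n) * s"
    and approx: "b \<in> S \<Longrightarrow> \<exists>a\<in>S. \<exists>t\<in>T. \<psi> b - a = of_nat (p ^ n) * t"
begin

text \<open>The image of a coset is described through congruences in \<open>T\<close>, since \<open>\<psi>\<close> maps \<open>S\<close> into \<open>T\<close> and
  its values are only congruent to elements of \<open>S\<close>.\<close>

definition completed :: "(nat \<Rightarrow> 'r set) \<Rightarrow> nat \<Rightarrow> 'r set" where
  "completed x n = {a \<in> S. \<exists>b\<in>x n. \<exists>t\<in>T. \<psi> b - a = of_nat (p ^ n) * t}"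

text \<open>Two elements of \<open>S\<close> that are congruent modulo \<open>p\<^sup>n\<close> in \<open>T\<close> are congruent in \<open>S\<close> by purity;
  so any approximation \<open>a\<close> of \<open>\<psi> b\<close> represents the coset.\<close>

lemma completed_pcoset:
  assumes "x n = pcoset S p n b" "a \<in> S" "\<psi> b - a = of_nat (p ^ n) * t" "t \<in> T"
  shows "completed x n = pcoset S p n a"
proof (intro Set.set_eqI iffI)
  fix c assume "c \<in> completed x n"
  then obtain s u where c: "c \<in> S" "s \<in> S" "u \<in> T" "\<psi> (of_nat (p ^ n) * s + b) - c = of_nat (p ^ n) * u"
    unfolding completed_def assms(1) pcoset_def by blast
  have "\<psi> (of_nat (p ^ n) * s + b) = of_nat (p ^ n) * \<psi> s + \<psi> b"
    by (simp only: hom_distribs)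
  then have "c - a = of_nat (p ^ n) * (\<psi> s - u + t)"
    using c(4) assms(3) by (simp add: algebra_simps)
  moreover have "\<psi> s - u + t \<in> T"
    using c assms(4) subset by (intro T.mem_intros stable) auto
  ultimately obtain v where "v \<in> S" "c - a = of_nat (p ^ n) * v"
    using pure[of "c - a"] c(1) assms(2) S.diff_mem by blast
  then show "c \<in> pcoset S p n a"
    unfolding pcoset_def by (auto intro!: exI[of _ v] simp: algebra_simps)
next
  fix c assume "c \<in> pcoset S p n a"
  then obtain s where s: "s \<in> S" "c = of_nat (p ^ n) * s + a"
    unfolding pcoset_def by blast
  have "\<psi> b - c = of_nat (p ^ n) * (t - s)"
    using assms(3) by (simp add: s(2) algebra_simps)
  moreover have "t - s \<in> T"
    using s(1) assms(4) subset by (intro T.mem_intros) auto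
  moreover have "c \<in> S"
    unfolding s(2) using s(1) assms(2) by (intro S.mem_intros)
  moreover have "b \<in> x n"
    unfolding assms(1) by (rule S.pcoset_self)
  ultimately show "c \<in> completed x n"
    unfolding completed_def by blast
qed

lemma completed_to_completion:
  assumes "a \<in> S" "\<psi> b - a = of_nat (p ^ n) * t" "t \<in> T"
  shows "completed (to_completion (subring_of S) p b) n = to_completion (subring_of S) p a n"
  using completed_pcoset[OF _ assms] by (simp add: S.to_completion_eq)

lemma completed_to_completion_exact:
  assumes "\<psi> b \<in> S"
  shows "completed (to_completion (subring_of S) p b) = to_completion (subring_of S) p (\<psi> b)"
  by (rule ext, rule completed_to_completion[of _ _ _ 0]) (auto simp: assms T.zero_mem)

lemma completion_component:
  assumes "x \<in> carrier (padic_completion (subring_of S) p)"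
  obtains b a t where "b \<in> S" "x n = pcoset S p n b" "a \<in> S" "t \<in> T"
    "\<psi> b - a = of_nat (p ^ n) * t" "completed x n = pcoset S p n a"
proof -
  have "x n \<in> pcoset S p n ` S"
    using assms by (simp add: padic_completion_def S.quot_carrier)
  then obtain b where b: "b \<in> S" "x n = pcoset S p n b" by blast
  moreover obtain a t where a: "a \<in> S" "t \<in> T" "\<psi> b - a = of_nat (p ^ n) * t"
    using approx[OF b(1)] by blast
  ultimately show ?thesis
    using that completed_pcoset by blast
qed

lemma completed_ring_hom:
  "completed \<in> Ring.ring_hom (padic_completion (subring_of S) p) (padic_completion (subring_of S) p)"
    (is "_ \<in> Ring.ring_hom ?C ?C")
proof (rule ring_hom_memI)
  fix x assume x: "x \<in> carrier ?C"
  show "completed x \<in> carrier ?C"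
  proof -
    have "completed x n \<in> pcoset S p n ` S" for n
      using completion_component[OF x, of n] by blast
    moreover have "completed x (Suc n) \<subseteq> completed x n" for n
    proof
      fix a assume "a \<in> completed x (Suc n)"
      then obtain b t where *: "a \<in> S" "b \<in> x (Suc n)" "t \<in> T" "\<psi> b - a = of_nat (p ^ Suc n) * t"
        unfolding completed_def by blast
      moreover have "x (Suc n) \<subseteq> x n"
        using x by (simp add: padic_completion_def)
      moreover have "\<psi> b - a = of_nat (p ^ n) * (of_nat p * t)"
        using *(4) by (simp add: mult_ac)
      moreover have "of_nat p * t \<in> T"
        using * by (intro T.mem_intros)
      ultimately show "a \<in> completed x n"
        unfolding completed_def by blast
    qed
    ultimately show ?thesis
      by (simp add: padic_completion_def S.quot_carrier)
  qed
next
  fix x y assume x: "x \<in> carrier ?C" and y: "y \<in> carrier ?C"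
  show "completed (x \<otimes>\<^bsub>?C\<^esub> y) = completed x \<otimes>\<^bsub>?C\<^esub> completed y"
  proof
    fix n
    obtain b a t where 1: "b \<in> S" "x n = pcoset S p n b" "a \<in> S" "t \<in> T"
      "\<psi> b - a = of_nat (p ^ n) * t" "completed x n = pcoset S p n a"
      using completion_component[OF x, of n] by metis
    obtain b' a' t' where 2: "b' \<in> S" "y n = pcoset S p n b'" "a' \<in> S" "t' \<in> T"
      "\<psi> b' - a' = of_nat (p ^ n) * t'" "completed y n = pcoset S p n a'"
      using completion_component[OF y, of n] by metis
    have "\<psi> (b * b') - a * a' = (\<psi> b - a) * \<psi> b' + a * (\<psi> b' - a')"
      by (simp add: hom_mult algebra_simps)
    also have "\<dots> = of_nat (p ^ n) * (t * \<psi> b' + a * t')"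
      unfolding 1(5) 2(5) by (simp add: algebra_simps)
    finally have "\<psi> (b * b') - a * a' = of_nat (p ^ n) * (t * \<psi> b' + a * t')" .
    moreover have "t * \<psi> b' + a * t' \<in> T"
      using 1 2 subset by (intro T.mem_intros stable) auto
    moreover have "(x \<otimes>\<^bsub>?C\<^esub> y) n = pcoset S p n (b * b')"
      by (simp add: padic_completion_def 1(2) 2(2) S.quot_mult 1(1) 2(1))
    ultimately have "completed (x \<otimes>\<^bsub>?C\<^esub> y) n = pcoset S p n (a * a')"
      using 1 2 by (intro completed_pcoset S.mem_intros)
    then show "completed (x \<otimes>\<^bsub>?C\<^esub> y) n = (completed x \<otimes>\<^bsub>?C\<^esub> completed y) n"
      by (simp add: padic_completion_def 1(6) 2(6) S.quot_mult 1(3) 2(3))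
  qed
  show "completed (x \<oplus>\<^bsub>?C\<^esub> y) = completed x \<oplus>\<^bsub>?C\<^esub> completed y"
  proof
    fix n
    obtain b a t where 1: "b \<in> S" "x n = pcoset S p n b" "a \<in> S" "t \<in> T"
      "\<psi> b - a = of_nat (p ^ n) * t" "completed x n = pcoset S p n a"
      using completion_component[OF x, of n] by metis
    obtain b' a' t' where 2: "b' \<in> S" "y n = pcoset S p n b'" "a' \<in> S" "t' \<in> T"
      "\<psi> b' - a' = of_nat (p ^ n) * t'" "completed y n = pcoset S p n a'"
      using completion_component[OF y, of n] by metis
    have "\<psi> (b + b') - (a + a') = (\<psi> b - a) + (\<psi> b' - a')"
      by (simp add: hom_add algebra_simps)
    also have "\<dots> = of_nat (p ^ n) * (t + t')"
      unfolding 1(5) 2(5) by (simp add: algebra_simps)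
    finally have "\<psi> (b + b') - (a + a') = of_nat (p ^ n) * (t + t')" .
    moreover have "t + t' \<in> T"
      using 1 2 by (intro T.mem_intros) auto
    moreover have "(x \<oplus>\<^bsub>?C\<^esub> y) n = pcoset S p n (b + b')"
      by (simp add: padic_completion_def 1(2) 2(2) S.quot_add 1(1) 2(1))
    ultimately have "completed (x \<oplus>\<^bsub>?C\<^esub> y) n = pcoset S p n (a + a')"
      using 1 2 by (intro completed_pcoset S.mem_intros)
    then show "completed (x \<oplus>\<^bsub>?C\<^esub> y) n = (completed x \<oplus>\<^bsub>?C\<^esub> completed y) n"
      by (simp add: padic_completion_def 1(6) 2(6) S.quot_add 1(3) 2(3))
  qed
next
  show "completed \<one>\<^bsub>?C\<^esub> = \<one>\<^bsub>?C\<^esub>"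
  proof
    fix n
    have "completed \<one>\<^bsub>?C\<^esub> n = pcoset S p n 1"
      by (rule completed_pcoset[of _ _ 1 _ 0])
         (auto simp: padic_completion_def S.quot_one hom_one S.one_mem T.zero_mem)
    then show "completed \<one>\<^bsub>?C\<^esub> n = \<one>\<^bsub>?C\<^esub> n"
      by (simp add: padic_completion_def S.quot_one)
  qed
qed

end

section \<open>The level rings\<close>

definition integral_series :: "complex \<Rightarrow> ('v, complex) mfps set" where
  "integral_series z = {F. \<forall>k. mfps_coeff F k \<in> ring_gen {z}}"

definition integral_polys :: "complex \<Rightarrow> 'v set \<Rightarrow> ('v, complex) mfps set" where
  "integral_polys z A = {F \<in> integral_series z. finite {k. mfps_coeff F k \<noteq> 0}
     \<and> (\<forall>k. mfps_coeff F k \<noteq> 0 \<longrightarrow> Poly_Mapping.keys k \<subseteq> A)}"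

lemma subring_set_integral_series: "subring_set (integral_series z)"
proof -
  interpret L: subring_set "ring_gen {z}" by (rule subring_set_ring_gen)
  show ?thesis
    by unfold_locales (auto simp: integral_series_def times_mfps.rep_eq intro!: L.mem_intros)
qed

lemma subring_set_integral_polys: "subring_set (integral_polys z A)"
proof -
  interpret subring_set "integral_series z" by (rule subring_set_integral_series)
  show ?thesis
  proof
    have "{k :: 'a \<Rightarrow>\<^sub>0 nat. k = 0} = {0}" by auto
    then show "1 \<in> integral_polys z A"
      using one_mem by (simp add: integral_polys_def)
  next
    fix F G assume F: "F \<in> integral_polys z A" and G: "G \<in> integral_polys z A"
    let ?s = "\<lambda>F :: ('a, complex) mfps. {k. mfps_coeff F k \<noteq> 0}"
    have "?s (F - G) \<subseteq> ?s F \<union> ?s G" by auto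
    then have "finite (?s (F - G))"
      by (rule finite_subset) (use F G in \<open>auto simp: integral_polys_def\<close>)
    moreover have "Poly_Mapping.keys k \<subseteq> A" if "k \<in> ?s (F - G)" for k
      using that F G \<open>?s (F - G) \<subseteq> ?s F \<union> ?s G\<close> by (auto simp: integral_polys_def)
    ultimately show "F - G \<in> integral_polys z A"
      using F G by (auto simp: integral_polys_def intro: mem_intros)
    have sub: "?s (F * G) \<subseteq> (\<lambda>(a, b). a + b) ` (?s F \<times> ?s G)"
    proof
      fix k assume "k \<in> ?s (F * G)"
      then have "(\<Sum>(a, b) | a + b = k. mfps_coeff F a * mfps_coeff G b) \<noteq> 0"
        by (simp add: times_mfps.rep_eq)
      then obtain x where "x \<in> {(a, b). a + b = k}"
        "(case x of (a, b) \<Rightarrow> mfps_coeff F a * mfps_coeff G b) \<noteq> 0"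
        by (rule sum.not_neutral_contains_not_neutral)
      then show "k \<in> (\<lambda>(a, b). a + b) ` (?s F \<times> ?s G)"
        by force
    qed
    then have "finite (?s (F * G))"
      by (rule finite_subset) (use F G in \<open>auto simp: integral_polys_def\<close>)
    moreover have "Poly_Mapping.keys k \<subseteq> A" if k: "k \<in> ?s (F * G)" for k
    proof -
      obtain x where x: "x \<in> ?s F \<times> ?s G" "k = (\<lambda>(a, b). a + b) x"
        using subsetD[OF sub k] by (rule imageE)
      then have "mfps_coeff F (fst x) \<noteq> 0" "mfps_coeff G (snd x) \<noteq> 0"
        by auto
      then have "Poly_Mapping.keys (fst x) \<subseteq> A" "Poly_Mapping.keys (snd x) \<subseteq> A"
        using F G unfolding integral_polys_def by blast+
      moreover have "k = fst x + snd x"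
        using x(2) by (simp add: case_prod_beta)
      ultimately show ?thesis
        using keys_add[of "fst x" "snd x"] by blast
    qed
    ultimately show "F * G \<in> integral_polys z A"
      using F G by (auto simp: integral_polys_def intro: mem_intros)
  qed
qed

lemma mfps_of_nat_coeff: "mfps_coeff (of_nat n * F) k = of_nat n * mfps_coeff F k"
  using mfps_const_coeff[of "of_nat n" F k] by (simp add: mfps_const.hom_of_nat)

lemma comm_ring_hom_level_embed:
  assumes "M \<ge> 1"
  shows "comm_ring_hom (level_embed M :: ('v, int) mfps \<Rightarrow> ('v, complex) mfps)"
proof -
  interpret s: comm_ring_hom "mfps_subst_power M :: ('v, complex) mfps \<Rightarrow> _"
    by (rule comm_ring_hom_subst_power[OF assms])
  interpret m: comm_ring_hom "mfps_map of_int :: ('v, int) mfps \<Rightarrow> ('v, complex) mfps"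
    by (rule comm_ring_hom_map[OF comm_ring_hom_of_int])
  show ?thesis
    unfolding level_embed_def
    by (rule comm_ring_homI) (simp_all add: m.hom_add m.hom_mult s.hom_add s.hom_mult)
qed

lemma level_embed_var: "M \<ge> 1 \<Longrightarrow> level_embed M (mfps_var \<alpha>) = mfps_var \<alpha> ^ M"
  by (simp add: level_embed_def mfps_map_var[OF comm_ring_hom_of_int] mfps_subst_power_var)

lemma subst_power_level_embed:
  "n \<ge> 1 \<Longrightarrow> M \<ge> 1 \<Longrightarrow> mfps_subst_power n (level_embed M g) = level_embed (n * M) g"
  by (simp add: level_embed_def mfps_subst_power_subst_power)

text \<open>The ring \<open>S\<close> below is \<open>R\<^sub>m\<close> for \<open>m = M\<close> and \<open>z = \<zeta>\<^sub>m\<close>, presented with a single generator \<open>h\<close>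
  besides the variables and \<open>\<zeta>\<^sub>m\<close>; its inverse \<open>d\<close> is the denominator at level \<open>m\<close>. The ring \<open>T\<close>
  consists of all power series over \<open>\<int>[\<zeta>\<^sub>m]\<close> in the variables \<open>t\<^sub>\<alpha>\<^bsup>1/m\<^esup>\<close>.\<close>

locale level =
  fixes z :: complex and A :: "'v set" and Q :: "'v \<Rightarrow> 'v \<Rightarrow> int" and M :: nat
  assumes finite_A: "finite A" and M: "M \<ge> 1"
begin

definition d :: "('v, complex) mfps" where
  "d = 1 - (\<Sum>\<alpha>\<in>A. minus_one_pow (Q \<alpha> \<alpha>) * mfps_var \<alpha> ^ M)"

definition h :: "('v, complex) mfps" where
  "h = level_embed M (f_classical A Q)"

definition S :: "('v, complex) mfps set" where
  "S = ring_gen (insert h (mfps_var ` A \<union> {mfps_const z}))"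

abbreviation T :: "('v, complex) mfps set" where "T \<equiv> integral_series z"

sublocale S: subring_set S
  unfolding S_def by (rule subring_set_ring_gen)

sublocale T: subring_set T
  by (rule subring_set_integral_series)

sublocale P: subring_set "integral_polys z A"
  by (rule subring_set_integral_polys)

sublocale L: subring_set "ring_gen {z}"
  by (rule subring_set_ring_gen)

sublocale emb: comm_ring_hom "level_embed M :: ('v, int) mfps \<Rightarrow> ('v, complex) mfps"
  by (rule comm_ring_hom_level_embed[OF M])

lemma emb_denom: "level_embed M (denom A Q) = d"
  by (simp add: denom_def d_def hom_distribs emb.hom_minus_one_pow level_embed_var[OF M])

lemma h_d: "h * d = 1"
  using arg_cong[OF f_classical_denom[of A Q], of "level_embed M"]
  by (simp add: emb.hom_mult emb_denom h_def)

lemma h_mem: "h \<in> S" and var_mem: "\<alpha> \<in> A \<Longrightarrow> mfps_var \<alpha> \<in> S" and z_mem: "mfps_const z \<in> S"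
  unfolding S_def by (auto intro: ring_gen_incl)

lemma d_mem: "d \<in> S"
  unfolding d_def by (intro S.mem_intros var_mem)

lemma R_classical_subset:
  assumes "subring_set U" "f_classical A Q \<in> U" "\<And>\<alpha>. \<alpha> \<in> A \<Longrightarrow> mfps_var \<alpha> \<in> U"
  shows "R_classical A Q \<subseteq> U"
  unfolding R_classical_def Zt_def
  by (intro ring_gen_subset assms(1) insert_subsetI assms(2)) (use assms(3) in auto)

lemma level_embed_mem: "g \<in> R_classical A Q \<Longrightarrow> level_embed M g \<in> S"
  using R_classical_subset[OF emb.subring_set_vimage[OF S.subring_set_axioms]] h_mem
  by (auto simp: level_embed_var[OF M] h_def intro: S.mem_intros var_mem)

text \<open>At level \<open>M\<close> the generators of \<open>R\<close> become \<open>h\<close> and the \<open>M\<close>-th powers of the variables.\<close>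

lemma level_ring_eq:
  assumes "\<zeta> M = z"
  shows "level_ring \<zeta> A (R_classical A Q) M = subring_of S"
proof -
  let ?G = "level_embed M ` R_classical A Q \<union> mfps_var ` A \<union> {mfps_const z}"
  have "f_classical A Q \<in> R_classical A Q"
    unfolding R_classical_def by (rule ring_gen_incl) simp
  then have "insert h (mfps_var ` A \<union> {mfps_const z}) \<subseteq> ring_gen ?G"
    unfolding h_def by (auto intro: ring_gen_incl)
  then have "S \<subseteq> ring_gen ?G"
    unfolding S_def by (intro ring_gen_subset subring_set_ring_gen)
  moreover have "ring_gen ?G \<subseteq> S"
    by (rule ring_gen_subset[OF S.subring_set_axioms]) (auto intro: level_embed_mem var_mem z_mem)
  ultimately show ?thesis
    by (simp add: level_ring_def subring_of_def assms)
qed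

lemma const_mem: "c \<in> ring_gen {z} \<Longrightarrow> mfps_const c \<in> S"
  using ring_gen_subset[OF mfps_const.subring_set_vimage[OF S.subring_set_axioms], of "{z}"] z_mem
  by auto

lemma const_integral: "c \<in> ring_gen {z} \<Longrightarrow> mfps_const c \<in> T"
  by (auto simp: integral_series_def mfps_const.rep_eq intro: L.mem_intros)

lemma monom_mem: "Poly_Mapping.keys k \<subseteq> A \<Longrightarrow> mfps_monom k \<in> S"
  by (subst mfps_monom_eq_prod[OF finite_A]) (auto intro!: S.mem_intros var_mem)

lemma monom_poly: "Poly_Mapping.keys k \<subseteq> A \<Longrightarrow> mfps_monom k \<in> integral_polys z A"
proof -
  have "{j :: 'v \<Rightarrow>\<^sub>0 nat. j = k} = {k}" by auto
  then show "Poly_Mapping.keys k \<subseteq> A \<Longrightarrow> mfps_monom k \<in> integral_polys z A"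
    by (auto simp: integral_polys_def integral_series_def mfps_monom_coeff intro: L.mem_intros)
qed

lemma var_poly: "\<alpha> \<in> A \<Longrightarrow> mfps_var \<alpha> \<in> integral_polys z A"
  by (simp add: mfps_var_eq_monom monom_poly)

lemma d_poly: "d \<in> integral_polys z A"
  unfolding d_def by (intro P.mem_intros var_poly)

lemma z_poly: "mfps_const z \<in> integral_polys z A"
proof -
  have "{k :: 'v \<Rightarrow>\<^sub>0 nat. k = 0 \<and> z \<noteq> 0} \<subseteq> {0}" by auto
  then have "finite {k :: 'v \<Rightarrow>\<^sub>0 nat. k = 0 \<and> z \<noteq> 0}"
    by (rule finite_subset) simp
  then show ?thesis
    using const_integral[of z] by (auto simp: integral_polys_def mfps_const.rep_eq intro: ring_gen_incl)
qed

lemma poly_subset: "integral_polys z A \<subseteq> S"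
proof
  fix F assume F: "F \<in> integral_polys z A"
  let ?K = "{k. mfps_coeff F k \<noteq> 0}"
  have "F = (\<Sum>k\<in>?K. mfps_const (mfps_coeff F k) * mfps_monom k)"
  proof (rule mfps_eqI)
    fix k
    have "(\<Sum>j\<in>?K. mfps_coeff F j * (if k = j then 1 else 0)) = mfps_coeff F k"
      using F by (simp add: integral_polys_def if_distrib cong: if_cong)
    then show "mfps_coeff F k
        = mfps_coeff (\<Sum>k\<in>?K. mfps_const (mfps_coeff F k) * mfps_monom k) k"
      by (simp add: mfps_coeff_sum mfps_const_coeff mfps_monom_coeff)
  qed
  also have "\<dots> \<in> S"
    using F by (intro S.mem_intros const_mem monom_mem)
      (auto simp: integral_polys_def integral_series_def)
  finally show "F \<in> S" .
qed

text \<open>The series that become polynomials when multiplied by some power of \<open>d\<close> form a ring, and this ring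
  contains the generators of \<open>S\<close>.\<close>

lemma S_denominator:
  assumes "b \<in> S"
  shows "\<exists>N. b * d ^ N \<in> integral_polys z A"
proof -
  define U where "U = {b. \<exists>N. b * d ^ N \<in> integral_polys z A}"
  have raise: "b * d ^ (N + N') \<in> integral_polys z A" if "b * d ^ N \<in> integral_polys z A" for b N N'
    using P.mult_mem[OF that P.power_mem[OF d_poly, of N']] by (simp add: power_add mult_ac)
  have "subring_set U"
  proof
    show "1 \<in> U"
      unfolding U_def using P.one_mem by (auto intro!: exI[of _ 0])
  next
    fix a b assume "a \<in> U" "b \<in> U"
    then obtain N N' where *: "a * d ^ N \<in> integral_polys z A" "b * d ^ N' \<in> integral_polys z A"
      unfolding U_def by blast
    have "(a - b) * d ^ (N + N') \<in> integral_polys z A"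
      using P.diff_mem[OF raise[OF *(1), of N'] raise[OF *(2), of N]]
      by (simp add: left_diff_distrib add.commute)
    then show "a - b \<in> U"
      unfolding U_def by blast
    have "(a * b) * d ^ (N + N') \<in> integral_polys z A"
      using P.mult_mem[OF *] by (simp add: power_add mult_ac)
    then show "a * b \<in> U"
      unfolding U_def by blast
  qed
  moreover have "h \<in> U"
    unfolding U_def using h_d P.one_mem by (auto intro!: exI[of _ 1])
  moreover have "mfps_const z \<in> U" "mfps_var ` A \<subseteq> U"
    unfolding U_def using z_poly var_poly by (auto intro!: exI[of _ 0])
  ultimately have "S \<subseteq> U"
    unfolding S_def by (intro ring_gen_subset) auto
  then show ?thesis
    using assms unfolding U_def by blast
qed

lemma h_integral: "h \<in> T"
  by (auto simp: h_def level_embed_def integral_series_def mfps_subst_power.rep_eq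
      intro: L.mem_intros)

lemma S_integral: "S \<subseteq> T"
  unfolding S_def
  by (rule ring_gen_subset[OF T.subring_set_axioms])
     (use h_integral z_poly var_poly in \<open>auto simp: integral_polys_def\<close>)

text \<open>If a polynomial is \<open>p\<^sup>n\<close> times a power series over \<open>\<int>[\<zeta>\<^sub>m]\<close>, then this series is a polynomial
  too. Clearing the denominator, which is a unit of \<open>S\<close>, extends this from polynomials to \<open>S\<close>.\<close>

lemma S_pure:
  assumes "p > 0" "a \<in> S" "a = of_nat (p ^ n) * t" "t \<in> T"
  shows "t \<in> S"
proof -
  obtain N where N: "a * d ^ N \<in> integral_polys z A"
    using S_denominator[OF assms(2)] by blast
  have "d \<in> T"
    using d_poly by (simp add: integral_polys_def)
  then have "d ^ N \<in> T"
    by (rule T.power_mem)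
  then have "t * d ^ N \<in> T"
    by (intro T.mult_mem assms(4))
  moreover have "mfps_coeff (a * d ^ N) k = of_nat (p ^ n) * mfps_coeff (t * d ^ N) k" for k
    by (simp only: assms(3) mult.assoc mfps_of_nat_coeff)
  then have "mfps_coeff (a * d ^ N) k = 0 \<longleftrightarrow> mfps_coeff (t * d ^ N) k = 0" for k
    using assms(1) by simp
  ultimately have "t * d ^ N \<in> S"
    using N poly_subset by (auto simp: integral_polys_def)
  then have "t * d ^ N * h ^ N \<in> S"
    by (rule S.mult_mem[OF _ S.power_mem[OF h_mem]])
  also have "t * d ^ N * h ^ N = t * (h * d) ^ N"
    by (simp add: power_mult_distrib mult_ac)
  finally show ?thesis
    by (simp add: h_d)
qed

end

section \<open>Frobenius lifts\<close>

lemma (in subring_set) freshman_dream: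
  assumes "prime p" "x \<in> S" "y \<in> S"
  shows "\<exists>u\<in>S. (x + y) ^ p = x ^ p + y ^ p + of_nat p * u"
proof -
  define u where "u = (\<Sum>k\<in>{0<..<p}. of_nat ((p choose k) div p) * x ^ k * y ^ (p - k))"
  have p: "p > 0" using assms(1) prime_gt_0_nat by blast
  then have "{..p} = insert 0 (insert p {0<..<p})" by auto
  then have "(x + y) ^ p = x ^ p + y ^ p + (\<Sum>k\<in>{0<..<p}. of_nat (p choose k) * x ^ k * y ^ (p - k))"
    using p by (simp add: binomial_ring)
  also have "(\<Sum>k\<in>{0<..<p}. of_nat (p choose k) * x ^ k * y ^ (p - k)) = of_nat p * u"
    unfolding u_def sum_distrib_left
  proof (intro sum.cong refl)
    fix k assume "k \<in> {0<..<p}"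
    then have "p dvd (p choose k)"
      using assms(1) by (intro dvd_choose_prime) auto
    then have "(p choose k) = p * ((p choose k) div p)" by simp
    then have "(of_nat (p choose k) :: 'r) = of_nat p * of_nat ((p choose k) div p)"
      by (metis of_nat_mult)
    then show "of_nat (p choose k) * x ^ k * y ^ (p - k)
        = of_nat p * (of_nat ((p choose k) div p) * x ^ k * y ^ (p - k))"
      by (simp add: mult.assoc)
  qed
  finally show ?thesis
    using assms by (intro bexI[of _ u]) (auto simp: u_def intro!: mem_intros)
qed

text \<open>Closure under differences is the congruence \<open>(x - y)\<^sup>p \<equiv> x\<^sup>p - y\<^sup>p\<close> modulo \<open>p\<close>; taking the
  \<open>p\<close>-th power of \<open>(x - y) + y\<close> avoids the sign of \<open>(- y)\<^sup>p\<close>, which depends on \<open>p\<close>.\<close>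

lemma (in subring_set) subring_set_frobenius:
  assumes "comm_ring_hom \<psi>" "prime p" and stable: "\<And>x. x \<in> S \<Longrightarrow> \<psi> x \<in> S"
  shows "subring_set {x \<in> S. \<exists>t\<in>S. \<psi> x - x ^ p = of_nat p * t}"
proof -
  interpret comm_ring_hom \<psi> by fact
  show ?thesis
  proof
    show "1 \<in> {x \<in> S. \<exists>t\<in>S. \<psi> x - x ^ p = of_nat p * t}"
      by (auto intro!: mem_intros bexI[of _ 0])
  next
    fix x y
    assume x: "x \<in> {x \<in> S. \<exists>t\<in>S. \<psi> x - x ^ p = of_nat p * t}"
      and y: "y \<in> {x \<in> S. \<exists>t\<in>S. \<psi> x - x ^ p = of_nat p * t}"
    obtain t t' where t: "t \<in> S" "\<psi> x - x ^ p = of_nat p * t" "t' \<in> S" "\<psi> y - y ^ p = of_nat p * t'"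
      using x y by blast
    have xy: "x \<in> S" "y \<in> S" using x y by auto
    obtain u where u: "u \<in> S" "x ^ p = (x - y) ^ p + y ^ p + of_nat p * u"
      using freshman_dream[OF assms(2) diff_mem[OF xy] xy(2)] by auto
    have "\<psi> (x - y) - (x - y) ^ p = (\<psi> x - x ^ p) - (\<psi> y - y ^ p) + of_nat p * u"
      using u(2) by (simp add: hom_minus algebra_simps)
    also have "\<dots> = of_nat p * (t - t' + u)"
      unfolding t(2,4) by (simp add: algebra_simps)
    finally show "x - y \<in> {x \<in> S. \<exists>t\<in>S. \<psi> x - x ^ p = of_nat p * t}"
      using t u xy by (auto intro!: mem_intros bexI[of _ "t - t' + u"])
    have "\<psi> (x * y) - (x * y) ^ p = (\<psi> x - x ^ p) * \<psi> y + x ^ p * (\<psi> y - y ^ p)"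
      by (simp add: hom_mult power_mult_distrib algebra_simps)
    also have "\<dots> = of_nat p * (t * \<psi> y + x ^ p * t')"
      unfolding t(2,4) by (simp add: algebra_simps)
    finally show "x * y \<in> {x \<in> S. \<exists>t\<in>S. \<psi> x - x ^ p = of_nat p * t}"
      using t xy by (auto intro!: mem_intros stable bexI[of _ "t * \<psi> y + x ^ p * t'"])
  qed
qed

locale frobenius_level = level z A Q M
  for z :: complex and A :: "'v set" and Q :: "'v \<Rightarrow> 'v \<Rightarrow> int" and M :: nat +
  fixes p :: nat
  assumes prime: "prime p"
begin

abbreviation \<psi> :: "('v, complex) mfps \<Rightarrow> ('v, complex) mfps" where
  "\<psi> \<equiv> mfps_subst_power p"

lemma p_ge_1: "p \<ge> 1"
  using prime prime_ge_1_nat by blast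

sublocale comm_ring_hom \<psi>
  by (rule comm_ring_hom_subst_power[OF p_ge_1])

lemma T_stable: "F \<in> T \<Longrightarrow> \<psi> F \<in> T"
  by (auto simp: integral_series_def mfps_subst_power.rep_eq intro: L.mem_intros)

definition frob :: "('v, complex) mfps set" where
  "frob = {x \<in> T. \<exists>t\<in>T. \<psi> x - x ^ p = of_nat p * t}"

sublocale frob: subring_set frob
  unfolding frob_def
  by (rule T.subring_set_frobenius[OF comm_ring_hom_axioms prime T_stable])

lemma var_frob: "\<alpha> \<in> A \<Longrightarrow> mfps_var \<alpha> \<in> frob"
  using var_mem S_integral T.zero_mem
  by (auto simp: frob_def mfps_subst_power_var[OF p_ge_1] intro!: bexI[of _ 0])

lemma d_frob: "d \<in> frob"
  unfolding d_def by (intro frob.mem_intros var_frob)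

text \<open>The congruence \<open>\<psi> d \<equiv> d\<^sup>p\<close> passes to the inverse \<open>h\<close> of \<open>d\<close>.\<close>

lemma h_frob: "h \<in> frob"
proof -
  obtain t where t: "t \<in> T" "\<psi> d - d ^ p = of_nat p * t"
    using d_frob by (auto simp: frob_def)
  have 1: "\<psi> h * \<psi> d = 1"
    by (simp add: h_d flip: hom_mult)
  have 2: "h ^ p * d ^ p = 1"
    by (simp add: h_d flip: power_mult_distrib)
  have "\<psi> h - h ^ p = \<psi> h * (h ^ p * d ^ p) - h ^ p * (\<psi> h * \<psi> d)"
    by (simp add: 1 2)
  also have "\<dots> = - (\<psi> h * h ^ p * (\<psi> d - d ^ p))"
    by (simp add: algebra_simps)
  also have "\<dots> = of_nat p * (- (\<psi> h * h ^ p * t))"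
    unfolding t(2) by (simp add: algebra_simps)
  finally show ?thesis
    unfolding frob_def using h_integral t(1)
    by (auto intro!: bexI[of _ "- (\<psi> h * h ^ p * t)"] T.mem_intros T_stable)
qed

lemma level_embed_frob: "g \<in> R_classical A Q \<Longrightarrow> level_embed M g \<in> frob"
  using R_classical_subset[OF emb.subring_set_vimage[OF frob.subring_set_axioms]] h_frob
  by (auto simp: level_embed_var[OF M] h_def intro: frob.mem_intros var_frob)

text \<open>The inverse of \<open>\<psi> h\<close> is \<open>\<psi> d = d\<^sup>p + p t\<close> for some \<open>t\<close> in \<open>S\<close>. Hence \<open>\<psi> h\<close> is \<open>h\<^sup>p\<close> times a
  geometric series in multiples of \<open>p\<close>, and truncations of this series approximate \<open>\<psi> h\<close> by elements
  of \<open>S\<close>.\<close>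

lemma h_approx: "\<exists>a\<in>S. \<exists>t\<in>T. \<psi> h - a = of_nat (p ^ n) * t"
proof -
  obtain t where t: "t \<in> T" "\<psi> d - d ^ p = of_nat (p ^ 1) * t"
    using d_frob by (auto simp: frob_def)
  have "\<psi> d \<in> S"
    unfolding d_def
    by (auto simp: hom_distribs hom_minus_one_pow mfps_subst_power_var[OF p_ge_1]
        intro!: S.mem_intros var_mem)
  then have "\<psi> d - d ^ p \<in> S"
    by (intro S.mem_intros d_mem)
  then have tS: "t \<in> S"
    using S_pure[OF _ _ t(2,1)] p_ge_1 by simp
  \<comment> \<open>chosen such that \<open>\<psi> d = d\<^sup>p (1 - p w)\<close>\<close>
  define w where "w = - (t * h ^ p)"
  have w: "w \<in> S"
    unfolding w_def by (intro S.mem_intros tS h_mem)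
  have 1: "\<psi> h * \<psi> d = 1"
    by (simp add: h_d flip: hom_mult)
  have 2: "d ^ p * h ^ p = 1"
    using h_d by (simp add: mult.commute[of d] flip: power_mult_distrib)
  have "h ^ p = \<psi> h * (d ^ p + of_nat p * t) * h ^ p"
    using t(2) 1 by (simp add: algebra_simps)
  also have "\<dots> = \<psi> h * (d ^ p * h ^ p - of_nat p * w)"
    by (simp add: w_def algebra_simps)
  finally have hp: "h ^ p = \<psi> h * (1 - of_nat p * w)"
    by (simp add: 2)
  define a where "a = h ^ p * (\<Sum>i<n. (of_nat p * w) ^ i)"
  have "a = \<psi> h * ((1 - of_nat p * w) * (\<Sum>i<n. (of_nat p * w) ^ i))"
    unfolding a_def hp by (simp add: mult.assoc)
  also have "\<dots> = \<psi> h * (1 - (of_nat p * w) ^ n)"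
    by (simp add: one_diff_power_eq)
  finally have "\<psi> h - a = of_nat (p ^ n) * (\<psi> h * w ^ n)"
    by (simp add: power_mult_distrib algebra_simps)
  moreover have "a \<in> S"
    unfolding a_def by (intro S.mem_intros h_mem w)
  moreover have "\<psi> h * w ^ n \<in> T"
    using w S_integral by (intro T.mem_intros T_stable h_integral) auto
  ultimately show ?thesis
    by blast
qed

sublocale padic_stable S T \<psi> p
proof
  show "S \<subseteq> T" by (rule S_integral)
  show "\<exists>s\<in>S. a = of_nat (p ^ n) * s" if "a \<in> S" "a = of_nat (p ^ n) * t" "t \<in> T" for a n t
    using S_pure[OF _ that] p_ge_1 that(2) by auto
  fix b and n :: nat assume b: "b \<in> S"
  define U where "U = {b \<in> S. \<exists>a\<in>S. \<exists>t\<in>T. \<psi> b - a = of_nat (p ^ n) * t}"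
  have exact: "x \<in> U" if "x \<in> S" "\<psi> x \<in> S" for x
    unfolding U_def using that T.zero_mem by (auto intro!: bexI[of _ "\<psi> x" S] bexI[of _ 0 T])
  have "subring_set U"
  proof
    show "1 \<in> U"
      by (rule exact) (simp_all add: S.one_mem)
  next
    fix x y assume "x \<in> U" "y \<in> U"
    then obtain a t a' t' where *: "x \<in> S" "a \<in> S" "t \<in> T" "\<psi> x - a = of_nat (p ^ n) * t"
      "y \<in> S" "a' \<in> S" "t' \<in> T" "\<psi> y - a' = of_nat (p ^ n) * t'"
      unfolding U_def by blast
    have "\<psi> (x - y) - (a - a') = (\<psi> x - a) - (\<psi> y - a')"
      by (simp add: hom_minus)
    also have "\<dots> = of_nat (p ^ n) * (t - t')"
      unfolding *(4,8) by (simp add: algebra_simps)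
    finally show "x - y \<in> U"
      unfolding U_def using * by (blast intro: S.mem_intros T.mem_intros)
    have "\<psi> (x * y) - a * a' = (\<psi> x - a) * \<psi> y + a * (\<psi> y - a')"
      by (simp add: hom_mult algebra_simps)
    also have "\<dots> = of_nat (p ^ n) * (t * \<psi> y + a * t')"
      unfolding *(4,8) by (simp add: algebra_simps)
    finally have "\<psi> (x * y) - a * a' = of_nat (p ^ n) * (t * \<psi> y + a * t')" .
    moreover have "t * \<psi> y + a * t' \<in> T"
      using * S_integral by (intro T.mem_intros T_stable) auto
    ultimately show "x * y \<in> U"
      unfolding U_def using * by (blast intro: S.mem_intros)
  qed
  moreover have "h \<in> U"
    using h_approx h_mem unfolding U_def by blast
  moreover have "mfps_const z \<in> U"
    by (rule exact) (simp_all add: z_mem mfps_subst_power_const[OF p_ge_1])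
  moreover have "mfps_var \<alpha> \<in> U" if "\<alpha> \<in> A" for \<alpha>
    using that by (intro exact var_mem) (auto simp: mfps_subst_power_var[OF p_ge_1]
      intro!: S.mem_intros var_mem)
  ultimately have "S \<subseteq> U"
    unfolding S_def by (intro ring_gen_subset) auto
  then show "\<exists>a\<in>S. \<exists>t\<in>T. \<psi> b - a = of_nat (p ^ n) * t"
    using b unfolding U_def by blast
qed (rule T_stable)

lemma is_frobenius_lift_completed:
  assumes "\<zeta> M = z" "M = p * m"
  shows "is_frobenius_lift \<zeta> A (R_classical A Q) p m completed"
proof -
  have "completed (to_completion (subring_of S) p (level_embed M g)) 1
      = to_completion (subring_of S) p (level_embed M g ^ p) 1" if g: "g \<in> R_classical A Q" for g
  proof -
    obtain t where "t \<in> T" "\<psi> (level_embed M g) - level_embed M g ^ p = of_nat (p ^ 1) * t"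
      using level_embed_frob[OF g] by (auto simp: frob_def)
    then show ?thesis
      by (intro completed_to_completion S.mem_intros level_embed_mem g)
  qed
  moreover have "completed (to_completion (subring_of S) p (mfps_var \<alpha>))
      = to_completion (subring_of S) p (mfps_var \<alpha> ^ p)" if "\<alpha> \<in> A" for \<alpha>
    using completed_to_completion_exact[of "mfps_var \<alpha>"] S.power_mem[OF var_mem[OF that]]
    by (simp add: mfps_subst_power_var[OF p_ge_1])
  moreover have "completed (to_completion (subring_of S) p (mfps_const z))
      = to_completion (subring_of S) p (mfps_const z)"
    using completed_to_completion_exact[of "mfps_const z"] z_mem
    by (simp add: mfps_subst_power_const[OF p_ge_1])
  ultimately show ?thesis
    using level_ring_eq[of \<zeta>] assms completed_ring_hom
    by (simp add: is_frobenius_lift_def Let_def)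
qed

text \<open>Both sides of the gluing condition are images under \<open>\<psi>\<close>, which fixes constants; so it suffices
  that the sums converge to the coefficients of \<open>G\<close> before \<open>\<psi>\<close> is applied, and among power series over
  \<open>\<int>[\<zeta>\<^sub>p\<^sub>m]\<close>.\<close>

lemma habiro_gluedI:
  assumes "\<zeta> M = z" "M = p * m" "\<zeta> M - \<zeta> m \<in> ring_gen {z}"
    and F: "\<And>i. \<psi> (fps_nth F i) \<in> S" and G: "\<And>j. fps_nth G j \<in> S"
    and conv: "\<And>j N. \<forall>\<^sub>F n in sequentially. \<exists>t\<in>T.
      (\<Sum>i<n. of_nat ((i + j) choose j) * mfps_const ((\<zeta> M - \<zeta> m) ^ i) * fps_nth F (i + j))
        - fps_nth G j = of_nat (p ^ N) * t"
  shows "habiro_glued \<zeta> A (R_classical A Q) p m F G"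
proof -
  have "padic_sums (subring_of S) p
      (\<lambda>i. of_nat ((i + j) choose j) * mfps_const ((\<zeta> M - \<zeta> m) ^ i) * \<psi> (fps_nth F (i + j)))
      (completed (to_completion (subring_of S) p (fps_nth G j)))" for j
    unfolding padic_sums_def
  proof
    fix N
    show "\<forall>\<^sub>F n in sequentially. to_completion (subring_of S) p
        (\<Sum>i<n. of_nat ((i + j) choose j) * mfps_const ((\<zeta> M - \<zeta> m) ^ i) * \<psi> (fps_nth F (i + j))) N
      = completed (to_completion (subring_of S) p (fps_nth G j)) N"
      using conv[where j = j and N = N]
    proof (rule eventually_mono)
      fix n
      let ?s = "\<Sum>i<n. of_nat ((i + j) choose j) * mfps_const ((\<zeta> M - \<zeta> m) ^ i) * fps_nth F (i + j)"
      let ?s' = "\<Sum>i<n. of_nat ((i + j) choose j) * mfps_const ((\<zeta> M - \<zeta> m) ^ i)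
          * \<psi> (fps_nth F (i + j))"
      assume "\<exists>t\<in>T. ?s - fps_nth G j = of_nat (p ^ N) * t"
      then obtain t where t: "t \<in> T" "?s - fps_nth G j = of_nat (p ^ N) * t" by blast
      have "\<psi> (fps_nth G j) - ?s' = \<psi> (- (?s - fps_nth G j))"
        by (simp add: hom_distribs mfps_subst_power_const[OF p_ge_1])
      also have "\<dots> = of_nat (p ^ N) * (- \<psi> t)"
        unfolding t(2) by (simp add: hom_distribs)
      finally have "\<psi> (fps_nth G j) - ?s' = of_nat (p ^ N) * (- \<psi> t)" .
      moreover have "?s' \<in> S"
        by (intro S.mem_intros F const_mem L.mem_intros assms(3))
      moreover have "- \<psi> t \<in> T"
        by (intro T.mem_intros T_stable t)
      ultimately show "to_completion (subring_of S) p ?s' N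
          = completed (to_completion (subring_of S) p (fps_nth G j)) N"
        by (intro completed_to_completion[symmetric])
    qed
  qed
  then show ?thesis
    using is_frobenius_lift_completed[where \<zeta> = \<zeta> and m = m] level_ring_eq[of \<zeta>] assms(1,2)
    by (auto simp: habiro_glued_def Let_def)
qed

end

(* below, $ extracts coefficients of formal power series *)
no_notation vec_index (infixl "$" 100)

section \<open>Expansions at roots of unity\<close>

lemma gbinomial_of_int_mem:
  assumes "subring_set S"
  shows "(of_int b gchoose n :: complex) \<in> S"
proof -
  interpret subring_set S by fact
  show ?thesis
  proof (cases "b \<ge> 0")
    case True
    then have "(of_int b gchoose n :: complex) = of_nat (nat b choose n)"
      by (simp add: binomial_gbinomial)
    then show ?thesis by (simp add: of_nat_mem)
  next
    case False
    have "(of_nat n - of_int b - 1 :: complex) = of_nat (nat (int n - b - 1))"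
      using False by (simp add: of_nat_nat)
    then have "(of_int b gchoose n :: complex) = (- 1) ^ n * of_nat (nat (int n - b - 1) choose n)"
      by (subst gbinomial_negated_upper) (simp add: binomial_gbinomial)
    then show ?thesis
      by (auto intro!: mem_intros)
  qed
qed

abbreviation qexp :: "complex \<Rightarrow> int \<Rightarrow> complex fps" where
  "qexp z b \<equiv> (fps_const z + fps_X) powi b"

lemma qexp_step:
  assumes "z \<noteq> 0"
  shows "(fps_const z + fps_X) * Abs_fps (\<lambda>n. (of_int b gchoose n) * z powi (b - int n))
    = Abs_fps (\<lambda>n. (of_int (b + 1) gchoose n) * z powi (b + 1 - int n))"
proof (rule fps_ext)
  fix n
  have *: "z * z powi k = z powi (k + 1)" for k
    using power_int_add[of z 1 k] assms by (simp add: add.commute)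
  show "((fps_const z + fps_X) * Abs_fps (\<lambda>n. (of_int b gchoose n) * z powi (b - int n))) $ n
    = Abs_fps (\<lambda>n. (of_int (b + 1) gchoose n) * z powi (b + 1 - int n)) $ n"
  proof (cases n)
    case 0
    then show ?thesis by (simp add: distrib_right * add.commute)
  next
    case (Suc k)
    have "((fps_const z + fps_X) * Abs_fps (\<lambda>n. (of_int b gchoose n) * z powi (b - int n))) $ Suc k
        = (of_int b gchoose Suc k) * (z * z powi (b - int (Suc k))) + (of_int b gchoose k) * z powi (b - int k)"
      by (simp add: distrib_right)
    also have "z * z powi (b - int (Suc k)) = z powi (b - int k)"
      using *[of "b - int (Suc k)"] by simp
    also have "(of_int b gchoose Suc k) * z powi (b - int k) + (of_int b gchoose k) * z powi (b - int k)
        = ((of_int b + 1) gchoose Suc k) * z powi (b - int k)"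
      unfolding gbinomial_Suc_Suc by (simp only: distrib_right add.commute)
    finally show ?thesis
      unfolding Suc by simp
  qed
qed

lemma qexp_eq:
  assumes z: "z \<noteq> 0"
  shows "qexp z b = Abs_fps (\<lambda>n. (of_int b gchoose n) * z powi (b - int n))"
proof -
  let ?G = "\<lambda>b. Abs_fps (\<lambda>n. (of_int b gchoose n) * z powi (b - int n))"
  let ?q = "fps_const z + fps_X"
  have G0: "?G 0 = 1"
    by (rule fps_ext) (simp add: gbinomial_0_left)
  have pos: "?q ^ n = ?G (int n)" for n
  proof (induction n)
    case (Suc n)
    then show ?case using qexp_step[OF z, of "int n"] by (simp add: add.commute)
  qed (use G0 in simp)
  have neg: "inverse ?q ^ n = ?G (- int n)" for n
  proof (induction n)
    case (Suc n)
    have "?G (- int n) = ?q * ?G (- int (Suc n))"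
      using qexp_step[OF z, of "- int (Suc n)"] by simp
    moreover have "inverse ?q * ?q = 1"
      by (rule inverse_mult_eq_1) (use z in simp)
    ultimately show ?case
      using Suc by (simp flip: mult.assoc)
  qed (use G0 in simp)
  show ?thesis
  proof (cases "b \<ge> 0")
    case True
    then show ?thesis using pos[of "nat b"] by (simp add: power_int_def)
  next
    case False
    then show ?thesis using neg[of "nat (- b)"] by (simp add: power_int_def)
  qed
qed

lemma qexp_nth: "z \<noteq> 0 \<Longrightarrow> qexp z b $ n = (of_int b gchoose n) * z powi (b - int n)"
  by (simp add: qexp_eq)

lemma qexp_Suc: "z \<noteq> 0 \<Longrightarrow> (fps_const z + fps_X) * qexp z b = qexp z (b + 1)"
  using qexp_step by (simp add: qexp_eq)

lemma qexp_add:
  assumes "z \<noteq> 0"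
  shows "qexp z (a + b) = qexp z a * qexp z b"
proof (induction a rule: int_induct[where k = 0])
  case (step1 i)
  then show ?case
    using qexp_Suc[OF assms, of "i + b"] qexp_Suc[OF assms, of i]
    by (simp add: add.commute add.left_commute flip: mult.assoc)
next
  case (step2 i)
  let ?q = "fps_const z + fps_X"
  have "?q $ 0 \<noteq> 0" using assms by simp
  then have "?q \<noteq> 0" by (metis fps_zero_nth)
  moreover have "?q * qexp z (i - 1 + b) = ?q * (qexp z (i - 1) * qexp z b)"
    using step2 qexp_Suc[OF assms, of "i - 1 + b"] qexp_Suc[OF assms, of "i - 1"]
    by (simp add: add.commute flip: mult.assoc)
  ultimately show ?case
    by simp
qed simp

lemma powi_mem:
  fixes z :: complex
  shows "z \<in> S \<Longrightarrow> subring_set S \<Longrightarrow> inverse z \<in> S \<Longrightarrow> z powi b \<in> S"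
  by (auto simp: power_int_def intro: subring_set.power_mem)

text \<open>Truncations of the binomial series for \<open>(z + c)\<^sup>b\<close> and \<open>(z + c)\<^bsup>b+1\<^esup>\<close> differ by the factor
  \<open>z + c\<close>, up to a single boundary term that carries the first omitted power of \<open>c\<close>.\<close>

lemma truncated_binomial_step:
  fixes z c :: complex
  assumes z: "z \<noteq> 0"
  shows "(z + c) * (\<Sum>i<Suc n. (of_int b gchoose i) * c ^ i * z powi (b - int i))
    = (\<Sum>i<Suc n. (of_int (b + 1) gchoose i) * c ^ i * z powi (b + 1 - int i))
      + (of_int b gchoose n) * c ^ Suc n * z powi (b - int n)"
proof -
  have *: "z * z powi k = z powi (k + 1)" for k
    using power_int_add[of z 1 k] assms by (simp add: add.commute)
  show ?thesis
  proof (induction n)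
    case 0
    then show ?case by (simp add: distrib_right * add.commute)
  next
    case (Suc n)
    have 1: "z * z powi (b - int (Suc n)) = z powi (b - int n)"
      using *[of "b - int (Suc n)"] by simp
    have 2: "(of_int (b + 1) gchoose Suc n :: complex) = (of_int b gchoose n) + (of_int b gchoose Suc n)"
      using gbinomial_Suc_Suc[of "of_int b :: complex" n] by (simp add: add.commute)
    have 3: "z powi (b + 1 - int (Suc n)) = z powi (b - int n)"
      by simp
    have "(z + c) * ((of_int b gchoose Suc n) * c ^ Suc n * z powi (b - int (Suc n)))
        = (of_int b gchoose Suc n) * c ^ Suc n * (z * z powi (b - int (Suc n)))
          + (of_int b gchoose Suc n) * c ^ Suc (Suc n) * z powi (b - int (Suc n))"
      by (simp add: algebra_simps)
    then show ?case
      unfolding sum.lessThan_Suc[of _ "Suc n"] distrib_left[of "z + c"] Suc.IH 1 2 3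
      by (simp add: algebra_simps)
  qed
qed

text \<open>The series is exact for \<open>b = 0\<close>, and the error remains divisible by \<open>c\<^sup>n\<close> when \<open>b\<close> increases by
  the previous identity; it does so as well when \<open>b\<close> decreases, because \<open>z + c\<close> is a unit.\<close>

lemma truncated_binomial:
  fixes z c :: complex
  assumes S: "subring_set S" and z: "z \<noteq> 0" "z \<in> S" "inverse z \<in> S"
    and w: "z + c \<noteq> 0" "z + c \<in> S" "inverse (z + c) \<in> S"
  shows "\<exists>t\<in>S. (\<Sum>i<n. (of_int b gchoose i) * c ^ i * z powi (b - int i)) - (z + c) powi b = c ^ n * t"
proof (cases n)
  case 0
  interpret subring_set S by fact
  show ?thesis
    using powi_mem[OF w(2) S w(3), of b]
    by (intro bexI[of _ "- ((z + c) powi b)"]) (auto simp: 0 intro: mem_intros)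
next
  case (Suc m)
  interpret subring_set S by fact
  let ?s = "\<lambda>b. \<Sum>i<n. (of_int b gchoose i) * c ^ i * z powi (b - int i)"
  let ?r = "\<lambda>b. (of_int b gchoose m) * z powi (b - int m)"
  have step: "(z + c) * ?s b = ?s (b + 1) + c ^ n * ?r b" for b
    using truncated_binomial_step[OF z(1), where c = c and n = m and b = b] unfolding Suc by (simp add: mult_ac)
  have r: "?r b \<in> S" for b
    by (intro mem_intros gbinomial_of_int_mem[OF S] powi_mem[OF z(2) S z(3)])
  have w_step: "(z + c) * (z + c) powi k = (z + c) powi (k + 1)" for k
    using power_int_add[of "z + c" 1 k] w(1) by (simp add: add.commute)
  show ?thesis
  proof (induction b rule: int_induct[where k = 0])
    case base
    have "?s 0 = 1"
      unfolding Suc by (subst sum.lessThan_Suc_shift) (simp add: gbinomial_0_left)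
    then show ?case
      by (intro bexI[of _ 0]) (auto intro: mem_intros)
  next
    case (step1 i)
    then obtain t where t: "t \<in> S" "?s i - (z + c) powi i = c ^ n * t" by blast
    have "?s (i + 1) - (z + c) powi (i + 1) = (z + c) * (?s i - (z + c) powi i) - c ^ n * ?r i"
      using step[of i] w_step[of i] by (simp add: algebra_simps)
    also have "\<dots> = c ^ n * ((z + c) * t - ?r i)"
      unfolding t(2) by (simp add: algebra_simps)
    finally show ?case
      using t(1) by (intro bexI[of _ "(z + c) * t - ?r i"] mem_intros r w)
  next
    case (step2 i)
    then obtain t where t: "t \<in> S" "?s i - (z + c) powi i = c ^ n * t" by blast
    have "?s (i - 1) - (z + c) powi (i - 1)
        = inverse (z + c) * ((z + c) * ?s (i - 1) - (z + c) * (z + c) powi (i - 1))"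
      using w(1) by (simp add: field_simps)
    also have "\<dots> = inverse (z + c) * ((?s i - (z + c) powi i) + c ^ n * ?r (i - 1))"
      using step[of "i - 1"] w_step[of "i - 1"] by simp
    also have "\<dots> = c ^ n * (inverse (z + c) * (t + ?r (i - 1)))"
      unfolding t(2) by (simp add: algebra_simps)
    finally show ?case
      using t(1) by (intro bexI[of _ "inverse (z + c) * (t + ?r (i - 1))"] mem_intros r w)
  qed
qed

lemma laurent_expand_nth:
  "z \<noteq> 0 \<Longrightarrow> laurent_expand z P $ n
    = (\<Sum>a\<in>Poly_Mapping.keys P. of_int (Poly_Mapping.lookup P a) * (qexp z a $ n))"
  by (simp add: laurent_expand_def fps_sum_nth)

text \<open>By the identity \<open>(i+j choose j) (a choose i+j) = (a choose j) (a-j choose i)\<close> the \<open>j\<close>-th coefficient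
  of the re-expanded power \<open>q\<^sup>a\<close> is \<open>(a choose j)\<close> times the binomial series for \<open>(z + c)\<^bsup>a-j\<^esup>\<close>.\<close>

lemma laurent_reexpand:
  fixes z c :: complex
  assumes S: "subring_set S" and z: "z \<noteq> 0" "z \<in> S" "inverse z \<in> S"
    and w: "z + c \<noteq> 0" "z + c \<in> S" "inverse (z + c) \<in> S"
  shows "\<exists>t\<in>S. (\<Sum>i<n. of_nat ((i + j) choose j) * c ^ i * (laurent_expand z P $ (i + j)))
    - laurent_expand (z + c) P $ j = c ^ n * t"
proof -
  interpret subring_set S by fact
  have "\<exists>t\<in>S. (\<Sum>i<n. of_nat ((i + j) choose j) * c ^ i * (qexp z a $ (i + j)))
      - qexp (z + c) a $ j = c ^ n * t" for a
  proof -
    obtain t where t: "t \<in> S" "(\<Sum>i<n. (of_int (a - int j) gchoose i) * c ^ i * z powi (a - int j - int i))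
        - (z + c) powi (a - int j) = c ^ n * t"
      using truncated_binomial[OF S z w, where n = n and b = "a - int j"] by blast
    have *: "of_nat ((i + j) choose j) * (of_int a gchoose (i + j) :: complex)
        = (of_int a gchoose j) * (of_int (a - int j) gchoose i)" for i
      using gbinomial_trinomial_revision[of j "i + j" "of_int a :: complex"]
      by (simp add: binomial_gbinomial mult.commute)
    have E: "of_nat ((i + j) choose j) * c ^ i * (qexp z a $ (i + j))
        = (of_int a gchoose j) * ((of_int (a - int j) gchoose i) * c ^ i * z powi (a - int j - int i))" for i
    proof -
      have e: "a - int (i + j) = a - int j - int i"
        by simp
      have "of_nat ((i + j) choose j) * c ^ i * (qexp z a $ (i + j))
          = (of_nat ((i + j) choose j) * (of_int a gchoose (i + j))) * c ^ i * z powi (a - int j - int i)"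
        unfolding qexp_nth[OF z(1)] e by (simp add: mult_ac)
      then show ?thesis
        unfolding * by (simp add: mult.assoc)
    qed
    have "(\<Sum>i<n. of_nat ((i + j) choose j) * c ^ i * (qexp z a $ (i + j))) - qexp (z + c) a $ j
        = c ^ n * ((of_int a gchoose j) * t)"
      unfolding E sum_distrib_left[symmetric] qexp_nth[OF w(1)] right_diff_distrib[symmetric] t(2)
      by (rule mult.left_commute)
    then show ?thesis
      using t(1) gbinomial_of_int_mem[OF S, of a j]
      by (intro bexI[of _ "(of_int a gchoose j) * t"] mem_intros) auto
  qed
  then obtain t where t: "\<And>a. t a \<in> S" "\<And>a. (\<Sum>i<n. of_nat ((i + j) choose j) * c ^ i * (qexp z a $ (i + j)))
      - qexp (z + c) a $ j = c ^ n * t a"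
    by metis
  let ?c = "\<lambda>a. of_int (Poly_Mapping.lookup P a) :: complex"
  have "(\<Sum>i<n. of_nat ((i + j) choose j) * c ^ i * (laurent_expand z P $ (i + j)))
      = (\<Sum>a\<in>Poly_Mapping.keys P. ?c a * (\<Sum>i<n. of_nat ((i + j) choose j) * c ^ i * (qexp z a $ (i + j))))"
    unfolding laurent_expand_nth[OF z(1)] sum_distrib_left
    by (subst sum.swap) (simp add: mult_ac)
  then have "(\<Sum>i<n. of_nat ((i + j) choose j) * c ^ i * (laurent_expand z P $ (i + j)))
      - laurent_expand (z + c) P $ j
      = (\<Sum>a\<in>Poly_Mapping.keys P. ?c a * ((\<Sum>i<n. of_nat ((i + j) choose j) * c ^ i * (qexp z a $ (i + j)))
        - qexp (z + c) a $ j))"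
    by (simp add: laurent_expand_nth[OF w(1)] right_diff_distrib sum_subtractf)
  also have "\<dots> = c ^ n * (\<Sum>a\<in>Poly_Mapping.keys P. ?c a * t a)"
    unfolding t(2) sum_distrib_left by (simp add: mult_ac)
  finally show ?thesis
    using t(1) by (intro bexI[of _ "\<Sum>a\<in>Poly_Mapping.keys P. ?c a * t a"]) (auto intro!: mem_intros)
qed

section \<open>Roots of unity\<close>

text \<open>The first \<open>n\<close> powers of \<open>w\<close> are distinct, so they exhaust the \<open>n\<close>-th roots of unity.\<close>

lemma primitive_root_generates:
  fixes w :: complex
  assumes n: "n \<ge> 1" and w: "w ^ n = 1" "\<And>k. 0 < k \<Longrightarrow> k < n \<Longrightarrow> w ^ k \<noteq> 1" and x: "x ^ n = 1"
  shows "x \<in> ring_gen {w}"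
proof -
  interpret subring_set "ring_gen {w}" by (rule subring_set_ring_gen)
  have w0: "w \<noteq> 0" using w(1) n by (auto simp: power_0_left)
  have inj: "inj_on (\<lambda>k. w ^ k) {..<n}"
  proof (rule linorder_inj_onI)
    fix i j assume ij: "i < j" "i \<in> {..<n}" "j \<in> {..<n}"
    then have "w ^ j = w ^ i * w ^ (j - i)"
      by (simp flip: power_add)
    moreover have "w ^ (j - i) \<noteq> 1"
      using ij by (intro w(2)) auto
    ultimately show "w ^ i \<noteq> w ^ j"
      using w0 by auto
  qed auto
  have card: "card {z :: complex. z ^ n = 1} = n"
    using n by (intro card_roots_unity_eq) auto
  have "(\<lambda>k. w ^ k) ` {..<n} = {z. z ^ n = 1}"
  proof (rule card_subset_eq)
    show "finite {z :: complex. z ^ n = 1}"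
      using card n by (intro card_ge_0_finite) auto
    show "(\<lambda>k. w ^ k) ` {..<n} \<subseteq> {z. z ^ n = 1}"
      using w(1) by (auto simp: power_mult[symmetric] mult.commute[of _ n]) (simp add: power_mult)
    show "card ((\<lambda>k. w ^ k) ` {..<n}) = card {z :: complex. z ^ n = 1}"
      using inj by (simp add: card card_image)
  qed
  then obtain k where "x = w ^ k"
    using x by blast
  then show ?thesis
    using power_mem[OF ring_gen_incl[of w "{w}"]] by simp
qed

lemma (in subring_set) freshman_dream_diff_power:
  assumes "prime p" "x \<in> S" "y \<in> S"
  shows "\<exists>u\<in>S. (x - y) ^ (p ^ k) = x ^ (p ^ k) - y ^ (p ^ k) + of_nat p * u"
proof (induction k)
  case 0
  then show ?case by (auto intro!: bexI[of _ 0] zero_mem)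
next
  case (Suc k)
  let ?X = "x ^ (p ^ k)" and ?Y = "y ^ (p ^ k)"
  have XY: "?X \<in> S" "?Y \<in> S" by (auto intro: mem_intros assms)
  obtain u where u: "u \<in> S" "(x - y) ^ (p ^ k) = ?X - ?Y + of_nat p * u"
    using Suc by blast
  obtain v where v: "v \<in> S" "(?X - ?Y + of_nat p * u) ^ p = (?X - ?Y) ^ p + (of_nat p * u) ^ p + of_nat p * v"
    using freshman_dream[OF assms(1), of "?X - ?Y" "of_nat p * u"] XY u by (auto intro: mem_intros)
  obtain v' where v': "v' \<in> S" "?X ^ p = (?X - ?Y) ^ p + ?Y ^ p + of_nat p * v'"
    using freshman_dream[OF assms(1), of "?X - ?Y" "?Y"] XY by (auto intro: mem_intros)
  have p: "p = Suc (p - 1)" using prime_gt_0_nat[OF assms(1)] by simp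
  have pu: "(of_nat p * u) ^ p = of_nat p * (u * (of_nat p * u) ^ (p - 1))"
    by (subst (2) p) (simp add: mult.assoc)
  have "(x - y) ^ (p ^ Suc k) = ((x - y) ^ (p ^ k)) ^ p"
    by (simp add: mult.commute flip: power_mult)
  also have "\<dots> = ?X ^ p - ?Y ^ p + of_nat p * (u * (of_nat p * u) ^ (p - 1) + v - v')"
    unfolding u(2) v(2) pu v'(2) by (simp add: algebra_simps)
  also have "\<dots> = x ^ (p ^ Suc k) - y ^ (p ^ Suc k) + of_nat p * (u * (of_nat p * u) ^ (p - 1) + v - v')"
    by (simp add: mult.commute flip: power_mult)
  finally show ?case
    using u v v' by (intro bexI[of _ "u * (of_nat p * u) ^ (p - 1) + v - v'"] mem_intros)
qed

locale compatible_roots =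
  fixes \<zeta> :: "nat \<Rightarrow> complex"
  assumes compatible: "compatible_roots_of_unity \<zeta>"
begin

lemma root_power: "m \<ge> 1 \<Longrightarrow> \<zeta> m ^ m = 1"
  and root_primitive: "m \<ge> 1 \<Longrightarrow> 0 < k \<Longrightarrow> k < m \<Longrightarrow> \<zeta> m ^ k \<noteq> 1"
  and root_coprime: "m \<ge> 1 \<Longrightarrow> m' \<ge> 1 \<Longrightarrow> coprime m m' \<Longrightarrow> \<zeta> (m * m') = \<zeta> m * \<zeta> m'"
  and root_prime: "prime p \<Longrightarrow> r \<ge> 1 \<Longrightarrow> \<zeta> (p ^ r) ^ p = \<zeta> (p ^ (r - 1))"
  using compatible unfolding compatible_roots_of_unity_def by blast+

lemma root_nonzero: "m \<ge> 1 \<Longrightarrow> \<zeta> m \<noteq> 0"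
  using root_power[of m] by (auto simp: power_0_left)

lemma root_mem:
  assumes "n \<ge> 1" "m dvd n" "x ^ m = 1"
  shows "x \<in> ring_gen {\<zeta> n}"
proof (rule primitive_root_generates[of n])
  obtain k where "n = m * k" using assms(2) by blast
  then show "x ^ n = 1" by (simp add: power_mult assms(3))
qed (use assms(1) root_power root_primitive in auto)

lemma root_inverse_mem:
  assumes "n \<ge> 1" "m dvd n" "m \<ge> 1"
  shows "\<zeta> m \<in> ring_gen {\<zeta> n}" "inverse (\<zeta> m) \<in> ring_gen {\<zeta> n}"
  by (auto intro!: root_mem[OF assms(1,2)] simp: power_inverse root_power[OF assms(3)])

text \<open>The quotient of \<open>\<zeta>\<^sub>p\<^sub>m\<close> and \<open>\<zeta>\<^sub>m\<close> has \<open>p\<close>-power order: with \<open>m = p\<^sup>s m'\<close> and \<open>p\<close> not dividing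
  \<open>m'\<close>, the compatibility of the roots yields \<open>\<zeta>\<^sub>p\<^sub>m = a b\<close> and \<open>\<zeta>\<^sub>m = a\<^sup>p b\<close>, where \<open>a\<close> is the root of
  order \<open>p\<^bsup>s+1\<^esup>\<close> and \<open>b\<close> that of order \<open>m'\<close>. Both roots thus have the same \<open>p\<^bsup>s+1\<^esup>\<close>-th power, and
  modulo \<open>p\<close> this power of their difference is the difference of their powers.\<close>

lemma root_diff_power:
  assumes p: "prime p" and m: "m \<ge> 1"
  shows "\<exists>K u. K > 0 \<and> u \<in> ring_gen {\<zeta> (p * m)} \<and> (\<zeta> (p * m) - \<zeta> m) ^ K = of_nat p * u"
proof -
  interpret subring_set "ring_gen {\<zeta> (p * m)}" by (rule subring_set_ring_gen)
  have p1: "p \<ge> 1" using prime_ge_1_nat[OF p] .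
  obtain s m' where sm: "m = p ^ s * m'" "\<not> p dvd m'"
    using prime_power_canonical[OF p, of m] m by (metis gr0I less_one mult.commute not_less_zero neq0_conv leD)
  have m': "m' \<ge> 1" using m sm by (cases m') auto
  have cop: "coprime (p ^ k) m'" for k
    using sm(2) p by (simp add: prime_imp_coprime)
  let ?a = "\<zeta> (p ^ Suc s)" and ?b = "\<zeta> m'"
  have ap: "?a ^ p = \<zeta> (p ^ s)"
    using root_prime[OF p, of "Suc s"] by simp
  have z: "\<zeta> m = ?a ^ p * ?b"
    unfolding ap sm(1) by (rule root_coprime[OF _ m' cop]) (use p1 in simp)
  have "p * m = p ^ Suc s * m'"
    by (simp add: sm(1))
  then have w: "\<zeta> (p * m) = ?a * ?b"
    using root_coprime[OF _ m' cop, of "Suc s"] p1 by (simp del: power_Suc)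
  have a1: "?a ^ (p ^ Suc s) = 1"
    using root_power[of "p ^ Suc s"] p1 by simp
  have "\<zeta> m \<in> ring_gen {\<zeta> (p * m)}" "\<zeta> (p * m) \<in> ring_gen {\<zeta> (p * m)}"
    using root_inverse_mem(1)[of "p * m"] p1 m by auto
  then obtain u where u: "u \<in> ring_gen {\<zeta> (p * m)}" "(\<zeta> (p * m) - \<zeta> m) ^ (p ^ Suc s)
      = \<zeta> (p * m) ^ (p ^ Suc s) - \<zeta> m ^ (p ^ Suc s) + of_nat p * u"
    using freshman_dream_diff_power[OF p] by blast
  have "(?a ^ p) ^ (p ^ Suc s) = 1"
    using a1 by (metis mult.commute power_mult power_one)
  then have "\<zeta> (p * m) ^ (p ^ Suc s) = \<zeta> m ^ (p ^ Suc s)"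
    unfolding w z power_mult_distrib a1 by simp
  then show ?thesis
    using u p1 by (intro exI[of _ "p ^ Suc s"] exI[of _ u]) auto
qed

text \<open>At each monomial in \<open>t\<close> both sides expand the same Laurent polynomial in \<open>q\<close>, at \<open>\<zeta>\<^sub>m\<close> and at
  \<open>\<zeta>\<^sub>p\<^sub>m\<close>. The truncation error is divisible by \<open>c\<^sup>n\<close> for \<open>c = \<zeta>\<^sub>p\<^sub>m - \<zeta>\<^sub>m\<close>, uniformly in the
  monomial, and \<open>c\<^bsup>K N\<^esup>\<close> is divisible by \<open>p\<^sup>N\<close>.\<close>

lemma expansion_converges:
  fixes f :: "('v, laurent) mfps"
  assumes p: "prime p" and m: "m \<ge> 1"
  shows "\<forall>\<^sub>F n in sequentially. \<exists>t\<in>integral_series (\<zeta> (p * m)).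
    (\<Sum>i<n. of_nat ((i + j) choose j) * mfps_const ((\<zeta> (p * m) - \<zeta> m) ^ i)
        * (habiro_expansion \<zeta> f m $ (i + j)))
      - habiro_expansion \<zeta> f (p * m) $ j = of_nat (p ^ N) * t"
proof -
  let ?L = "ring_gen {\<zeta> (p * m)}" and ?c = "\<zeta> (p * m) - \<zeta> m"
  interpret subring_set ?L by (rule subring_set_ring_gen)
  have pm: "p * m \<ge> 1" using prime_ge_1_nat[OF p] m by simp
  obtain K u where K: "K > 0" "u \<in> ?L" "?c ^ K = of_nat p * u"
    using root_diff_power[OF p m] by blast
  have "\<exists>t\<in>integral_series (\<zeta> (p * m)).
    (\<Sum>i<n. of_nat ((i + j) choose j) * mfps_const (?c ^ i) * (habiro_expansion \<zeta> f m $ (i + j)))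
      - habiro_expansion \<zeta> f (p * m) $ j = of_nat (p ^ N) * t" (is "\<exists>t\<in>_. ?D = _ * t")
    if n: "n \<ge> K * N" for n
  proof -
    have c_mem: "?c \<in> ?L"
      using root_inverse_mem(1)[OF pm, of m] m by (intro diff_mem[OF ring_gen_incl]) auto
    have "\<exists>t\<in>?L. mfps_coeff ?D k = of_nat (p ^ N) * t" for k
    proof -
      have "mfps_coeff ?D k = (\<Sum>i<n. of_nat ((i + j) choose j) * ?c ^ i
          * (laurent_expand (\<zeta> m) (mfps_coeff f k) $ (i + j)))
        - laurent_expand (\<zeta> m + ?c) (mfps_coeff f k) $ j"
        by (simp add: habiro_expansion_def mfps_coeff_sum mult.assoc mfps_of_nat_coeff mfps_const_coeff)
      moreover obtain t where t: "t \<in> ?L" "(\<Sum>i<n. of_nat ((i + j) choose j) * ?c ^ i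
          * (laurent_expand (\<zeta> m) (mfps_coeff f k) $ (i + j)))
        - laurent_expand (\<zeta> m + ?c) (mfps_coeff f k) $ j = ?c ^ n * t"
        using laurent_reexpand[OF subring_set_axioms, where z = "\<zeta> m" and c = ?c and n = n and j = j
              and P = "mfps_coeff f k"]
          root_inverse_mem[OF pm] root_nonzero[OF m] root_nonzero[OF pm] m pm by auto
      moreover have "?c ^ n = of_nat (p ^ N) * (u ^ N * ?c ^ (n - K * N))"
      proof -
        have "?c ^ n = (?c ^ K) ^ N * ?c ^ (n - K * N)"
          using n by (simp flip: power_mult power_add)
        then show ?thesis
          unfolding K(3) by (simp add: power_mult_distrib)
      qed
      ultimately have "mfps_coeff ?D k = of_nat (p ^ N) * (u ^ N * ?c ^ (n - K * N) * t)"
        by (simp add: mult.assoc)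
      moreover have "u ^ N * ?c ^ (n - K * N) * t \<in> ?L"
        by (intro mult_mem power_mem K(2) c_mem t(1))
      ultimately show ?thesis by blast
    qed
    then obtain t where t: "\<And>k. t k \<in> ?L" "\<And>k. mfps_coeff ?D k = of_nat (p ^ N) * t k"
      by metis
    have "?D = of_nat (p ^ N) * Abs_mfps t"
      by (rule mfps_eqI) (simp only: t(2) mfps_of_nat_coeff mfps_coeff_Abs)
    then show ?thesis
      using t(1) by (intro bexI[of _ "Abs_mfps t"]) (auto simp: integral_series_def)
  qed
  then show ?thesis
    unfolding eventually_sequentially by blast
qed

end

(* keeps the unit vectors single \<alpha> 1 of exponents in this form *)
declare One_nat_def [simp del]

section \<open>Multinomial coefficients and Laurent polynomials in q\<close>

text \<open>If \<open>\<alpha>\<close> runs through \<open>A\<close> in increasing order and \<open>s\<^sub>\<alpha>\<close> is the sum of the \<open>k\<^sub>\<beta>\<close> with \<open>\<beta>\<close> above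
  \<open>\<alpha>\<close>, then the summands are the successive differences of the powers \<open>q ^ s\<^sub>\<alpha>\<close>.\<close>

lemma telescoping_sum:
  fixes q :: "'c :: comm_ring_1" and r :: "'v \<Rightarrow> nat"
  assumes "finite A" "inj_on r A"
  shows "(\<Sum>\<alpha>\<in>A. q ^ (\<Sum>\<beta> | \<beta> \<in> A \<and> r \<alpha> < r \<beta>. k \<beta>) * (1 - q ^ k \<alpha>)) = 1 - q ^ sum k A"
  using assms
proof (induction A rule: finite_ranking_induct[where f = r])
  case (insert x S)
  show ?case
  proof (cases "x \<in> S")
    case True
    then show ?thesis using insert by (simp add: insert_absorb)
  next
    case False
    have less: "r \<alpha> < r x" if "\<alpha> \<in> S" for \<alpha>
    proof -
      have "r \<alpha> \<noteq> r x"
        using insert.prems that False by (auto simp: inj_on_def)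
      then show ?thesis using insert.hyps(2)[OF that] by simp
    qed
    have x: "{\<beta>. \<beta> \<in> insert x S \<and> r x < r \<beta>} = {}"
      using less by (auto dest: less_asym)
    have S: "(\<Sum>\<beta> | \<beta> \<in> insert x S \<and> r \<alpha> < r \<beta>. k \<beta>) = k x + (\<Sum>\<beta> | \<beta> \<in> S \<and> r \<alpha> < r \<beta>. k \<beta>)"
      if "\<alpha> \<in> S" for \<alpha>
    proof -
      have "{\<beta>. \<beta> \<in> insert x S \<and> r \<alpha> < r \<beta>} = insert x {\<beta>. \<beta> \<in> S \<and> r \<alpha> < r \<beta>}"
        using less[OF that] by auto
      then show ?thesis using False insert.hyps(1) by simp
    qed
    have "(\<Sum>\<alpha>\<in>S. q ^ (\<Sum>\<beta> | \<beta> \<in> insert x S \<and> r \<alpha> < r \<beta>. k \<beta>) * (1 - q ^ k \<alpha>))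
        = q ^ k x * (\<Sum>\<alpha>\<in>S. q ^ (\<Sum>\<beta> | \<beta> \<in> S \<and> r \<alpha> < r \<beta>. k \<beta>) * (1 - q ^ k \<alpha>))"
      unfolding sum_distrib_left by (intro sum.cong refl) (simp only: S power_add mult.assoc)
    also have "\<dots> = q ^ k x * (1 - q ^ sum k S)"
      using insert.IH insert.prems by (simp add: inj_on_insert)
    finally have "(\<Sum>\<alpha>\<in>insert x S. q ^ (\<Sum>\<beta> | \<beta> \<in> insert x S \<and> r \<alpha> < r \<beta>. k \<beta>) * (1 - q ^ k \<alpha>))
        = q ^ (\<Sum>\<beta> | \<beta> \<in> insert x S \<and> r x < r \<beta>. k \<beta>) * (1 - q ^ k x)
          + q ^ k x * (1 - q ^ sum k S)"
      unfolding sum.insert[OF insert.hyps(1) False] by (rule arg_cong)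
    then show ?thesis
      unfolding x using False insert.hyps(1) by (simp add: power_add algebra_simps)
  qed
qed simp

definition qvar :: "int poly" where "qvar = [:0, 1:]"

lemma qpoch_eq: "qpoch n = (\<Prod>i=1..n. 1 - qvar ^ i)"
  by (simp add: qpoch_def qvar_def monom_altdef)

lemma qpoch_0 [simp]: "qpoch 0 = 1"
  by (simp add: qpoch_def)

lemma qpoch_Suc: "qpoch (Suc n) = qpoch n * (1 - qvar ^ Suc n)"
  by (simp add: qpoch_eq)

lemma qpoch_nonzero: "qpoch n \<noteq> 0"
proof (induction n)
  case (Suc n)
  have "poly (1 - qvar ^ Suc n) 0 = 1" by (simp add: qvar_def)
  then have "1 - qvar ^ Suc n \<noteq> 0" by (metis poly_0 zero_neq_one)
  then show ?case using Suc by (simp add: qpoch_Suc del: power_Suc)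
qed simp

definition qpoch_prod :: "'v set \<Rightarrow> ('v \<Rightarrow>\<^sub>0 nat) \<Rightarrow> int poly" where
  "qpoch_prod A k = (\<Prod>\<alpha>\<in>A. qpoch (Poly_Mapping.lookup k \<alpha>))"

abbreviation total :: "'v set \<Rightarrow> ('v \<Rightarrow>\<^sub>0 nat) \<Rightarrow> nat" where
  "total A k \<equiv> \<Sum>\<alpha>\<in>A. Poly_Mapping.lookup k \<alpha>"

abbreviation unit_exp :: "'v \<Rightarrow> 'v \<Rightarrow>\<^sub>0 nat" where
  "unit_exp \<alpha> \<equiv> Poly_Mapping.single \<alpha> 1"

definition upper_sum :: "'v set \<Rightarrow> ('v \<Rightarrow> nat) \<Rightarrow> 'v \<Rightarrow> ('v \<Rightarrow>\<^sub>0 nat) \<Rightarrow> nat" where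
  "upper_sum A r \<alpha> k = (\<Sum>\<beta> | \<beta> \<in> A \<and> r \<alpha> < r \<beta>. Poly_Mapping.lookup k \<beta>)"

lemma qpoch_prod_nonzero: "finite A \<Longrightarrow> qpoch_prod A k \<noteq> 0"
  by (simp add: qpoch_prod_def qpoch_nonzero)

lemma lookup_diff_unit:
  "Poly_Mapping.lookup (k - unit_exp \<alpha>) \<beta> = Poly_Mapping.lookup k \<beta> - (if \<beta> = \<alpha> then 1 else 0)"
  by (simp add: lookup_minus lookup_single when_def)

lemma total_diff_unit:
  assumes "finite A" "\<alpha> \<in> A" "Poly_Mapping.lookup k \<alpha> > 0"
  shows "total A k = Suc (total A (k - unit_exp \<alpha>))"
  using assms by (simp add: sum.remove[of A \<alpha>] lookup_diff_unit)

lemma qpoch_prod_diff_unit: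
  assumes "finite A" "\<alpha> \<in> A" "Poly_Mapping.lookup k \<alpha> > 0"
  shows "qpoch_prod A k = qpoch_prod A (k - unit_exp \<alpha>) * (1 - qvar ^ Poly_Mapping.lookup k \<alpha>)"
proof -
  obtain n where "Poly_Mapping.lookup k \<alpha> = Suc n"
    using assms(3) gr0_implies_Suc by blast
  then show ?thesis
    using assms(1,2) unfolding qpoch_prod_def
    by (simp add: prod.remove[of A \<alpha>] lookup_diff_unit qpoch_Suc del: power_Suc)
qed

text \<open>After multiplication with the denominator \<open>\<Prod>\<^sub>\<alpha> (q;q)\<^sub>k\<close>, with \<open>k = k\<^sub>\<alpha>\<close>, Pascal's rule for
  \<open>q\<close>-multinomial coefficients becomes a telescoping sum. Exactness of the division that defines the
  coefficients follows in the same induction, as the right-hand side of the rule is a polynomial.\<close>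

lemma qmultinomial_pascal:
  assumes A: "finite A" "inj_on r A"
  shows "qpoch_prod A k * qmultinomial A k = qpoch (total A k)"
    and "total A k > 0 \<Longrightarrow> qmultinomial A k = (\<Sum>\<alpha> | \<alpha> \<in> A \<and> Poly_Mapping.lookup k \<alpha> > 0.
      qvar ^ upper_sum A r \<alpha> k * qmultinomial A (k - unit_exp \<alpha>))"
proof -
  have exact: "qmultinomial A k = W" if "qpoch_prod A k * W = qpoch (total A k)" for k W
    unfolding qmultinomial_def qpoch_prod_def[symmetric] that[symmetric]
    using qpoch_prod_nonzero[OF A(1)] by simp
  have *: "qpoch_prod A k * qmultinomial A k = qpoch (total A k) \<and>
     (total A k > 0 \<longrightarrow> qmultinomial A k = (\<Sum>\<alpha> | \<alpha> \<in> A \<and> Poly_Mapping.lookup k \<alpha> > 0.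
      qvar ^ upper_sum A r \<alpha> k * qmultinomial A (k - unit_exp \<alpha>)))"
  proof (induction "total A k" arbitrary: k)
    case 0
    then have "qpoch_prod A k = 1"
      using A(1) by (simp add: qpoch_prod_def)
    then have "qpoch_prod A k * 1 = qpoch (total A k)"
      using 0[symmetric] by simp
    then show ?case
      using exact[of k 1] 0 by simp
  next
    case (Suc n)
    let ?I = "{\<alpha>. \<alpha> \<in> A \<and> Poly_Mapping.lookup k \<alpha> > 0}"
    let ?W = "\<Sum>\<alpha>\<in>?I. qvar ^ upper_sum A r \<alpha> k * qmultinomial A (k - unit_exp \<alpha>)"
    have "qpoch_prod A k * ?W
        = (\<Sum>\<alpha>\<in>?I. qvar ^ upper_sum A r \<alpha> k * (1 - qvar ^ Poly_Mapping.lookup k \<alpha>) * qpoch n)"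
      unfolding sum_distrib_left
    proof (intro sum.cong refl)
      fix \<alpha> assume \<alpha>: "\<alpha> \<in> ?I"
      then have n: "n = total A (k - unit_exp \<alpha>)"
        using total_diff_unit[OF A(1), of \<alpha> k] Suc.hyps(2) by simp
      then have "qpoch_prod A (k - unit_exp \<alpha>) * qmultinomial A (k - unit_exp \<alpha>) = qpoch n"
        using Suc.hyps(1)[OF n] by simp
      then show "qpoch_prod A k * (qvar ^ upper_sum A r \<alpha> k * qmultinomial A (k - unit_exp \<alpha>))
          = qvar ^ upper_sum A r \<alpha> k * (1 - qvar ^ Poly_Mapping.lookup k \<alpha>) * qpoch n"
        using qpoch_prod_diff_unit[OF A(1), of \<alpha> k] \<alpha> by (simp add: mult_ac)
    qed
    also have "\<dots> = (\<Sum>\<alpha>\<in>A. qvar ^ upper_sum A r \<alpha> k * (1 - qvar ^ Poly_Mapping.lookup k \<alpha>) * qpoch n)"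
      using A(1) by (intro sum.mono_neutral_left) auto
    also have "\<dots> = (1 - qvar ^ total A k) * qpoch n"
      unfolding sum_distrib_right[symmetric] upper_sum_def telescoping_sum[OF A] ..
    also have "\<dots> = qpoch (total A k)"
      unfolding Suc.hyps(2)[symmetric] qpoch_Suc by (simp add: mult.commute)
    finally have "qpoch_prod A k * ?W = qpoch (total A k)" .
    then show ?case
      using exact[of k ?W] by simp
  qed
  show "qpoch_prod A k * qmultinomial A k = qpoch (total A k)"
    using * by blast
  show "total A k > 0 \<Longrightarrow> qmultinomial A k = (\<Sum>\<alpha> | \<alpha> \<in> A \<and> Poly_Mapping.lookup k \<alpha> > 0.
      qvar ^ upper_sum A r \<alpha> k * qmultinomial A (k - unit_exp \<alpha>))"
    using * by blast
qed

lemma laurent_of_poly_superset: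
  assumes "Polynomial.degree P \<le> n"
  shows "laurent_of_poly P = (\<Sum>i\<le>n. Poly_Mapping.single (int i) (Polynomial.coeff P i))"
  unfolding laurent_of_poly_def
  by (rule sum.mono_neutral_left) (use assms in \<open>auto simp: coeff_eq_0\<close>)

lemma laurent_of_poly_add: "laurent_of_poly (P + R) = laurent_of_poly P + laurent_of_poly R"
proof -
  let ?n = "max (Polynomial.degree P) (Polynomial.degree R)"
  show ?thesis
    using laurent_of_poly_superset[of P ?n] laurent_of_poly_superset[of R ?n]
      laurent_of_poly_superset[of "P + R" ?n] degree_add_le_max[of P R]
    by (simp add: single_add sum.distrib)
qed

lemma laurent_of_poly_pCons:
  "laurent_of_poly (pCons a P) = Poly_Mapping.single 0 a + Poly_Mapping.single 1 1 * laurent_of_poly P"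
proof -
  have "laurent_of_poly (pCons a P)
      = (\<Sum>i\<le>Suc (Polynomial.degree P). Poly_Mapping.single (int i) (Polynomial.coeff (pCons a P) i))"
    by (rule laurent_of_poly_superset) (rule degree_pCons_le)
  also have "\<dots> = Poly_Mapping.single 0 a
      + (\<Sum>i\<le>Polynomial.degree P. Poly_Mapping.single (1 + int i) (Polynomial.coeff P i))"
    by (subst sum.atMost_Suc_shift) simp
  also have "(\<Sum>i\<le>Polynomial.degree P. Poly_Mapping.single (1 + int i) (Polynomial.coeff P i))
      = Poly_Mapping.single 1 1 * laurent_of_poly P"
    by (simp add: laurent_of_poly_def sum_distrib_left mult_single)
  finally show ?thesis .
qed

lemma comm_ring_hom_laurent_of_poly: "comm_ring_hom laurent_of_poly"
proof (rule comm_ring_homI)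
  show "laurent_of_poly 1 = 1"
    by (simp add: laurent_of_poly_def)
  have 0: "laurent_of_poly 0 = 0"
    by (simp add: laurent_of_poly_def)
  have smult: "laurent_of_poly (Polynomial.smult a P) = Poly_Mapping.single 0 a * laurent_of_poly P" for a P
    by (induction P) (simp_all add: 0 laurent_of_poly_pCons mult_single distrib_left mult_ac)
  show "laurent_of_poly (P * R) = laurent_of_poly P * laurent_of_poly R" for P R
    by (induction P)
       (simp_all add: 0 mult_pCons_left laurent_of_poly_add smult laurent_of_poly_pCons algebra_simps)
qed (rule laurent_of_poly_add)

interpretation laurent_of_poly: comm_ring_hom laurent_of_poly
  by (rule comm_ring_hom_laurent_of_poly)

definition qpow :: "int \<Rightarrow> laurent" where
  "qpow i = Poly_Mapping.single i 1"

lemma qpow_add: "qpow (a + b) = qpow a * qpow b"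
  by (simp add: qpow_def mult_single)

lemma qpow_0: "qpow 0 = 1"
  by (simp add: qpow_def)

lemma laurent_of_poly_qvar_power: "laurent_of_poly (qvar ^ n) = qpow (int n)"
proof -
  have "laurent_of_poly qvar = qpow 1"
    by (simp add: qvar_def laurent_of_poly_pCons qpow_def)
  then have "laurent_of_poly (qvar ^ n) = qpow 1 ^ n"
    by (simp add: laurent_of_poly.hom_power)
  also have "\<dots> = qpow (int n)"
    by (induction n) (simp_all add: qpow_0 flip: qpow_add)
  finally show ?thesis .
qed

lemma comm_ring_hom_laurent_expand:
  assumes z: "z \<noteq> 0"
  shows "comm_ring_hom (laurent_expand z)"
proof -
  have sup: "laurent_expand z P = (\<Sum>i\<in>I. fps_const (of_int (Poly_Mapping.lookup P i)) * qexp z i)"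
    if "finite I" "Poly_Mapping.keys P \<subseteq> I" for P I
    unfolding laurent_expand_def
    by (rule sum.mono_neutral_left) (use that in \<open>auto simp: in_keys_iff\<close>)
  have single: "laurent_expand z (Poly_Mapping.single i c) = fps_const (of_int c) * qexp z i" for i c
    by (subst sup[of "{i}"]) auto
  have add: "laurent_expand z (P + R) = laurent_expand z P + laurent_expand z R" for P R
  proof -
    let ?I = "Poly_Mapping.keys P \<union> Poly_Mapping.keys R"
    show ?thesis
      using sup[of ?I P] sup[of ?I R] sup[of ?I "P + R"] keys_add[of P R]
      by (simp add: lookup_add distrib_right sum.distrib flip: fps_const_add)
  qed
  have sum: "laurent_expand z (sum F I) = (\<Sum>i\<in>I. laurent_expand z (F i))" for F and I :: "int set"
  proof -
    have "laurent_expand z 0 = 0" by (simp add: laurent_expand_def)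
    then show ?thesis
      by (induction I rule: infinite_finite_induct) (auto simp: add)
  qed
  show ?thesis
  proof (rule comm_ring_homI)
    show "laurent_expand z 1 = 1"
      using single[of 0 1] by simp
    show "laurent_expand z (P * R) = laurent_expand z P * laurent_expand z R" for P R
      by (subst poly_mapping_mult_eq_sum)
         (simp add: sum single qexp_add[OF z] sup[of "Poly_Mapping.keys P" P]
            sup[of "Poly_Mapping.keys R" R] sum_product mult_ac flip: fps_const_mult)
  qed (rule add)
qed

lemma laurent_expand_qpow: "laurent_expand z (qpow i) = qexp z i"
  by (simp add: laurent_expand_def qpow_def)

section \<open>The q-difference equation\<close>

definition qdiff :: "'v set \<Rightarrow> ('v \<Rightarrow> 'c :: comm_ring_1) \<Rightarrow> ('v \<Rightarrow> ('v \<Rightarrow>\<^sub>0 nat) \<Rightarrow> 'c)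
    \<Rightarrow> ('v, 'c) mfps \<Rightarrow> ('v, 'c) mfps" where
  "qdiff A y \<chi> F = (\<Sum>\<alpha>\<in>A. mfps_const (y \<alpha>) * mfps_var \<alpha> * mfps_twist (\<chi> \<alpha>) F)"

lemma qdiff_coeff:
  "mfps_coeff (qdiff A y \<chi> F) k = (\<Sum>\<alpha> | \<alpha> \<in> A \<and> Poly_Mapping.lookup k \<alpha> > 0.
    y \<alpha> * \<chi> \<alpha> (k - unit_exp \<alpha>) * mfps_coeff F (k - unit_exp \<alpha>))" if "finite A"
proof -
  have "mfps_coeff (qdiff A y \<chi> F) k = (\<Sum>\<alpha>\<in>A. if Poly_Mapping.lookup k \<alpha> > 0
      then y \<alpha> * \<chi> \<alpha> (k - unit_exp \<alpha>) * mfps_coeff F (k - unit_exp \<alpha>) else 0)"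
    unfolding qdiff_def mfps_coeff_sum
    by (intro sum.cong refl)
       (simp add: mult.assoc mfps_const_coeff mfps_var_coeff mfps_twist_coeff)
  then show ?thesis
    unfolding sum.inter_filter[OF that] .
qed

text \<open>The form \<open>Q\<close> plus the indicator of the order given by \<open>r\<close>. Adding the indicator on one side of
  the diagonal only makes the summands of \<open>qdiff\<close> with exponents \<open>skew_form A r Q \<alpha>\<close> commute up
  to \<open>q\<^bsup>\<plusminus>1\<^esup>\<close> for symmetric \<open>Q\<close>; this is where \<open>q\<close>-multinomial coefficients come from.\<close>

definition skew_form :: "'v set \<Rightarrow> ('v \<Rightarrow> nat) \<Rightarrow> ('v \<Rightarrow> 'v \<Rightarrow> int) \<Rightarrow> 'v \<Rightarrow> ('v \<Rightarrow>\<^sub>0 nat) \<Rightarrow> int" where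
  "skew_form A r Q \<alpha> k
    = (\<Sum>\<beta>\<in>A. (Q \<alpha> \<beta> + (if r \<alpha> < r \<beta> then 1 else 0)) * int (Poly_Mapping.lookup k \<beta>))"

lemma skew_form_add: "skew_form A r Q \<alpha> (k + l) = skew_form A r Q \<alpha> k + skew_form A r Q \<alpha> l"
  by (simp add: skew_form_def lookup_add distrib_left sum.distrib)

lemma skew_form_eq:
  assumes "finite A"
  shows "skew_form A r Q \<alpha> k
    = (\<Sum>\<beta>\<in>A. Q \<alpha> \<beta> * int (Poly_Mapping.lookup k \<beta>)) + int (upper_sum A r \<alpha> k)"
proof -
  have "(\<Sum>\<beta>\<in>A. (if r \<alpha> < r \<beta> then 1 else 0) * int (Poly_Mapping.lookup k \<beta>)) = int (upper_sum A r \<alpha> k)"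
    unfolding upper_sum_def of_nat_sum
    using assms by (simp add: if_distrib[of "\<lambda>x. x * _"] sum.inter_filter[symmetric] cong: if_cong)
  then show ?thesis
    by (simp add: skew_form_def distrib_right sum.distrib)
qed

lemma sum_mult_indicator:
  fixes g :: "'v \<Rightarrow> int"
  assumes "finite A" "\<alpha> \<in> A"
  shows "(\<Sum>\<beta>\<in>A. g \<beta> * (if \<beta> = \<alpha> then 1 else 0)) = g \<alpha>"
    and "(\<Sum>\<beta>\<in>A. (if \<beta> = \<alpha> then 1 else 0) * g \<beta>) = g \<alpha>"
  using assms by (simp_all add: if_distrib if_distribR cong: if_cong)

lemma quad_form_add_unit:
  assumes A: "finite A" and \<alpha>: "\<alpha> \<in> A" and sym: "\<And>\<beta>. \<beta> \<in> A \<Longrightarrow> Q \<beta> \<alpha> = Q \<alpha> \<beta>"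
  shows "quad_form A Q (k + unit_exp \<alpha>)
    = quad_form A Q k + 2 * (\<Sum>\<beta>\<in>A. Q \<alpha> \<beta> * int (Poly_Mapping.lookup k \<beta>)) + Q \<alpha> \<alpha>"
proof -
  let ?k = "\<lambda>\<beta>. int (Poly_Mapping.lookup k \<beta>)" and ?e = "\<lambda>\<beta>. if \<beta> = \<alpha> then 1 else 0 :: int"
  have l: "int (Poly_Mapping.lookup (k + unit_exp \<alpha>) \<beta>) = ?k \<beta> + ?e \<beta>" for \<beta>
    by (simp add: lookup_add lookup_single when_def)
  have "quad_form A Q (k + unit_exp \<alpha>) = (\<Sum>\<gamma>\<in>A. \<Sum>\<beta>\<in>A. ?k \<gamma> * Q \<gamma> \<beta> * ?k \<beta>)
      + (\<Sum>\<gamma>\<in>A. \<Sum>\<beta>\<in>A. ?k \<gamma> * Q \<gamma> \<beta> * ?e \<beta>) + (\<Sum>\<gamma>\<in>A. \<Sum>\<beta>\<in>A. ?e \<gamma> * (Q \<gamma> \<beta> * ?k \<beta>))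
      + (\<Sum>\<gamma>\<in>A. \<Sum>\<beta>\<in>A. ?e \<gamma> * (Q \<gamma> \<beta> * ?e \<beta>))"
    unfolding quad_form_def l sum.distrib[symmetric]
    by (intro sum.cong refl) (simp only: algebra_simps)
  also have "(\<Sum>\<gamma>\<in>A. \<Sum>\<beta>\<in>A. ?k \<gamma> * Q \<gamma> \<beta> * ?e \<beta>) = (\<Sum>\<gamma>\<in>A. Q \<alpha> \<gamma> * ?k \<gamma>)"
    unfolding sum_mult_indicator(1)[OF A \<alpha>] by (intro sum.cong refl) (simp add: sym mult.commute)
  also have "(\<Sum>\<gamma>\<in>A. \<Sum>\<beta>\<in>A. ?e \<gamma> * (Q \<gamma> \<beta> * ?k \<beta>)) = (\<Sum>\<beta>\<in>A. Q \<alpha> \<beta> * ?k \<beta>)"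
    unfolding sum_distrib_left[symmetric] sum_mult_indicator(2)[OF A \<alpha>] ..
  also have "(\<Sum>\<gamma>\<in>A. \<Sum>\<beta>\<in>A. ?e \<gamma> * (Q \<gamma> \<beta> * ?e \<beta>)) = Q \<alpha> \<alpha>"
    unfolding sum_distrib_left[symmetric] sum_mult_indicator[OF A \<alpha>] ..
  finally show ?thesis
    by (simp add: quad_form_def)
qed

lemma diag_form_add_unit:
  assumes "finite A" "\<alpha> \<in> A"
  shows "diag_form A Q (k + unit_exp \<alpha>) = diag_form A Q k + Q \<alpha> \<alpha>"
proof -
  have "diag_form A Q (k + unit_exp \<alpha>) = diag_form A Q k + (\<Sum>\<beta>\<in>A. Q \<beta> \<beta> * (if \<beta> = \<alpha> then 1 else 0))"
    unfolding diag_form_def sum.distrib[symmetric]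
    by (intro sum.cong refl) (simp add: lookup_add lookup_single when_def algebra_simps)
  then show ?thesis
    unfolding sum_mult_indicator(1)[OF assms] .
qed

definition q_exponent :: "'v set \<Rightarrow> ('v \<Rightarrow> 'v \<Rightarrow> int) \<Rightarrow> ('v \<Rightarrow>\<^sub>0 nat) \<Rightarrow> int" where
  "q_exponent A Q k = (quad_form A Q k + diag_form A Q k) div 2"

lemma q_exponent_add_unit:
  assumes "finite A" "\<alpha> \<in> A" "\<And>\<beta>. \<beta> \<in> A \<Longrightarrow> Q \<beta> \<alpha> = Q \<alpha> \<beta>"
  shows "q_exponent A Q (k + unit_exp \<alpha>)
    = q_exponent A Q k + (\<Sum>\<beta>\<in>A. Q \<alpha> \<beta> * int (Poly_Mapping.lookup k \<beta>)) + Q \<alpha> \<alpha>"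
proof -
  have "quad_form A Q (k + unit_exp \<alpha>) + diag_form A Q (k + unit_exp \<alpha>)
      = (quad_form A Q k + diag_form A Q k)
        + ((\<Sum>\<beta>\<in>A. Q \<alpha> \<beta> * int (Poly_Mapping.lookup k \<beta>)) + Q \<alpha> \<alpha>) * 2"
    using quad_form_add_unit[of A \<alpha> Q k, OF assms] diag_form_add_unit[OF assms(1,2), of Q k]
    by simp
  then show ?thesis
    unfolding q_exponent_def by simp
qed

lemma f_quantum_coeff:
  "Poly_Mapping.keys k \<subseteq> A \<Longrightarrow> mfps_coeff (f_quantum A Q) k
    = minus_one_pow (diag_form A Q k) * qpow (q_exponent A Q k) * laurent_of_poly (qmultinomial A k)"
  by (simp add: f_quantum_def qpow_def q_exponent_def)

definition q_weight :: "('v \<Rightarrow> 'v \<Rightarrow> int) \<Rightarrow> 'v \<Rightarrow> laurent" where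
  "q_weight Q \<alpha> = minus_one_pow (Q \<alpha> \<alpha>) * qpow (Q \<alpha> \<alpha>)"

lemma keys_diff_unit:
  fixes k :: "'v \<Rightarrow>\<^sub>0 nat"
  shows "Poly_Mapping.keys (k - unit_exp \<alpha>) \<subseteq> Poly_Mapping.keys k"
  by (auto simp: in_keys_iff lookup_diff_unit)

lemma total_pos:
  assumes "finite A" "Poly_Mapping.keys k \<subseteq> A" "k \<noteq> 0"
  shows "total A k > 0"
proof -
  have "total A k = mon_degree k"
    unfolding mon_degree_def
    by (rule sum.mono_neutral_right) (use assms in \<open>auto simp: in_keys_iff\<close>)
  then show ?thesis
    using mon_degree_pos[OF assms(3)] by simp
qed

text \<open>When \<open>k\<^sub>\<alpha>\<close> increases by one, the exponent \<open>(k\<^sup>t Q k + diag(Q) k) / 2\<close> grows by what \<open>Q\<close>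
  contributes to \<open>skew_form\<close> and \<open>q_weight\<close>. The indicator in \<open>skew_form\<close> supplies the powers of \<open>q\<close> in
  Pascal's rule, to which the equation thus reduces at each monomial.\<close>

lemma f_quantum_equation:
  assumes A: "finite A" "inj_on r A" and sym: "\<And>\<alpha> \<beta>. \<alpha> \<in> A \<Longrightarrow> \<beta> \<in> A \<Longrightarrow> Q \<alpha> \<beta> = Q \<beta> \<alpha>"
  shows "f_quantum A Q
    = 1 + qdiff A (q_weight Q) (\<lambda>\<alpha> k. qpow (skew_form A r Q \<alpha> k)) (f_quantum A Q)"
proof (rule mfps_eqI)
  fix k :: "'a \<Rightarrow>\<^sub>0 nat"
  let ?I = "{\<alpha>. \<alpha> \<in> A \<and> Poly_Mapping.lookup k \<alpha> > 0}"
  let ?t = "\<lambda>\<alpha>. q_weight Q \<alpha> * qpow (skew_form A r Q \<alpha> (k - unit_exp \<alpha>))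
      * mfps_coeff (f_quantum A Q) (k - unit_exp \<alpha>)"
  consider "k = 0" | "\<not> Poly_Mapping.keys k \<subseteq> A" | "Poly_Mapping.keys k \<subseteq> A" "k \<noteq> 0"
    by blast
  then have "mfps_coeff (f_quantum A Q) k = (if k = 0 then 1 else 0) + (\<Sum>\<alpha>\<in>?I. ?t \<alpha>)"
  proof cases
    case 1
    have "qpoch_prod A 0 = 1" by (simp add: qpoch_prod_def)
    then have "qmultinomial A 0 = 1"
      using qmultinomial_pascal(1)[OF A, of 0] by simp
    moreover have "quad_form A Q 0 = 0" "diag_form A Q 0 = 0"
      by (simp_all add: quad_form_def diag_form_def)
    ultimately have "mfps_coeff (f_quantum A Q) 0 = 1"
      by (simp add: f_quantum_coeff minus_one_pow_def q_exponent_def qpow_0)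
    then show ?thesis using 1 by simp
  next
    case 2
    have "?t \<alpha> = 0" if \<alpha>: "\<alpha> \<in> ?I" for \<alpha>
    proof -
      obtain \<beta> where \<beta>: "\<beta> \<in> Poly_Mapping.keys k" "\<beta> \<notin> A" using 2 by blast
      then have "\<beta> \<in> Poly_Mapping.keys (k - unit_exp \<alpha>)"
        using \<alpha> by (auto simp: in_keys_iff lookup_diff_unit)
      then have "\<not> Poly_Mapping.keys (k - unit_exp \<alpha>) \<subseteq> A" using \<beta> by blast
      then show ?thesis by (simp add: f_quantum_def)
    qed
    then have "(\<Sum>\<alpha>\<in>?I. ?t \<alpha>) = 0"
      by (intro sum.neutral ballI)
    moreover have "k \<noteq> 0" using 2 by auto
    moreover have "mfps_coeff (f_quantum A Q) k = 0" using 2 by (simp add: f_quantum_def)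
    ultimately show ?thesis by simp
  next
    case 3
    have t: "?t \<alpha> = minus_one_pow (diag_form A Q k) * qpow (q_exponent A Q k)
        * laurent_of_poly (qvar ^ upper_sum A r \<alpha> k * qmultinomial A (k - unit_exp \<alpha>))"
      if \<alpha>: "\<alpha> \<in> ?I" for \<alpha>
    proof -
      define l where "l = k - unit_exp \<alpha>"
      have k: "k = l + unit_exp \<alpha>"
        using single_le_decomp[of k \<alpha>] \<alpha> by (simp add: l_def add.commute)
      have l: "Poly_Mapping.keys l \<subseteq> A"
        unfolding l_def by (rule subset_trans[OF keys_diff_unit 3(1)])
      have "upper_sum A r \<alpha> k = upper_sum A r \<alpha> l"
        unfolding upper_sum_def k by (intro sum.cong refl) (auto simp: lookup_add lookup_single when_def)
      then have e: "Q \<alpha> \<alpha> + skew_form A r Q \<alpha> l + q_exponent A Q l = q_exponent A Q k + int (upper_sum A r \<alpha> k)"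
        unfolding skew_form_eq[OF A(1)]
        using q_exponent_add_unit[OF A(1), of \<alpha> Q l] \<alpha> sym k by auto
      have "?t \<alpha> = (minus_one_pow (Q \<alpha> \<alpha>) * minus_one_pow (diag_form A Q l))
          * qpow (Q \<alpha> \<alpha> + skew_form A r Q \<alpha> l + q_exponent A Q l) * laurent_of_poly (qmultinomial A l)"
        unfolding l_def[symmetric] by (simp add: f_quantum_coeff[OF l] q_weight_def qpow_add mult_ac)
      also have "minus_one_pow (Q \<alpha> \<alpha>) * minus_one_pow (diag_form A Q l)
          = (minus_one_pow (diag_form A Q k) :: laurent)"
        using diag_form_add_unit[OF A(1), of \<alpha> Q l] \<alpha> by (simp add: k add.commute flip: minus_one_pow_add)
      finally have t: "?t \<alpha> = minus_one_pow (diag_form A Q k)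
          * qpow (Q \<alpha> \<alpha> + skew_form A r Q \<alpha> l + q_exponent A Q l) * laurent_of_poly (qmultinomial A l)" .
      show ?thesis
        unfolding t e unfolding l_def qpow_add laurent_of_poly.hom_mult laurent_of_poly_qvar_power
        by (simp only: mult.assoc)
    qed
    have "(\<Sum>\<alpha>\<in>?I. ?t \<alpha>) = minus_one_pow (diag_form A Q k) * qpow (q_exponent A Q k)
        * laurent_of_poly (\<Sum>\<alpha>\<in>?I. qvar ^ upper_sum A r \<alpha> k * qmultinomial A (k - unit_exp \<alpha>))"
      unfolding laurent_of_poly.hom_sum sum_distrib_left by (intro sum.cong refl t)
    also have "(\<Sum>\<alpha>\<in>?I. qvar ^ upper_sum A r \<alpha> k * qmultinomial A (k - unit_exp \<alpha>)) = qmultinomial A k"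
      by (rule qmultinomial_pascal(2)[OF A total_pos[OF A(1) 3], symmetric])
    finally show ?thesis
      using 3 by (simp add: f_quantum_coeff)
  qed
  then show "mfps_coeff (f_quantum A Q) k = mfps_coeff
      (1 + qdiff A (q_weight Q) (\<lambda>\<alpha> k. qpow (skew_form A r Q \<alpha> k)) (f_quantum A Q)) k"
    using A(1) by (simp add: qdiff_coeff)
qed

section \<open>Iterating the q-difference operator\<close>

lemma qdiff_sum:
  assumes "\<And>\<alpha>. \<alpha> \<in> A \<Longrightarrow> exp_char (\<chi> \<alpha>)"
  shows "qdiff A y \<chi> (sum F I) = (\<Sum>i\<in>I. qdiff A y \<chi> (F i))"
proof -
  have "qdiff A y \<chi> (sum F I)
      = (\<Sum>\<alpha>\<in>A. \<Sum>i\<in>I. mfps_const (y \<alpha>) * mfps_var \<alpha> * mfps_twist (\<chi> \<alpha>) (F i))"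
    unfolding qdiff_def
  proof (intro sum.cong refl)
    fix \<alpha> assume "\<alpha> \<in> A"
    then interpret comm_ring_hom "mfps_twist (\<chi> \<alpha>)"
      by (intro comm_ring_hom_twist assms)
    show "mfps_const (y \<alpha>) * mfps_var \<alpha> * mfps_twist (\<chi> \<alpha>) (sum F I)
        = (\<Sum>i\<in>I. mfps_const (y \<alpha>) * mfps_var \<alpha> * mfps_twist (\<chi> \<alpha>) (F i))"
      by (simp only: hom_sum sum_distrib_left)
  qed
  then show ?thesis
    by (simp add: qdiff_def sum.swap[of _ I A])
qed

lemma qdiff_add:
  assumes "\<And>\<alpha>. \<alpha> \<in> A \<Longrightarrow> exp_char (\<chi> \<alpha>)"
  shows "qdiff A y \<chi> (F + G) = qdiff A y \<chi> F + qdiff A y \<chi> G"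
  using qdiff_sum[OF assms, where F = "\<lambda>b. if b then F else G" and I = UNIV and y = y]
  by (simp add: UNIV_bool add.commute)

lemma qdiff_const_mult: "qdiff A y \<chi> (mfps_const c * F) = mfps_const c * qdiff A y \<chi> F"
proof -
  have "mfps_twist \<xi> (mfps_const c * F) = mfps_const c * mfps_twist \<xi> F" for \<xi>
    by (rule mfps_eqI) (simp add: mfps_twist_coeff mfps_const_coeff mult.left_commute)
  then show ?thesis
    by (simp add: qdiff_def sum_distrib_left mult_ac)
qed

lemma mfps_map_qdiff:
  assumes "comm_ring_hom \<phi>"
  shows "mfps_map \<phi> (qdiff A y \<chi> F) = qdiff A (\<lambda>\<alpha>. \<phi> (y \<alpha>)) (\<lambda>\<alpha> k. \<phi> (\<chi> \<alpha> k)) (mfps_map \<phi> F)"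
proof -
  interpret comm_ring_hom \<phi> by fact
  interpret m: comm_ring_hom "mfps_map \<phi>" by (rule comm_ring_hom_map[OF assms])
  have "mfps_map \<phi> (mfps_twist \<xi> F) = mfps_twist (\<lambda>k. \<phi> (\<xi> k)) (mfps_map \<phi> F)" for \<xi>
    by (rule mfps_eqI) (simp add: mfps_twist_coeff hom_mult)
  then show ?thesis
    by (simp add: qdiff_def m.hom_sum m.hom_mult mfps_map_const[OF assms] mfps_map_var[OF assms])
qed

definition exps :: "'v set \<Rightarrow> nat \<Rightarrow> ('v \<Rightarrow>\<^sub>0 nat) set" where
  "exps A n = {j. Poly_Mapping.keys j \<subseteq> A \<and> total A j = n}"

lemma exps_0: "finite A \<Longrightarrow> exps A 0 = {0}"
  by (auto simp: exps_def in_keys_iff intro!: poly_mapping_eqI)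

lemma total_add_unit: "finite A \<Longrightarrow> \<alpha> \<in> A \<Longrightarrow> total A (j + unit_exp \<alpha>) = Suc (total A j)"
  by (simp add: lookup_add sum.distrib lookup_single when_def)

lemma exps_add_unit: "finite A \<Longrightarrow> \<alpha> \<in> A \<Longrightarrow> j \<in> exps A n \<Longrightarrow> j + unit_exp \<alpha> \<in> exps A (Suc n)"
  using keys_add[of j "unit_exp \<alpha>"] by (auto simp: exps_def total_add_unit split: if_splits)

lemma exps_diff_unit:
  "finite A \<Longrightarrow> \<alpha> \<in> A \<Longrightarrow> Poly_Mapping.lookup j \<alpha> > 0 \<Longrightarrow> j \<in> exps A (Suc n) \<Longrightarrow> j - unit_exp \<alpha> \<in> exps A n"
  using keys_diff_unit[of j \<alpha>] total_diff_unit[of A \<alpha> j] by (auto simp: exps_def)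

lemma diff_unit_add: "Poly_Mapping.lookup j \<alpha> > 0 \<Longrightarrow> j - unit_exp \<alpha> + unit_exp \<alpha> = j"
  using single_le_decomp[of j \<alpha>] by (simp add: add.commute)

lemma finite_exps: "finite A \<Longrightarrow> finite (exps A n)"
proof (induction n)
  case (Suc n)
  have "exps A (Suc n) \<subseteq> (\<lambda>(\<alpha>, j). j + unit_exp \<alpha>) ` (A \<times> exps A n)"
  proof
    fix j assume j: "j \<in> exps A (Suc n)"
    then have "\<exists>\<alpha>\<in>A. Poly_Mapping.lookup j \<alpha> \<noteq> 0"
      unfolding exps_def by (metis (mono_tags, lifting) mem_Collect_eq nat.distinct(1) sum.neutral)
    then obtain \<alpha> where \<alpha>: "\<alpha> \<in> A" "Poly_Mapping.lookup j \<alpha> > 0" by blast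
    then show "j \<in> (\<lambda>(\<alpha>, j). j + unit_exp \<alpha>) ` (A \<times> exps A n)"
      using exps_diff_unit[OF Suc.prems \<alpha> j] diff_unit_add[OF \<alpha>(2)]
      by (intro image_eqI[of _ _ "(\<alpha>, j - unit_exp \<alpha>)"]) auto
  qed
  then show ?case
    using Suc by (meson finite_SigmaI finite_imageI finite_subset)
qed (simp add: exps_0)

text \<open>Expanding the \<open>n\<close>-th power of the operator yields one term for each word of length \<open>n\<close> in \<open>A\<close>. The
  rescaling of \<open>F\<close> that belongs to a word depends only on its content \<open>j\<close>, which counts each letter, and
  the coefficients of all words of content \<open>j\<close> add up to \<open>c j\<close>: the recursion for \<open>c\<close> splits off the
  first letter.\<close>

lemma qdiff_funpow:
  fixes F :: "('v, 'c :: comm_ring_1) mfps"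
  assumes A: "finite A" and \<chi>: "\<And>\<alpha>. \<alpha> \<in> A \<Longrightarrow> exp_char (\<chi> \<alpha>)"
    and c0: "c 0 = 1"
    and c: "\<And>j. Poly_Mapping.keys j \<subseteq> A \<Longrightarrow> j \<noteq> 0 \<Longrightarrow> c j
      = (\<Sum>\<alpha> | \<alpha> \<in> A \<and> Poly_Mapping.lookup j \<alpha> > 0. y \<alpha> * \<chi> \<alpha> (j - unit_exp \<alpha>) * c (j - unit_exp \<alpha>))"
  shows "(qdiff A y \<chi> ^^ n) F = (\<Sum>j\<in>exps A n. mfps_const (c j)
    * (mfps_monom j * mfps_twist (\<lambda>k. \<Prod>\<alpha>\<in>A. \<chi> \<alpha> k ^ Poly_Mapping.lookup j \<alpha>) F))"
proof (induction n)
  case 0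
  have "mfps_twist (\<lambda>k. 1) F = F"
    by (rule mfps_eqI) (simp add: mfps_twist_coeff)
  then show ?case
    by (simp add: exps_0[OF A] c0 mfps_monom_0)
next
  case (Suc n)
  define H where "H = (\<lambda>j. mfps_monom j * mfps_twist (\<lambda>k. \<Prod>\<alpha>\<in>A. \<chi> \<alpha> k ^ Poly_Mapping.lookup j \<alpha>) F)"
  let ?c = "\<lambda>\<alpha> j. y \<alpha> * \<chi> \<alpha> j * c j"
  have H: "mfps_const (y \<alpha>) * mfps_var \<alpha> * mfps_twist (\<chi> \<alpha>) (mfps_const (c j) * H j)
      = mfps_const (?c \<alpha> j) * H (j + unit_exp \<alpha>)" if \<alpha>: "\<alpha> \<in> A" for \<alpha> j
  proof -
    interpret comm_ring_hom "mfps_twist (\<chi> \<alpha>)"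
      by (rule comm_ring_hom_twist[OF \<chi>[OF \<alpha>]])
    have "\<chi> \<alpha> k * (\<Prod>\<beta>\<in>A. \<chi> \<beta> k ^ Poly_Mapping.lookup j \<beta>)
        = (\<Prod>\<beta>\<in>A. \<chi> \<beta> k ^ Poly_Mapping.lookup (j + unit_exp \<alpha>) \<beta>)" for k
    proof -
      have "(\<Prod>\<beta>\<in>A - {\<alpha>}. \<chi> \<beta> k ^ Poly_Mapping.lookup (j + unit_exp \<alpha>) \<beta>)
          = (\<Prod>\<beta>\<in>A - {\<alpha>}. \<chi> \<beta> k ^ Poly_Mapping.lookup j \<beta>)"
        by (intro prod.cong refl) (auto simp: lookup_add lookup_single when_def)
      then show ?thesis
        by (simp add: prod.remove[OF A \<alpha>] lookup_add power_add mult_ac)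
    qed
    then have tw: "mfps_twist (\<chi> \<alpha>) (mfps_const (c j) * H j) = mfps_const (c j)
        * (mfps_const (\<chi> \<alpha> j) * mfps_monom j
          * mfps_twist (\<lambda>k. \<Prod>\<beta>\<in>A. \<chi> \<beta> k ^ Poly_Mapping.lookup (j + unit_exp \<alpha>) \<beta>) F)"
      by (simp add: H_def hom_mult mfps_twist_const[OF \<chi>[OF \<alpha>]] mfps_twist_monom mfps_twist_twist)
    have ac: "a * v * (b * (e * u * G)) = (a * e * b) * ((v * u) * G)" for a b e u v G :: "('v, 'c) mfps"
      by (simp only: mult_ac)
    have "mfps_var \<alpha> * mfps_monom j = (mfps_monom (j + unit_exp \<alpha>) :: ('v, 'c) mfps)"
      by (simp add: mfps_var_eq_monom mfps_monom_mult add.commute)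
    then show ?thesis
      unfolding tw ac by (simp add: H_def mfps_const.hom_mult)
  qed
  have "(qdiff A y \<chi> ^^ Suc n) F = qdiff A y \<chi> (\<Sum>j\<in>exps A n. mfps_const (c j) * H j)"
    by (simp add: Suc.IH H_def)
  also have "\<dots> = (\<Sum>j\<in>exps A n. qdiff A y \<chi> (mfps_const (c j) * H j))"
    by (rule qdiff_sum[OF \<chi>])
  also have "\<dots> = (\<Sum>j\<in>exps A n. \<Sum>\<alpha>\<in>A. mfps_const (?c \<alpha> j) * H (j + unit_exp \<alpha>))"
    unfolding qdiff_def by (intro sum.cong refl H)
  also have "\<dots> = (\<Sum>x\<in>exps A n \<times> A. mfps_const (?c (snd x) (fst x)) * H (fst x + unit_exp (snd x)))"
    by (simp add: sum.cartesian_product case_prod_beta)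
  also have "\<dots> = (\<Sum>x\<in>Sigma (exps A (Suc n)) (\<lambda>j. {\<alpha>. \<alpha> \<in> A \<and> Poly_Mapping.lookup j \<alpha> > 0}).
      mfps_const (?c (snd x) (fst x - unit_exp (snd x))) * H (fst x))"
    by (rule sum.reindex_bij_witness[where i = "\<lambda>(j, \<alpha>). (j - unit_exp \<alpha>, \<alpha>)"
          and j = "\<lambda>(j, \<alpha>). (j + unit_exp \<alpha>, \<alpha>)"])
       (auto simp: diff_unit_add lookup_add intro: exps_add_unit[OF A] exps_diff_unit[OF A])
  also have "\<dots> = (\<Sum>j\<in>exps A (Suc n). \<Sum>\<alpha> | \<alpha> \<in> A \<and> Poly_Mapping.lookup j \<alpha> > 0.
      mfps_const (?c \<alpha> (j - unit_exp \<alpha>)) * H j)"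
    by (subst sum.Sigma) (use finite_exps[OF A] A in \<open>auto simp: case_prod_beta\<close>)
  also have "\<dots> = (\<Sum>j\<in>exps A (Suc n). mfps_const (c j) * H j)"
  proof (intro sum.cong refl)
    fix j assume "j \<in> exps A (Suc n)"
    then have "Poly_Mapping.keys j \<subseteq> A" "j \<noteq> 0"
      by (auto simp: exps_def)
    from c[OF this] show "(\<Sum>\<alpha> | \<alpha> \<in> A \<and> Poly_Mapping.lookup j \<alpha> > 0. mfps_const (?c \<alpha> (j - unit_exp \<alpha>)) * H j)
        = mfps_const (c j) * H j"
      unfolding sum_distrib_right[symmetric] mfps_const.hom_sum[symmetric]
      by (rule arg_cong[OF sym])
  qed
  finally show ?case
    by (simp add: H_def)
qed

section \<open>The q-difference operator at a root of unity\<close>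

lemma comm_ring_hom_fps_nth_0: "comm_ring_hom (\<lambda>c :: complex fps. c $ 0)"
  by (rule comm_ring_homI) auto

definition at_root :: "complex \<Rightarrow> laurent \<Rightarrow> complex" where
  "at_root z P = laurent_expand z P $ 0"

lemma comm_ring_hom_at_root: "z \<noteq> 0 \<Longrightarrow> comm_ring_hom (at_root z)"
proof -
  assume "z \<noteq> 0"
  then interpret e: comm_ring_hom "laurent_expand z"
    by (rule comm_ring_hom_laurent_expand)
  show ?thesis
    unfolding at_root_def by (rule comm_ring_homI) (auto simp: e.hom_add e.hom_mult)
qed

lemma at_root_qpow: "z \<noteq> 0 \<Longrightarrow> at_root z (qpow i) = z powi i"
  by (simp add: at_root_def laurent_expand_qpow qexp_nth)

lemma eq_single:
  assumes "finite A" "\<alpha> \<in> A" "j \<in> exps A m" "Poly_Mapping.lookup j \<alpha> \<ge> m"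
  shows "j = Poly_Mapping.single \<alpha> m"
proof -
  have "total A j = Poly_Mapping.lookup j \<alpha> + (\<Sum>\<beta>\<in>A - {\<alpha>}. Poly_Mapping.lookup j \<beta>)"
    by (rule sum.remove[OF assms(1,2)])
  then have *: "Poly_Mapping.lookup j \<alpha> = m" "(\<Sum>\<beta>\<in>A - {\<alpha>}. Poly_Mapping.lookup j \<beta>) = 0"
    using assms(3,4) by (auto simp: exps_def)
  show ?thesis
  proof (rule poly_mapping_eqI)
    fix \<beta>
    show "Poly_Mapping.lookup j \<beta> = Poly_Mapping.lookup (Poly_Mapping.single \<alpha> m) \<beta>"
      using * assms(1,3) by (cases "\<beta> = \<alpha>"; cases "\<beta> \<in> A")
        (auto simp: lookup_single when_def exps_def in_keys_iff)
  qed
qed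

locale primitive_root =
  fixes z :: complex and m :: nat
  assumes m: "m \<ge> 1" and z_m: "z ^ m = 1" and primitive: "0 < k \<Longrightarrow> k < m \<Longrightarrow> z ^ k \<noteq> 1"
begin

lemma z_nonzero: "z \<noteq> 0"
  using z_m m by (auto simp: power_0_left)

sublocale at_root: comm_ring_hom "at_root z"
  by (rule comm_ring_hom_at_root[OF z_nonzero])

lemma powi_m: "(z powi i) ^ m = 1"
proof -
  have "(z powi i) ^ m = (z ^ m) powi i"
    by (simp add: power_int_power power_int_power' mult.commute)
  then show ?thesis by (simp add: z_m)
qed

lemma at_root_qpoch:
  "at_root z (laurent_of_poly (qpoch n)) = (\<Prod>i=1..n. 1 - z ^ i)"
  by (simp add: qpoch_eq laurent_of_poly.hom_prod laurent_of_poly.hom_minus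
      laurent_of_poly_qvar_power at_root.hom_prod at_root.hom_minus at_root_qpow[OF z_nonzero])

text \<open>The factor \<open>1 - q\<^sup>m\<close> of \<open>(q;q)\<^sub>m\<close> vanishes at a primitive \<open>m\<close>-th root of unity, and cancels
  only against a denominator \<open>(q;q)\<^sub>m\<close>.\<close>

lemma qmultinomial_vanishes:
  assumes A: "finite A" and j: "j \<in> exps A m" and less: "\<And>\<alpha>. \<alpha> \<in> A \<Longrightarrow> Poly_Mapping.lookup j \<alpha> < m"
  shows "at_root z (laurent_of_poly (qmultinomial A j)) = 0"
proof -
  obtain r :: "'a \<Rightarrow> nat" where r: "inj_on r A"
    using finite_imp_inj_to_nat_seg[OF A] by blast
  have "qpoch_prod A j * qmultinomial A j = qpoch m"
    using qmultinomial_pascal(1)[OF A r, of j] j by (simp add: exps_def)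
  then have "at_root z (laurent_of_poly (qpoch_prod A j)) * at_root z (laurent_of_poly (qmultinomial A j))
      = (\<Prod>i=1..m. 1 - z ^ i)"
    by (simp flip: at_root_qpoch at_root.hom_mult laurent_of_poly.hom_mult)
  also have "\<dots> = 0"
    using m z_m by (intro prod_zero) auto
  also have "at_root z (laurent_of_poly (qpoch_prod A j))
      = (\<Prod>\<alpha>\<in>A. \<Prod>i=1..Poly_Mapping.lookup j \<alpha>. 1 - z ^ i)"
    by (simp add: qpoch_prod_def laurent_of_poly.hom_prod at_root.hom_prod at_root_qpoch)
  moreover have "\<dots> \<noteq> 0"
    using A less primitive by (force simp: prod_zero_iff)
  ultimately show ?thesis by simp
qed

lemma qmultinomial_single:
  assumes A: "finite A" and \<alpha>: "\<alpha> \<in> A"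
  shows "qmultinomial A (Poly_Mapping.single \<alpha> n) = 1"
proof -
  obtain r :: "'a \<Rightarrow> nat" where r: "inj_on r A"
    using finite_imp_inj_to_nat_seg[OF A] by blast
  have "total A (Poly_Mapping.single \<alpha> n) = n"
    using A \<alpha> by (simp add: lookup_single when_def)
  moreover have "qpoch_prod A (Poly_Mapping.single \<alpha> n) = qpoch n"
  proof -
    have "(\<Prod>\<beta>\<in>A - {\<alpha>}. qpoch (Poly_Mapping.lookup (Poly_Mapping.single \<alpha> n) \<beta>)) = 1"
      by (intro prod.neutral) (auto simp: lookup_single when_def)
    then show ?thesis
      by (simp add: qpoch_prod_def prod.remove[OF A \<alpha>])
  qed
  ultimately have "qpoch n * qmultinomial A (Poly_Mapping.single \<alpha> n) = qpoch n * 1"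
    using qmultinomial_pascal(1)[OF A r, of "Poly_Mapping.single \<alpha> n"] by simp
  then show ?thesis
    using qpoch_nonzero[of n] by (metis mult_left_cancel)
qed

text \<open>If \<open>m\<close> is odd, it divides \<open>m (m + 1) / 2\<close>; if \<open>m\<close> is even, \<open>z ^ (m / 2) = -1\<close>. Thus the sign of
  the coefficient of \<open>t\<^sub>\<alpha>\<^sup>m\<close> in the \<open>q\<close>-series at \<open>z\<close> is the sign of \<open>t\<^sub>\<alpha>\<close> in the denominator.\<close>

lemma power_triangular: "z powi (a * int (m * (m + 1) div 2)) * minus_one_pow (a * int m) = minus_one_pow a"
proof (cases "even m")
  case True
  then obtain n where n: "m = 2 * n" by blast
  then have "z ^ n \<noteq> 1" using m by (intro primitive) auto
  moreover have "(z ^ n)\<^sup>2 = 1" using z_m by (simp add: n mult.commute flip: power_mult)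
  ultimately have zn: "z ^ n = -1" by (simp add: power2_eq_1_iff)
  have "m * (m + 1) div 2 = n * (m + 1)" by (simp add: n)
  then have "z ^ (m * (m + 1) div 2) = (z ^ n) ^ (m + 1)" by (simp only: power_mult)
  then have "z ^ (m * (m + 1) div 2) = -1" using True by (simp add: zn)
  then have "z powi (a * int (m * (m + 1) div 2)) = (-1) powi a"
    by (simp add: mult.commute[of a] power_int_mult)
  moreover have "(-1 :: complex) powi a = minus_one_pow a"
    by (auto simp: minus_one_pow_def power_int_def even_nat_iff)
  ultimately show ?thesis
    using True by (simp add: minus_one_pow_def)
next
  case False
  then have "m * (m + 1) div 2 = m * ((m + 1) div 2)"
    by (intro div_mult_swap[symmetric]) simp
  then have "z ^ (m * (m + 1) div 2) = 1" by (simp add: power_mult z_m)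
  then have "z powi (a * int (m * (m + 1) div 2)) = 1"
    by (simp add: mult.commute[of a] power_int_mult)
  then show ?thesis
    using False by (simp add: minus_one_pow_def)
qed

lemma f_quantum_at_root_single:
  assumes A: "finite A" and \<alpha>: "\<alpha> \<in> A"
  shows "at_root z (mfps_coeff (f_quantum A Q) (Poly_Mapping.single \<alpha> m)) = minus_one_pow (Q \<alpha> \<alpha>)"
proof -
  let ?s = "Poly_Mapping.single \<alpha> m" and ?T = "int (m * (m + 1) div 2)"
  have s: "int (Poly_Mapping.lookup ?s \<beta>) = int m * (if \<beta> = \<alpha> then 1 else 0)" for \<beta>
    by (simp add: lookup_single when_def)
  have diag: "diag_form A Q ?s = Q \<alpha> \<alpha> * int m"
    unfolding diag_form_def s mult.assoc[symmetric] sum_mult_indicator(1)[OF A \<alpha>] ..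
  have quad: "quad_form A Q ?s = int m * Q \<alpha> \<alpha> * int m"
  proof -
    have "quad_form A Q ?s = (\<Sum>\<beta>\<in>A. int m * (if \<beta> = \<alpha> then 1 else 0) * Q \<beta> \<alpha> * int m)"
      unfolding quad_form_def s mult.assoc[symmetric] sum_mult_indicator(1)[OF A \<alpha>] ..
    also have "\<dots> = (\<Sum>\<beta>\<in>A. (int m * Q \<beta> \<alpha> * int m) * (if \<beta> = \<alpha> then 1 else 0))"
      by (intro sum.cong refl) (simp add: mult_ac)
    also have "\<dots> = int m * Q \<alpha> \<alpha> * int m"
      by (rule sum_mult_indicator(1)[OF A \<alpha>])
    finally show ?thesis .
  qed
  have "2 * (m * (m + 1) div 2) = m * (m + 1)"
    by simp
  then have T: "int (m * (m + 1)) = 2 * ?T"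
    by (metis of_nat_mult of_nat_numeral)
  have "quad_form A Q ?s + diag_form A Q ?s = Q \<alpha> \<alpha> * int (m * (m + 1))"
    unfolding diag quad by (simp add: algebra_simps)
  then have "quad_form A Q ?s + diag_form A Q ?s = 2 * (Q \<alpha> \<alpha> * ?T)"
    unfolding T by (simp only: mult.left_commute)
  then have "q_exponent A Q ?s = Q \<alpha> \<alpha> * ?T"
    unfolding q_exponent_def by simp
  moreover have "Poly_Mapping.keys ?s \<subseteq> A"
    using \<alpha> by simp
  ultimately show ?thesis
    using power_triangular[of "Q \<alpha> \<alpha>"]
    by (simp add: f_quantum_coeff diag qmultinomial_single[OF A \<alpha>] at_root.hom_mult
        at_root.hom_minus_one_pow at_root_qpow[OF z_nonzero] mult.commute)
qed

text \<open>In the expansion of the \<open>m\<close>-th power the coefficient of the content \<open>j\<close> is that of \<open>t\<^sup>j\<close> in the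
  \<open>q\<close>-series. At a primitive \<open>m\<close>-th root of unity only the words that repeat one letter \<open>m\<close> times survive,
  and for these the rescaling is by \<open>m\<close>-th powers of powers of \<open>z\<close>, which are trivial.\<close>

lemma qdiff_power_at_root:
  assumes A: "finite A" "inj_on r A" and sym: "\<And>\<alpha> \<beta>. \<alpha> \<in> A \<Longrightarrow> \<beta> \<in> A \<Longrightarrow> Q \<alpha> \<beta> = Q \<beta> \<alpha>"
  shows "(qdiff A (\<lambda>\<alpha>. at_root z (q_weight Q \<alpha>)) (\<lambda>\<alpha> k. at_root z (qpow (skew_form A r Q \<alpha> k))) ^^ m) F
    = (\<Sum>\<alpha>\<in>A. minus_one_pow (Q \<alpha> \<alpha>) * mfps_var \<alpha> ^ m) * F"
proof -
  let ?y = "\<lambda>\<alpha>. at_root z (q_weight Q \<alpha>)"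
  let ?\<chi> = "\<lambda>\<alpha> k. at_root z (qpow (skew_form A r Q \<alpha> k))"
  let ?c = "\<lambda>j. at_root z (mfps_coeff (f_quantum A Q) j)"
  have \<chi>: "exp_char (?\<chi> \<alpha>)" for \<alpha>
  proof -
    have "skew_form A r Q \<alpha> 0 = 0" by (simp add: skew_form_def)
    then show ?thesis
      by (simp add: exp_char_def skew_form_add qpow_add qpow_0 at_root.hom_mult)
  qed
  have f: "mfps_coeff (f_quantum A Q) j = (if j = 0 then 1 else 0)
      + (\<Sum>\<alpha> | \<alpha> \<in> A \<and> Poly_Mapping.lookup j \<alpha> > 0. q_weight Q \<alpha>
        * qpow (skew_form A r Q \<alpha> (j - unit_exp \<alpha>)) * mfps_coeff (f_quantum A Q) (j - unit_exp \<alpha>))" for j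
    by (subst f_quantum_equation[OF A sym]) (simp_all add: qdiff_coeff[OF A(1)])
  have c0: "?c 0 = 1"
    by (subst f) simp
  have c: "?c j = (\<Sum>\<alpha> | \<alpha> \<in> A \<and> Poly_Mapping.lookup j \<alpha> > 0.
      ?y \<alpha> * ?\<chi> \<alpha> (j - unit_exp \<alpha>) * ?c (j - unit_exp \<alpha>))" if "j \<noteq> 0" for j
    by (subst f) (simp add: that at_root.hom_sum at_root.hom_mult)
  let ?t = "\<lambda>j. mfps_const (?c j) * (mfps_monom j * mfps_twist (\<lambda>k. \<Prod>\<alpha>\<in>A. ?\<chi> \<alpha> k ^ Poly_Mapping.lookup j \<alpha>) F)"
  have "(qdiff A ?y ?\<chi> ^^ m) F = (\<Sum>j\<in>exps A m. ?t j)"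
    by (rule qdiff_funpow[OF A(1) \<chi> c0 c])
  also have "\<dots> = (\<Sum>j\<in>(\<lambda>\<alpha>. Poly_Mapping.single \<alpha> m) ` A. ?t j)"
  proof (rule sum.mono_neutral_right[OF finite_exps[OF A(1)]])
    show "(\<lambda>\<alpha>. Poly_Mapping.single \<alpha> m) ` A \<subseteq> exps A m"
      using A(1) by (auto simp: exps_def lookup_single when_def split: if_splits)
    show "\<forall>j\<in>exps A m - (\<lambda>\<alpha>. Poly_Mapping.single \<alpha> m) ` A. ?t j = 0"
    proof
      fix j assume j: "j \<in> exps A m - (\<lambda>\<alpha>. Poly_Mapping.single \<alpha> m) ` A"
      have "Poly_Mapping.lookup j \<alpha> < m" if "\<alpha> \<in> A" for \<alpha>
      proof (rule ccontr)
        assume "\<not> Poly_Mapping.lookup j \<alpha> < m"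
        then have "j = Poly_Mapping.single \<alpha> m"
          using j by (intro eq_single[OF A(1) that]) auto
        then show False
          using j that by blast
      qed
      then have "at_root z (laurent_of_poly (qmultinomial A j)) = 0"
        using j by (intro qmultinomial_vanishes[OF A(1)]) auto
      moreover have "Poly_Mapping.keys j \<subseteq> A"
        using j by (simp add: exps_def)
      ultimately have "?c j = 0"
        by (simp add: f_quantum_coeff at_root.hom_mult)
      then show "?t j = 0"
        by simp
    qed
  qed
  also have "\<dots> = (\<Sum>\<alpha>\<in>A. ?t (Poly_Mapping.single \<alpha> m))"
  proof (rule sum.reindex_cong[OF _ refl refl])
    show "inj_on (\<lambda>\<alpha>. Poly_Mapping.single \<alpha> m) A"
    proof (rule inj_onI)
      fix \<alpha> \<beta> assume "Poly_Mapping.single \<alpha> m = Poly_Mapping.single \<beta> m"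
      then have "Poly_Mapping.lookup (Poly_Mapping.single \<beta> m) \<alpha> = m"
        by (metis lookup_single_eq)
      then show "\<alpha> = \<beta>"
        using m by (auto simp: lookup_single when_def split: if_splits)
    qed
  qed
  also have "\<dots> = (\<Sum>\<alpha>\<in>A. minus_one_pow (Q \<alpha> \<alpha>) * mfps_var \<alpha> ^ m * F)"
  proof (intro sum.cong refl)
    fix \<alpha> assume \<alpha>: "\<alpha> \<in> A"
    have "(\<Prod>\<beta>\<in>A. ?\<chi> \<beta> k ^ Poly_Mapping.lookup (Poly_Mapping.single \<alpha> m) \<beta>) = 1" for k
      by (intro prod.neutral) (auto simp: lookup_single when_def at_root_qpow[OF z_nonzero] powi_m)
    moreover have "mfps_twist (\<lambda>k. 1) F = F"
      by (rule mfps_eqI) (simp add: mfps_twist_coeff)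
    ultimately show "?t (Poly_Mapping.single \<alpha> m) = minus_one_pow (Q \<alpha> \<alpha>) * mfps_var \<alpha> ^ m * F"
      by (simp add: f_quantum_at_root_single[OF A(1) \<alpha>] mfps_var_power mfps_const.hom_minus_one_pow mult.assoc)
  qed
  finally show ?thesis
    by (simp add: sum_distrib_right)
qed

end

section \<open>Integrality of the expansions\<close>

text \<open>In \<^typ>\<open>complex fps\<close> the variable stands for \<open>q - z\<close>. So \<open>ord_coeff n\<close> extracts the coefficient
  of \<open>(q - z)\<^sup>n\<close>, a power series in the \<open>t\<^sub>\<alpha>\<close>, and \<open>const_lift\<close> below embeds the series that do not
  involve \<open>q\<close>.\<close>

definition ord_coeff :: "nat \<Rightarrow> ('v, complex fps) mfps \<Rightarrow> ('v, complex) mfps" where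
  "ord_coeff n = mfps_map (\<lambda>c. c $ n)"

lemma ord_coeff_coeff [simp]: "mfps_coeff (ord_coeff n F) k = mfps_coeff F k $ n"
  by (simp add: ord_coeff_def)

lemma ord_coeff_add: "ord_coeff n (F + G) = ord_coeff n F + ord_coeff n G"
  and ord_coeff_diff: "ord_coeff n (F - G) = ord_coeff n F - ord_coeff n G"
  and ord_coeff_1: "ord_coeff n 1 = (if n = 0 then 1 else 0)"
  and ord_coeff_const: "ord_coeff n (mfps_const c) = mfps_const (c $ n)"
  by (rule mfps_eqI; simp add: mfps_const.rep_eq)+

lemma ord_coeff_mult: "ord_coeff n (F * G) = (\<Sum>i\<le>n. ord_coeff i F * ord_coeff (n - i) G)"
proof (rule mfps_eqI)
  fix k
  have "mfps_coeff (ord_coeff n (F * G)) k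
      = (\<Sum>x\<in>{(a, b). a + b = k}. \<Sum>i\<le>n. mfps_coeff F (fst x) $ i * mfps_coeff G (snd x) $ (n - i))"
    by (simp add: times_mfps.rep_eq fps_sum_nth fps_mult_nth case_prod_beta atLeast0AtMost)
  also have "\<dots> = mfps_coeff (\<Sum>i\<le>n. ord_coeff i F * ord_coeff (n - i) G) k"
    by (subst sum.swap) (simp add: mfps_coeff_sum times_mfps.rep_eq case_prod_beta)
  finally show "mfps_coeff (ord_coeff n (F * G)) k = mfps_coeff (\<Sum>i\<le>n. ord_coeff i F * ord_coeff (n - i) G) k" .
qed

lemma comm_ring_hom_ord_coeff_0: "comm_ring_hom (ord_coeff 0)"
  unfolding ord_coeff_def by (rule comm_ring_hom_map[OF comm_ring_hom_fps_nth_0])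

lemma comm_ring_hom_fps_const: "comm_ring_hom (fps_const :: complex \<Rightarrow> complex fps)"
  by (rule comm_ring_homI) auto

definition const_lift :: "('v, complex) mfps \<Rightarrow> ('v, complex fps) mfps" where
  "const_lift = mfps_map fps_const"

lemma comm_ring_hom_const_lift: "comm_ring_hom const_lift"
  unfolding const_lift_def by (rule comm_ring_hom_map[OF comm_ring_hom_fps_const])

interpretation const_lift: comm_ring_hom const_lift
  by (rule comm_ring_hom_const_lift)

lemma const_lift_var: "const_lift (mfps_var \<alpha>) = mfps_var \<alpha>"
  by (simp add: const_lift_def mfps_map_var[OF comm_ring_hom_fps_const])

lemma const_lift_const: "const_lift (mfps_const c) = mfps_const (fps_const c)"
  by (simp add: const_lift_def mfps_map_const[OF comm_ring_hom_fps_const])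

lemma ord_coeff_const_lift: "ord_coeff n (const_lift g) = (if n = 0 then g else 0)"
  by (rule mfps_eqI) (simp add: const_lift_def)

lemma ord_coeff_twist:
  "ord_coeff n (mfps_twist \<chi> F)
    = (\<Sum>i\<le>n. ord_coeff (n - i) (mfps_twist \<chi> (const_lift (ord_coeff i F))))"
proof (rule mfps_eqI)
  fix k
  have "(\<chi> k * mfps_coeff F k) $ n = (\<Sum>i\<le>n. mfps_coeff F k $ i * \<chi> k $ (n - i))"
    by (subst mult.commute) (simp add: fps_mult_nth atLeast0AtMost)
  then show "mfps_coeff (ord_coeff n (mfps_twist \<chi> F)) k
      = mfps_coeff (\<Sum>i\<le>n. ord_coeff (n - i) (mfps_twist \<chi> (const_lift (ord_coeff i F)))) k"
    by (simp add: mfps_coeff_sum mfps_twist_coeff const_lift_def mult.commute)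
qed

lemma ord_coeff_X_power:
  "ord_coeff k (mfps_const (fps_X ^ n) * F) = (if k < n then 0 else ord_coeff (k - n) F)"
  by (rule mfps_eqI) (simp add: mfps_const_coeff fps_X_power_mult_nth)

lemma ord_coeff_decomp:
  "F = (\<Sum>i<n. mfps_const (fps_X ^ i) * const_lift (ord_coeff i F))
    + mfps_const (fps_X ^ n) * mfps_map (fps_shift n) F"
proof (rule mfps_eqI)
  fix k
  let ?c = "mfps_coeff F k"
  have "?c = (\<Sum>i<n. fps_X ^ i * fps_const (?c $ i)) + fps_X ^ n * fps_shift n ?c"
  proof (rule fps_ext)
    fix j
    have "(\<Sum>i<n. (fps_X ^ i * fps_const (?c $ i)) $ j) = (\<Sum>i<n. if j = i then ?c $ i else 0)"
      by (intro sum.cong refl) (simp add: fps_X_power_mult_nth)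
    then show "?c $ j = ((\<Sum>i<n. fps_X ^ i * fps_const (?c $ i)) + fps_X ^ n * fps_shift n ?c) $ j"
      by (simp add: fps_sum_nth fps_X_power_mult_nth)
  qed
  then show "mfps_coeff F k = mfps_coeff ((\<Sum>i<n. mfps_const (fps_X ^ i) * const_lift (ord_coeff i F))
    + mfps_const (fps_X ^ n) * mfps_map (fps_shift n) F) k"
    by (simp add: mfps_coeff_sum mfps_const_coeff const_lift_def)
qed

locale root_level = level z A Q M + primitive_root z M
  for z :: complex and A :: "'v set" and Q :: "'v \<Rightarrow> 'v \<Rightarrow> int" and M :: nat +
  assumes sym: "\<And>\<alpha> \<beta>. \<alpha> \<in> A \<Longrightarrow> \<beta> \<in> A \<Longrightarrow> Q \<alpha> \<beta> = Q \<beta> \<alpha>"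
begin

text \<open>This is \<open>R\<^sub>m[[q - \<zeta>\<^sub>m]]\<close>, with the two sets of variables exchanged.\<close>

definition B :: "('v, complex fps) mfps set" where
  "B = {F. \<forall>n. ord_coeff n F \<in> S}"

sublocale B: subring_set B
  by unfold_locales
     (auto simp: B_def ord_coeff_1 ord_coeff_diff ord_coeff_mult intro!: S.mem_intros)

lemma const_lift_mem: "g \<in> S \<Longrightarrow> const_lift g \<in> B"
  by (simp add: B_def ord_coeff_const_lift S.zero_mem)

lemma const_mem_B: "(\<And>n. c $ n \<in> ring_gen {z}) \<Longrightarrow> mfps_const c \<in> B"
  by (simp add: B_def ord_coeff_const const_mem)

lemma qexp_mem_B: "mfps_const (qexp z i) \<in> B"
proof (rule const_mem_B)
  have "inverse z \<in> ring_gen {z}"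
    using primitive_root_generates[OF M z_m primitive, of "inverse z"] by (simp add: power_inverse z_m)
  then show "qexp z i $ n \<in> ring_gen {z}" for n
    unfolding qexp_nth[OF z_nonzero]
    by (intro L.mult_mem gbinomial_of_int_mem powi_mem[OF ring_gen_incl] L.subring_set_axioms) auto
qed

lemma X_power_mem_B: "mfps_const (fps_X ^ n) \<in> B"
  by (rule const_mem_B) (simp add: fps_X_power_nth L.zero_mem L.one_mem)

lemma var_mem_B: "\<alpha> \<in> A \<Longrightarrow> mfps_var \<alpha> \<in> B"
  using const_lift_mem[OF var_mem] by (simp add: const_lift_var)

text \<open>The coefficients of the inverse \<open>H\<close> are determined recursively up to the factor \<open>d\<close>, a unit of
  \<open>S\<close>.\<close>

lemma inverse_mem_B:
  assumes "G \<in> B" "ord_coeff 0 G = d" "H * G = 1"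
  shows "H \<in> B"
proof -
  have "ord_coeff n H \<in> S" for n
  proof (induction n rule: less_induct)
    case (less n)
    have "(\<Sum>i\<le>n. ord_coeff i H * ord_coeff (n - i) G) = (if n = 0 then 1 else 0)"
      by (simp add: assms(3) ord_coeff_1 flip: ord_coeff_mult)
    then have "ord_coeff n H * d = (if n = 0 then 1 else 0) - (\<Sum>i<n. ord_coeff i H * ord_coeff (n - i) G)"
      by (simp add: assms(2) lessThan_Suc_atMost[symmetric] algebra_simps)
    also have "\<dots> \<in> S"
      using less assms(1) by (auto simp: B_def intro!: S.mem_intros)
    finally have "ord_coeff n H * d * h \<in> S"
      by (rule S.mult_mem[OF _ h_mem])
    also have "ord_coeff n H * d * h = ord_coeff n H * (h * d)"
      by (simp only: mult_ac)
    finally show ?case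
      by (simp add: h_d)
  qed
  then show ?thesis
    by (simp add: B_def)
qed

text \<open>Modulo \<open>q - \<zeta>\<^sub>m\<close> the rescaling multiplies the variables \<open>t\<^sub>\<alpha>\<^bsup>1/m\<^esup>\<close> by \<open>m\<close>-th roots of unity. It
  thus fixes \<open>t\<^sub>\<alpha>\<close> and the denominator \<open>d\<close>, so that the image of \<open>d\<close> is invertible in
  \<open>R\<^sub>m[[q - \<zeta>\<^sub>m]]\<close>, and the inverse is the image of \<open>h\<close>.\<close>

lemma twist_mem_B:
  assumes \<chi>: "exp_char \<chi>" "\<And>k. \<chi> k = qexp z (a k)" and F: "F \<in> B"
  shows "mfps_twist \<chi> F \<in> B"
proof -
  interpret t: comm_ring_hom "mfps_twist \<chi>"
    by (rule comm_ring_hom_twist[OF \<chi>(1)])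
  interpret o: comm_ring_hom "ord_coeff 0"
    by (rule comm_ring_hom_ord_coeff_0)
  define U where "U = {g. mfps_twist \<chi> (const_lift g) \<in> B}"
  have "subring_set {F. mfps_twist \<chi> F \<in> B}"
    by (rule t.subring_set_vimage[OF B.subring_set_axioms])
  from const_lift.subring_set_vimage[OF this] have U: "subring_set U"
    by (simp add: U_def)
  have var: "mfps_twist \<chi> (mfps_var \<alpha>) = mfps_const (qexp z (a (unit_exp \<alpha>))) * mfps_var \<alpha>" for \<alpha>
    by (simp add: mfps_var_eq_monom mfps_twist_monom \<chi>(2))
  have var_B: "mfps_twist \<chi> (mfps_var \<alpha>) \<in> B" if "\<alpha> \<in> A" for \<alpha>
    unfolding var by (intro B.mult_mem qexp_mem_B var_mem_B that)
  have d: "mfps_twist \<chi> (const_lift d)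
      = 1 - (\<Sum>\<alpha>\<in>A. minus_one_pow (Q \<alpha> \<alpha>) * mfps_twist \<chi> (mfps_var \<alpha>) ^ M)"
    by (simp add: d_def const_lift.hom_minus const_lift.hom_sum const_lift.hom_mult const_lift.hom_power
        const_lift.hom_minus_one_pow const_lift_var t.hom_minus t.hom_sum t.hom_mult t.hom_power
        t.hom_minus_one_pow)
  have "ord_coeff 0 (mfps_twist \<chi> (mfps_var \<alpha>)) ^ M = mfps_var \<alpha> ^ M" for \<alpha>
  proof -
    have "ord_coeff 0 (mfps_var \<alpha>) = mfps_var \<alpha>"
      using ord_coeff_const_lift[of 0 "mfps_var \<alpha>"] by (simp add: const_lift_var)
    moreover have "mfps_const (z powi i) ^ M = (1 :: ('v, complex) mfps)" for i
      by (simp add: powi_m flip: mfps_const.hom_power)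
    ultimately show ?thesis
      by (simp add: var o.hom_mult power_mult_distrib ord_coeff_const qexp_nth[OF z_nonzero])
  qed
  then have d0: "ord_coeff 0 (mfps_twist \<chi> (const_lift d)) = d"
    unfolding d by (simp add: o.hom_minus o.hom_sum o.hom_mult o.hom_power o.hom_minus_one_pow d_def)
  have d_B: "mfps_twist \<chi> (const_lift d) \<in> B"
    unfolding d by (intro B.mem_intros var_B)
  have "mfps_twist \<chi> (const_lift h) * mfps_twist \<chi> (const_lift d) = 1"
    by (simp add: h_d flip: t.hom_mult const_lift.hom_mult)
  then have "h \<in> U"
    unfolding U_def using inverse_mem_B[OF d_B d0] by simp
  moreover have "mfps_const z \<in> U"
    using const_lift_mem[OF z_mem] by (simp add: U_def const_lift_const mfps_twist_const[OF \<chi>(1)])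
  moreover have "mfps_var ` A \<subseteq> U"
    using var_B by (auto simp: U_def const_lift_var)
  ultimately have "S \<subseteq> U"
    unfolding S_def by (intro ring_gen_subset[OF U]) auto
  then have "mfps_twist \<chi> (const_lift (ord_coeff i F)) \<in> B" for i
    using F by (auto simp: U_def B_def)
  then have "ord_coeff j (mfps_twist \<chi> (const_lift (ord_coeff i F))) \<in> S" for i j
    by (simp add: B_def)
  then show ?thesis
    unfolding B_def by (auto simp: ord_coeff_twist[of _ \<chi> F] intro!: S.sum_mem)
qed

text \<open>The \<open>q\<close>-difference equation \<open>f = 1 + T f\<close> yields \<open>f = g + T\<^sup>m f\<close> with \<open>g\<close> integral. As \<open>T\<^sup>m\<close>
  is multiplication by one minus the denominator modulo \<open>q - \<zeta>\<^sub>m\<close>, the coefficient of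
  \<open>(q - \<zeta>\<^sub>m)\<^sup>n\<close> in \<open>f\<close>, multiplied by the denominator, is determined by the previous ones.\<close>

lemma expansion_mem_B: "mfps_map (laurent_expand z) (f_quantum A Q) \<in> B"
proof -
  obtain r :: "'v \<Rightarrow> nat" where r: "inj_on r A"
    using finite_imp_inj_to_nat_seg[OF finite_A] by blast
  interpret e: comm_ring_hom "laurent_expand z"
    by (rule comm_ring_hom_laurent_expand[OF z_nonzero])
  interpret em: comm_ring_hom "mfps_map (laurent_expand z) :: ('v, laurent) mfps \<Rightarrow> _"
    by (rule comm_ring_hom_map[OF e.comm_ring_hom_axioms])
  define f where "f = mfps_map (laurent_expand z) (f_quantum A Q)"
  define y where "y = (\<lambda>\<alpha>. laurent_expand z (q_weight Q \<alpha>))"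
  define \<chi> where "\<chi> = (\<lambda>\<alpha> k. laurent_expand z (qpow (skew_form A r Q \<alpha> k)))"
  define T where "T = qdiff A y \<chi>"
  have \<chi>: "exp_char (\<chi> \<alpha>)" for \<alpha>
  proof -
    have "skew_form A r Q \<alpha> 0 = 0" by (simp add: skew_form_def)
    then show ?thesis
      by (simp add: \<chi>_def exp_char_def skew_form_add qpow_add qpow_0 e.hom_mult)
  qed
  have y_mem: "mfps_const (y \<alpha>) \<in> B" for \<alpha>
    using B.mult_mem[OF B.minus_one_pow_mem qexp_mem_B]
    by (simp add: y_def q_weight_def e.hom_mult e.hom_minus_one_pow laurent_expand_qpow
        mfps_const.hom_mult mfps_const.hom_minus_one_pow)
  have T_mem: "T F \<in> B" if "F \<in> B" for F
    unfolding T_def qdiff_def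
    by (intro B.sum_mem B.mult_mem y_mem var_mem_B twist_mem_B[OF \<chi> _ that, where a = "skew_form A r Q _"])
       (simp_all add: \<chi>_def laurent_expand_qpow)
  have T_pow_mem: "(T ^^ i) F \<in> B" if "F \<in> B" for F i
    by (induction i) (auto intro: T_mem that)
  have T_add: "(T ^^ i) (F + G) = (T ^^ i) F + (T ^^ i) G" for i F G
    by (induction i) (simp_all add: T_def qdiff_add[OF \<chi>])
  have T_const: "(T ^^ i) (mfps_const c * F) = mfps_const c * (T ^^ i) F" for i c F
    by (induction i) (simp_all add: T_def qdiff_const_mult)
  have f: "f = 1 + T f"
    using arg_cong[OF f_quantum_equation[OF finite_A r sym], where f = "mfps_map (laurent_expand z)"]
    by (simp add: f_def T_def y_def \<chi>_def em.hom_add mfps_map_qdiff[OF e.comm_ring_hom_axioms])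
  have "f - (T ^^ i) f \<in> B" for i
  proof (induction i)
    case 0
    show ?case by (simp add: B.zero_mem)
  next
    case (Suc i)
    have "(T ^^ i) f = (T ^^ i) 1 + (T ^^ Suc i) f"
      by (subst f) (simp add: T_add funpow_swap1)
    then have step: "f - (T ^^ Suc i) f = (f - (T ^^ i) f) + (T ^^ i) 1"
      by (simp add: algebra_simps)
    show ?case
      unfolding step by (rule B.add_mem[OF Suc T_pow_mem[OF B.one_mem]])
  qed
  then have diff: "f - (T ^^ M) f \<in> B" .
  have T0: "ord_coeff 0 ((T ^^ M) F) = (\<Sum>\<alpha>\<in>A. minus_one_pow (Q \<alpha> \<alpha>) * mfps_var \<alpha> ^ M) * ord_coeff 0 F" for F
  proof -
    let ?T0 = "qdiff A (\<lambda>\<alpha>. at_root z (q_weight Q \<alpha>)) (\<lambda>\<alpha> k. at_root z (qpow (skew_form A r Q \<alpha> k)))"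
    have "ord_coeff 0 (T F) = ?T0 (ord_coeff 0 F)" for F
      by (simp add: ord_coeff_def T_def y_def \<chi>_def at_root_def mfps_map_qdiff[OF comm_ring_hom_fps_nth_0])
    then have "ord_coeff 0 ((T ^^ i) F) = (?T0 ^^ i) (ord_coeff 0 F)" for i
      by (induction i) simp_all
    then show ?thesis
      using qdiff_power_at_root[OF finite_A r sym] by simp
  qed
  have "ord_coeff n f \<in> S" for n
  proof (induction n rule: less_induct)
    case (less n)
    \<comment> \<open>\<open>P\<close> is integral by induction; \<open>ord_coeff n f\<close> is the constant coefficient of the rest \<open>F\<close>.\<close>
    define P where "P = (\<Sum>i<n. mfps_const (fps_X ^ i) * const_lift (ord_coeff i f))"
    define F where "F = mfps_map (fps_shift n) f"
    have P: "P \<in> B"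
      unfolding P_def by (intro B.sum_mem B.mult_mem X_power_mem_B const_lift_mem less) simp
    have decomp: "f = P + mfps_const (fps_X ^ n) * F"
      unfolding P_def F_def by (rule ord_coeff_decomp)
    have F0: "ord_coeff 0 F = ord_coeff n f"
      by (rule mfps_eqI) (simp add: F_def)
    have "ord_coeff n ((T ^^ M) f) = ord_coeff n ((T ^^ M) P) + ord_coeff 0 ((T ^^ M) F)"
      by (subst decomp) (simp add: T_add T_const ord_coeff_add ord_coeff_X_power)
    then have "ord_coeff n f * d = ord_coeff n (f - (T ^^ M) f) + ord_coeff n ((T ^^ M) P)"
      unfolding T0 F0 by (simp add: d_def ord_coeff_diff algebra_simps)
    also have "\<dots> \<in> S"
      using diff T_pow_mem[OF P] by (intro S.add_mem) (auto simp: B_def)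
    finally have "ord_coeff n f * d * h \<in> S"
      by (rule S.mult_mem[OF _ h_mem])
    also have "ord_coeff n f * d * h = ord_coeff n f * (h * d)"
      by (simp only: mult_ac)
    finally show ?case
      by (simp add: h_d)
  qed
  then show ?thesis
    by (simp add: B_def f_def)
qed

lemma habiro_expansion_mem:
  assumes "\<zeta> M = z"
  shows "habiro_expansion \<zeta> (f_quantum A Q) M $ n \<in> S"
proof -
  have "habiro_expansion \<zeta> (f_quantum A Q) M $ n
      = ord_coeff n (mfps_map (laurent_expand z) (f_quantum A Q))"
    by (rule mfps_eqI) (simp add: habiro_expansion_def assms)
  then show ?thesis
    using expansion_mem_B by (simp add: B_def)
qed

end

theorem theorem1p11:
  fixes A :: "'v set" and Q :: "'v \<Rightarrow> 'v \<Rightarrow> int" and \<zeta> :: "nat \<Rightarrow> complex"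
  assumes "finite A"
    and "\<And>\<alpha> \<beta>. \<alpha> \<in> A \<Longrightarrow> \<beta> \<in> A \<Longrightarrow> Q \<alpha> \<beta> = Q \<beta> \<alpha>"
    and "compatible_roots_of_unity \<zeta>"
  shows "etale_over (Zt A) (R_classical A Q)
    \<and> habiro_expansion \<zeta> (f_quantum A Q) \<in> habiro_ring \<zeta> A (R_classical A Q)"
proof
  show "etale_over (Zt A) (R_classical A Q)"
    by (rule etale_R_classical)
next
  interpret compatible_roots \<zeta>
    by unfold_locales (rule assms(3))
  let ?f = "habiro_expansion \<zeta> (f_quantum A Q)"
  have root_level: "root_level (\<zeta> m) A Q m" if "m \<ge> 1" for m
    using that assms(1,2) root_power root_primitive by unfold_locales auto
  have mem: "?f m $ n \<in> level.S (\<zeta> m) A Q m" if "m \<ge> 1" for m n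
    by (rule root_level.habiro_expansion_mem[where \<zeta> = \<zeta> and z = "\<zeta> m" and M = m, OF root_level[OF that] refl])
  have "?f m $ n \<in> carrier (level_ring \<zeta> A (R_classical A Q) m)" if "m \<ge> 1" for m n
  proof -
    interpret root_level "\<zeta> m" A Q m by (rule root_level[OF that])
    show ?thesis
      using mem[OF that] by (simp add: level_ring_eq)
  qed
  moreover have "habiro_glued \<zeta> A (R_classical A Q) p m (?f m) (?f (p * m))"
    if m: "m \<ge> 1" and p: "prime p" for m p
  proof -
    have p1: "p \<ge> 1" using prime_ge_1_nat[OF p] .
    have pm: "p * m \<ge> 1" using mult_le_mono[OF p1 m] by simp
    interpret level_m: level "\<zeta> m" A Q m
      by unfold_locales (use assms(1) m in auto)
    interpret frobenius_level "\<zeta> (p * m)" A Q "p * m" p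
      by unfold_locales (use assms(1) pm p in auto)
    have \<zeta>_m: "\<zeta> m \<in> ring_gen {\<zeta> (p * m)}"
      using root_inverse_mem(1)[OF pm _ m] by simp
    have "level_m.S \<subseteq> {F. \<psi> F \<in> S}"
      unfolding level_m.S_def
    proof (rule ring_gen_subset[OF subring_set_vimage[OF S.subring_set_axioms]])
      have "\<psi> level_m.h = h"
        unfolding level_m.h_def h_def by (rule subst_power_level_embed[OF p1 m])
      moreover have "\<psi> (mfps_var \<alpha>) \<in> S" if "\<alpha> \<in> A" for \<alpha>
        unfolding mfps_subst_power_var[OF p1] by (intro S.power_mem var_mem that)
      ultimately show "insert level_m.h (mfps_var ` A \<union> {mfps_const (\<zeta> m)}) \<subseteq> {F. \<psi> F \<in> S}"
        using h_mem const_mem[OF \<zeta>_m] by (auto simp: mfps_subst_power_const[OF p1])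
    qed
    then have F: "\<psi> (?f m $ i) \<in> S" for i
      using mem[OF m, of i] by blast
    have c: "\<zeta> (p * m) - \<zeta> m \<in> ring_gen {\<zeta> (p * m)}"
      by (intro L.diff_mem \<zeta>_m ring_gen_incl) simp
    show ?thesis
      by (rule habiro_gluedI[OF refl refl c F mem[OF pm] expansion_converges[OF p m]])
  qed
  ultimately show "?f \<in> habiro_ring \<zeta> A (R_classical A Q)"
    by (auto simp: habiro_ring_def)
qed

end
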